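(* Let $n$ be a positive integer and let $\Omega\subseteq\mathbb{R}^n$ be a bounded extension domain. For every $\varepsilon\in(0,1)$ let $E_\varepsilon:L^2(\Omega)\to[0,+\infty]$ and $E_\varepsilon^{**}:L^2(\Omega)\to[0,+\infty]$ be defined by $$E_\varepsilon(u):=\int_\Omega \varphi_\varepsilon(|\nabla u(x)|)\,dx,\qquad E_\varepsilon^{**}(u):=\int_\Omega \varphi_\varepsilon^{**}(|\nabla u(x)|)\,dx\qquad\text{if }u\in H^1(\Omega),$$ and $E_\varepsilon(u)=E_\varepsilon^{**}(u)=+\infty$ if $u\in L^2(\Omega)\setminus H^1(\Omega)$, where $$\varphi_\varepsilon(\sigma):=\frac{1}{2\varepsilon|\log\varepsilon|}\log(1+\sigma^2)+\frac{\varepsilon}{4}\sigma^2,\qquad \sigma\in\mathbb{R},$$ and $\varphi_\varepsilon^{**}$ is the convexification of $\varphi_\varepsilon$. Then: (1) (Gamma-convergence) With respect to the topology of $L^2(\Omega)$, for every $u\in L^2(\Omega)$, $$\Gamma\text{-}\lim_{\varepsilon\to0^+}E_\varepsilon(u)=\Gamma\text{-}\lim_{\varepsilon\to0^+}E_\varepsilon^{**}(u)=TV(u).$$ (2) (Compactness) Let $\{u_\varepsilon\}_{\varepsilon\in(0,1)}\subseteq L^2(\Omega)$ be a family of functions such that $$\sup_{\varepsilon\in(0,1)}\left\{\|u_\varepsilon\|_{L^\infty(\Omega)}+E_\varepsilon^{**}(u_\varepsilon)\right\}<+\infty.$$ Then the family $\{u_\varepsilon\}$ is relatively compact in $L^2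(\Omega)$.
   Context: Extension domain: an open set $\Omega\subseteq\mathbb{R}^n$ is an extension domain if $\partial\Omega$ is bounded and, for every open set $A\supseteq\overline{\Omega}$ and every integer $m\ge1$, there is a linear continuous extension operator $T$ from the ($L^1$-based) space $[BV(\Omega)]^m$ to $[BV(\mathbb{R}^n)]^m$ such that (a) $Tu=0$ a.e. in $\mathbb{R}^n\setminus A$ for every $u\in[BV(\Omega)]^m$; (b) $|D(Tu)|(\partial\Omega)=0$ for every $u\in[BV(\Omega)]^m$; (c) for every $p\in[1,+\infty]$ the restriction of $T$ to $[W^{1,p}(\Omega)]^m$ is a linear continuous map into $[W^{1,p}(\mathbb{R}^n)]^m$. Every bounded open set with Lipschitz boundary is an extension domain. The convexification $\varphi_\varepsilon^{**}$ is the largest convex function on $\mathbb{R}$ that is $\le\varphi_\varepsilon$. $TV(u)\in[0,+\infty]$ denotes the total variation of $u$ in $\Omega$, regarded as defined for every $u\in L^2(\Omega)$: $TV(u)=\sup\{\int_\Omega u\,\mathrm{div}\,\phi\,dx:\ \phi\in C^1_c(\Omega;\mathbb{R}^n),\ |\phi|\le1\}$ (finite or $+\infty$). Gamma-convergence: functionals $F_\varepsilon:L^2(\Omega)\to[0,+\infty]$ satisfy $\Gamma\text{-}\lim_{\varepsilon\to0^+}F_\varepsilon(u)=F(u)$ for all $u$ if for every $u\in L^2(\Omega)$: (i) $\liminf_{\varepsilon\to0^+}F_\varepsilon(u_\varepsilon)\ge F(u)$ for every family $u_\varepsilon\to u$ in $L^2(\Omega)$; (ii) there is a family $u_\varepsilon\to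 u$ in $L^2(\Omega)$ with $\limsup_{\varepsilon\to0^+}F_\varepsilon(u_\varepsilon)\le F(u)$. In (2), $\|u\|_{L^\infty(\Omega)}=+\infty$ if $u\notin L^\infty(\Omega)$. *)

theory Defs
  imports "HOL-Analysis.Analysis" "HOL-Probability.Essential_Supremum"
begin

section \<open>Lebesgue spaces\<close>

text \<open>
  Elements of function spaces on \<open>\<Omega>\<close> are represented by total functions; only the values on \<open>\<Omega>\<close>
  matter, up to null sets. No quotient is formed, so the norms below are seminorms on functions.
\<close>

definition Lp_norm :: "ennreal \<Rightarrow> 'a measure \<Rightarrow> ('a \<Rightarrow> 'b::real_normed_vector) \<Rightarrow> ennreal" where
  "Lp_norm p M u =
    (if p = \<infinity> then esssup M (\<lambda>x. ennreal (norm (u x)))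
     else let I = (\<integral>\<^sup>+ x. ennreal (norm (u x) powr enn2real p) \<partial>M)
          in if I = \<infinity> then \<infinity> else ennreal (enn2real I powr (1 / enn2real p)))"

definition Lp :: "ennreal \<Rightarrow> 'a measure \<Rightarrow> ('a \<Rightarrow> 'b::real_normed_vector) set" where
  "Lp p M = {u \<in> borel_measurable M. Lp_norm p M u < \<infinity>}"

abbreviation L2 :: "(real^'n) set \<Rightarrow> (real^'n \<Rightarrow> real) set" where
  "L2 \<Omega> \<equiv> Lp 2 (lebesgue_on \<Omega>)"

text \<open>
  The topology of the \<open>L\<^sup>2\<close> seminorm on functions. Its open sets are unions of classes of almost
  everywhere equal functions, hence they correspond to the open sets of the quotient Hilbert space.
\<close>

definition L2_topology :: "(real^'n) set \<Rightarrow> (real^'n \<Rightarrow> real) topology" where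
  "L2_topology \<Omega> = topology (\<lambda>U. U \<subseteq> L2 \<Omega> \<and>
     (\<forall>u\<in>U. \<exists>r>0::real. \<forall>v\<in>L2 \<Omega>.
        Lp_norm 2 (lebesgue_on \<Omega>) (\<lambda>x. v x - u x) < ennreal r \<longrightarrow> v \<in> U))"

lemma openin_L2_topology:
  fixes \<Omega> :: "(real^'n) set"
  shows "openin (L2_topology \<Omega>) U \<longleftrightarrow> U \<subseteq> L2 \<Omega> \<and>
     (\<forall>u\<in>U. \<exists>r>0::real. \<forall>v\<in>L2 \<Omega>.
        Lp_norm 2 (lebesgue_on \<Omega>) (\<lambda>x. v x - u x) < ennreal r \<longrightarrow> v \<in> U)"
proof -
  define N where "N v u = Lp_norm 2 (lebesgue_on \<Omega>) (\<lambda>x. v x - u x)" for u v :: "real^'n \<Rightarrow> real"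
  define P where "P U \<longleftrightarrow> U \<subseteq> L2 \<Omega> \<and>
    (\<forall>u\<in>U. \<exists>r>0::real. \<forall>v\<in>L2 \<Omega>. N v u < ennreal r \<longrightarrow> v \<in> U)" for U
  have Int: "P (S \<inter> T)" if S: "P S" and T: "P T" for S T
    unfolding P_def
  proof (intro conjI ballI)
    show "S \<inter> T \<subseteq> L2 \<Omega>" using S unfolding P_def by blast
    fix u assume u: "u \<in> S \<inter> T"
    obtain r where r: "r > 0" "\<And>v. v \<in> L2 \<Omega> \<Longrightarrow> N v u < ennreal r \<Longrightarrow> v \<in> S"
      using S u unfolding P_def by blast
    obtain s where s: "s > 0" "\<And>v. v \<in> L2 \<Omega> \<Longrightarrow> N v u < ennreal s \<Longrightarrow> v \<in> T"
      using T u unfolding P_def by blast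
    show "\<exists>r>0. \<forall>v\<in>L2 \<Omega>. N v u < ennreal r \<longrightarrow> v \<in> S \<inter> T"
    proof (intro exI conjI ballI impI)
      show "min r s > 0" using r(1) s(1) by simp
      fix v assume v: "v \<in> L2 \<Omega>" "N v u < ennreal (min r s)"
      have "N v u < ennreal r" "N v u < ennreal s"
        using v(2) by (rule order_less_le_trans, simp add: ennreal_leI)+
      then show "v \<in> S \<inter> T" using r(2) s(2) v(1) by blast
    qed
  qed
  have Un: "P (\<Union>K)" if K: "\<And>S. S \<in> K \<Longrightarrow> P S" for K
    unfolding P_def
  proof (intro conjI ballI)
    show "\<Union>K \<subseteq> L2 \<Omega>" using K unfolding P_def by blast
    fix u assume "u \<in> \<Union>K"
    then obtain S where S: "S \<in> K" "u \<in> S" by blast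
    then obtain r where "r > 0" "\<And>v. v \<in> L2 \<Omega> \<Longrightarrow> N v u < ennreal r \<Longrightarrow> v \<in> S"
      using K[OF S(1)] unfolding P_def by blast
    then show "\<exists>r>0. \<forall>v\<in>L2 \<Omega>. N v u < ennreal r \<longrightarrow> v \<in> \<Union>K"
      using S(1) by blast
  qed
  have "istopology P"
    unfolding istopology_def using Int Un by simp
  then have "openin (topology P) U \<longleftrightarrow> P U"
    by (simp add: topology_inverse')
  then show ?thesis
    unfolding L2_topology_def P_def N_def .
qed

lemma topspace_L2_topology [simp]: "topspace (L2_topology \<Omega>) = L2 \<Omega>"
proof (rule subset_antisym)
  show "topspace (L2_topology \<Omega>) \<subseteq> L2 \<Omega>"
    using openin_topspace[of "L2_topology \<Omega>"] unfolding openin_L2_topology by (rule conjunct1)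
  have "openin (L2_topology \<Omega>) (L2 \<Omega>)"
    unfolding openin_L2_topology using zero_less_one by blast
  then show "L2 \<Omega> \<subseteq> topspace (L2_topology \<Omega>)"
    by (rule openin_subset)
qed


section \<open>Test functions, total variation and \<open>BV\<close>\<close>

text \<open>Functions in \<open>C\<^sup>1\<^sub>c(\<Omega>)\<close>, extended by zero to the whole space.\<close>

definition C1c :: "(real^'n) set \<Rightarrow> (real^'n \<Rightarrow> 'b::real_normed_vector) set" where
  "C1c \<Omega> = {\<phi>. (\<forall>x. \<phi> differentiable (at x)) \<and>
      (\<forall>v. continuous_on UNIV (\<lambda>x. frechet_derivative \<phi> (at x) v)) \<and>
      compact (closure {x. \<phi> x \<noteq> 0}) \<and> closure {x. \<phi> x \<noteq> 0} \<subseteq> \<Omega>}"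

definition divergence :: "(real^'n \<Rightarrow> real^'n) \<Rightarrow> real^'n \<Rightarrow> real" where
  "divergence \<phi> x = (\<Sum>i\<in>UNIV. frechet_derivative \<phi> (at x) (axis i 1) $ i)"

text \<open>
  The coercion \<^const>\<open>ennreal\<close> sends negative numbers to \<open>0\<close>; this does not change the suprema
  below, since \<open>\<phi> = 0\<close> is admissible.
\<close>

definition TV :: "(real^'n) set \<Rightarrow> (real^'n \<Rightarrow> real) \<Rightarrow> ennreal" where
  "TV \<Omega> u = (SUP \<phi>\<in>{\<phi>\<in>C1c \<Omega>. \<forall>x. norm (\<phi> x) \<le> 1}.
     ennreal (\<integral>x. u x * divergence \<phi> x \<partial>lebesgue_on \<Omega>))"

text \<open>
  The variation \<open>|Du|(\<Omega>)\<close> of a function with \<open>m\<close> components \<open>u 0, \<dots>, u (m - 1)\<close>; the matrix-valued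
  test fields are measured in the Euclidean (Frobenius) norm.
\<close>

definition variation ::
    "nat \<Rightarrow> (real^'n) set \<Rightarrow> (nat \<Rightarrow> real^'n \<Rightarrow> real) \<Rightarrow> ennreal" where
  "variation m \<Omega> u =
     (SUP \<phi>\<in>{\<phi>. (\<forall>j<m. \<phi> j \<in> C1c \<Omega>) \<and> (\<forall>x. (\<Sum>j<m. (norm (\<phi> j x))\<^sup>2) \<le> 1)}.
       ennreal (\<Sum>j<m. \<integral>x. u j x * divergence (\<phi> j) x \<partial>lebesgue_on \<Omega>))"

text \<open>
  The variation measure \<open>|Du|\<close> of \<open>u\<close> on Borel subsets \<open>B\<close> of the whole space: the Borel measure
  whose value on open sets is given by \<^const>\<open>variation\<close>, extended by outer regularity.
\<close>

definition variation_measure ::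
    "nat \<Rightarrow> (nat \<Rightarrow> real^'n \<Rightarrow> real) \<Rightarrow> (real^'n) set \<Rightarrow> ennreal" where
  "variation_measure m u B = (INF A\<in>{A. open A \<and> B \<subseteq> A}. variation m A u)"

definition BV :: "(real^'n) set \<Rightarrow> (real^'n \<Rightarrow> real) set" where
  "BV \<Omega> = {u \<in> Lp 1 (lebesgue_on \<Omega>). TV \<Omega> u < \<infinity>}"

definition BV_norm :: "(real^'n) set \<Rightarrow> (real^'n \<Rightarrow> real) \<Rightarrow> ennreal" where
  "BV_norm \<Omega> u = Lp_norm 1 (lebesgue_on \<Omega>) u + TV \<Omega> u"


section \<open>Sobolev spaces\<close>

definition locally_integrable ::
    "(real^'n) set \<Rightarrow> (real^'n \<Rightarrow> 'b::{banach, second_countable_topology}) \<Rightarrow> bool" where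
  "locally_integrable \<Omega> u \<longleftrightarrow> (\<forall>K. compact K \<and> K \<subseteq> \<Omega> \<longrightarrow> set_integrable lebesgue K u)"

definition has_weak_gradient ::
    "(real^'n) set \<Rightarrow> (real^'n \<Rightarrow> real) \<Rightarrow> (real^'n \<Rightarrow> real^'n) \<Rightarrow> bool" where
  "has_weak_gradient \<Omega> u g \<longleftrightarrow> locally_integrable \<Omega> u \<and> locally_integrable \<Omega> g \<and>
     (\<forall>\<phi>\<in>C1c \<Omega>. \<forall>i.
        (\<integral>x. u x * frechet_derivative \<phi> (at x) (axis i 1) \<partial>lebesgue_on \<Omega>) =
        - (\<integral>x. g x $ i * \<phi> x \<partial>lebesgue_on \<Omega>))"

text \<open>Weak gradients are unique up to null sets; one representative is chosen.\<close>

definition weak_grad :: "(real^'n) set \<Rightarrow> (real^'n \<Rightarrow> real) \<Rightarrow> real^'n \<Rightarrow> real^'n" where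
  "weak_grad \<Omega> u = (SOME g. has_weak_gradient \<Omega> u g)"

definition W1p :: "ennreal \<Rightarrow> (real^'n) set \<Rightarrow> (real^'n \<Rightarrow> real) set" where
  "W1p p \<Omega> = {u \<in> Lp p (lebesgue_on \<Omega>). \<exists>g \<in> Lp p (lebesgue_on \<Omega>). has_weak_gradient \<Omega> u g}"

definition W1p_norm :: "ennreal \<Rightarrow> (real^'n) set \<Rightarrow> (real^'n \<Rightarrow> real) \<Rightarrow> ennreal" where
  "W1p_norm p \<Omega> u =
     Lp_norm p (lebesgue_on \<Omega>) u + Lp_norm p (lebesgue_on \<Omega>) (weak_grad \<Omega> u)"

abbreviation H1 :: "(real^'n) set \<Rightarrow> (real^'n \<Rightarrow> real) set" where
  "H1 \<Omega> \<equiv> W1p 2 \<Omega>"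


section \<open>Extension domains\<close>

text \<open>
  \<open>m\<close>-fold product spaces consist of sequences \<open>u\<close> of which only the components \<open>u j\<close> with \<open>j < m\<close>
  are relevant, normed by the sum of the component norms.
\<close>

definition prod_space :: "nat \<Rightarrow> 'f set \<Rightarrow> (nat \<Rightarrow> 'f) set" where
  "prod_space m S = {u. \<forall>j<m. u j \<in> S}"

definition prod_norm :: "nat \<Rightarrow> ('f \<Rightarrow> ennreal) \<Rightarrow> (nat \<Rightarrow> 'f) \<Rightarrow> ennreal" where
  "prod_norm m N u = (\<Sum>j<m. N (u j))"

text \<open>
  Linearity is required up to null sets. Together with the bound it also makes \<open>T\<close> compatible with
  equality almost everywhere on \<open>\<Omega>\<close> of the components \<open>u j\<close> with \<open>j < m\<close>.
\<close>

definition bounded_linear_BV ::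
    "nat \<Rightarrow> (real^'n) set \<Rightarrow> ((nat \<Rightarrow> real^'n \<Rightarrow> real) \<Rightarrow> nat \<Rightarrow> real^'n \<Rightarrow> real) \<Rightarrow> bool" where
  "bounded_linear_BV m \<Omega> T \<longleftrightarrow>
     (\<forall>u\<in>prod_space m (BV \<Omega>). T u \<in> prod_space m (BV UNIV)) \<and>
     (\<forall>u\<in>prod_space m (BV \<Omega>). \<forall>v\<in>prod_space m (BV \<Omega>). \<forall>a b. \<forall>j<m.
        AE x in lebesgue. T (\<lambda>i y. a * u i y + b * v i y) j x = a * T u j x + b * T v j x) \<and>
     (\<exists>C::real. \<forall>u\<in>prod_space m (BV \<Omega>).
        prod_norm m (BV_norm UNIV) (T u) \<le> ennreal C * prod_norm m (BV_norm \<Omega>) u)"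

text \<open>
  In the last clause \<open>T\<close> is only applied to elements of \<open>W\<^sup>1\<^sup>,\<^sup>p\<close> that are also in \<open>BV\<close>. This is no
  restriction for bounded \<open>\<Omega>\<close>.
\<close>

definition extension_domain :: "(real^'n) set \<Rightarrow> bool" where
  "extension_domain \<Omega> \<longleftrightarrow> open \<Omega> \<and> bounded (frontier \<Omega>) \<and>
     (\<forall>A m. open A \<and> closure \<Omega> \<subseteq> A \<and> m \<ge> 1 \<longrightarrow>
       (\<exists>T. bounded_linear_BV m \<Omega> T \<and>
          (\<forall>u\<in>prod_space m (BV \<Omega>). \<forall>j<m. AE x in lebesgue. x \<in> \<Omega> \<longrightarrow> T u j x = u j x) \<and>
          (\<forall>u\<in>prod_space m (BV \<Omega>). \<forall>j<m. AE x in lebesgue. x \<notin> A \<longrightarrow> T u j x = 0) \<and>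
          (\<forall>u\<in>prod_space m (BV \<Omega>). variation_measure m (T u) (frontier \<Omega>) = 0) \<and>
          (\<forall>p\<ge>1. \<exists>C::real. \<forall>u\<in>prod_space m (W1p p \<Omega> \<inter> BV \<Omega>).
             T u \<in> prod_space m (W1p p UNIV) \<and>
             prod_norm m (W1p_norm p UNIV) (T u) \<le> ennreal C * prod_norm m (W1p_norm p \<Omega>) u)))"


section \<open>The functionals\<close>

definition phi :: "real \<Rightarrow> real \<Rightarrow> real" where
  "phi \<epsilon> \<sigma> = 1 / (2 * \<epsilon> * \<bar>ln \<epsilon>\<bar>) * ln (1 + \<sigma>\<^sup>2) + \<epsilon> / 4 * \<sigma>\<^sup>2"

text \<open>The largest convex function below \<open>f\<close>, with respect to the pointwise order of functions.\<close>

definition convexification :: "(real \<Rightarrow> real) \<Rightarrow> real \<Rightarrow> real" where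
  "convexification f = (GREATEST g. convex_on UNIV g \<and> g \<le> f)"

lemma convexification_greatest:
  fixes f g0 :: "real \<Rightarrow> real"
  assumes "convex_on UNIV g0" "g0 \<le> f"
  shows "convex_on UNIV (convexification f)" "convexification f \<le> f"
    and "\<And>g. convex_on UNIV g \<Longrightarrow> g \<le> f \<Longrightarrow> g \<le> convexification f"
proof -
  define K where "K = {g. convex_on UNIV g \<and> g \<le> f}"
  define h where "h x = (SUP g\<in>K. g x)" for x
  have ne: "K \<noteq> {}" using assms by (auto simp: K_def)
  have bdd: "bdd_above ((\<lambda>g. g x) ` K)" for x
    by (rule bdd_aboveI[of _ "f x"]) (auto simp: K_def le_fun_def)
  have upper: "g x \<le> h x" if "g \<in> K" for g x
    unfolding h_def by (rule cSUP_upper[OF that bdd])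
  have "convex_on UNIV h"
  proof (rule convex_onI)
    fix t x y :: real assume t: "0 < t" "t < 1"
    show "h ((1 - t) *\<^sub>R x + t *\<^sub>R y) \<le> (1 - t) * h x + t * h y"
      unfolding h_def[of "(1 - t) *\<^sub>R x + t *\<^sub>R y"]
    proof (rule cSUP_least[OF ne])
      fix g assume g: "g \<in> K"
      have "g ((1 - t) *\<^sub>R x + t *\<^sub>R y) \<le> (1 - t) * g x + t * g y"
        using g t by (intro convex_onD[of UNIV]) (auto simp: K_def)
      also have "\<dots> \<le> (1 - t) * h x + t * h y"
        using t upper[OF g] by (intro add_mono mult_left_mono) auto
      finally show "g ((1 - t) *\<^sub>R x + t *\<^sub>R y) \<le> (1 - t) * h x + t * h y" .
    qed
  qed simp
  moreover have "h \<le> f"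
    unfolding le_fun_def h_def
  proof
    show "(SUP g\<in>K. g x) \<le> f x" for x
      by (rule cSUP_least[OF ne]) (simp add: K_def le_fun_def)
  qed
  moreover have least: "g \<le> h" if "convex_on UNIV g \<and> g \<le> f" for g
    using upper that by (auto simp: K_def le_fun_def)
  ultimately have h: "convexification f = h"
    unfolding convexification_def by (intro Greatest_equality conjI) simp_all
  show "convex_on UNIV (convexification f)" "convexification f \<le> f"
    unfolding h by fact+
  show "g \<le> convexification f" if "convex_on UNIV g" "g \<le> f" for g
    unfolding h using least that by blast
qed

definition energy :: "(real^'n) set \<Rightarrow> (real \<Rightarrow> real) \<Rightarrow> (real^'n \<Rightarrow> real) \<Rightarrow> ennreal" where
  "energy \<Omega> f u =
     (if u \<in> H1 \<Omega> then \<integral>\<^sup>+ x. ennreal (f (norm (weak_grad \<Omega> u x))) \<partial>lebesgue_on \<Omega> else \<infinity>)"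


section \<open>Gamma-convergence as \<open>\<epsilon> \<rightarrow> 0\<^sup>+\<close>\<close>

definition Gamma_converges ::
    "'a topology \<Rightarrow> (real \<Rightarrow> 'a \<Rightarrow> ennreal) \<Rightarrow> ('a \<Rightarrow> ennreal) \<Rightarrow> bool" where
  "Gamma_converges X F G \<longleftrightarrow> (\<forall>u\<in>topspace X.
     (\<forall>v. (\<forall>\<epsilon>\<in>{0<..<1}. v \<epsilon> \<in> topspace X) \<and> limitin X v u (at_right 0) \<longrightarrow>
        G u \<le> Liminf (at_right 0) (\<lambda>\<epsilon>. F \<epsilon> (v \<epsilon>))) \<and>
     (\<exists>v. (\<forall>\<epsilon>\<in>{0<..<1}. v \<epsilon> \<in> topspace X) \<and> limitin X v u (at_right 0) \<and>
        Limsup (at_right 0) (\<lambda>\<epsilon>. F \<epsilon> (v \<epsilon>)) \<le> G u))"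

definition relatively_compact_in :: "'a topology \<Rightarrow> 'a set \<Rightarrow> bool" where
  "relatively_compact_in X S \<longleftrightarrow> S \<subseteq> topspace X \<and> compactin X (X closure_of S)"

end

theory Submission
  imports Defs "HOL-Complex_Analysis.Great_Picard" "HOL-Real_Asymp.Real_Asymp" "HOL-Library.Diagonal_Subsequence"
begin

text \<open>
  Since \<open>phi \<epsilon> \<sigma>\<close> lies above \<open>c \<bar>\<sigma>\<bar> - \<epsilon> \<bar>ln \<epsilon>\<bar>\<close> for every \<open>c < 1\<close> and small \<open>\<epsilon>\<close>, so does its
  convexification, and the lower bound follows from the lower semicontinuity of the total variation.

  For the upper bound, \<open>u\<close> is extended to a \<open>BV\<close> function on the whole space that charges no mass on
  the boundary of \<open>\<Omega>\<close>; mollifying and truncating it gives \<open>C\<^sup>1\<close> functions \<open>f\<close> that approximate \<open>u\<close> in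
  \<open>L\<^sup>2\<close> with \<open>\<integral>\<bar>\<nabla>f\<bar>\<close> close to \<open>TV \<Omega> u\<close>. Such an \<open>f\<close> is replaced by a staircase with steps of height
  \<open>\<epsilon>\<close>, whose risers have slope \<open>2 / \<epsilon>\<close>, where \<open>phi \<epsilon> \<sigma> / \<sigma>\<close> is almost \<open>1\<close>.

  For the compactness, the energies bound the total variations, the extensions satisfy
  \<open>\<integral>\<bar>w (x + h) - w x\<bar> dx \<le> \<bar>h\<bar> TV UNIV w\<close>, hence they are uniformly close to their mollifications,
  to which the theorem of Arzela and Ascoli applies; the \<open>L\<^sup>\<infinity>\<close> bound upgrades \<open>L\<^sup>1\<close> to \<open>L\<^sup>2\<close>.
\<close>

section \<open>Continuously differentiable functions and cutoffs\<close>

text \<open>The slope \<open>2 / \<epsilon>\<close> comes from balancing the two terms of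
  \<open>phi \<epsilon>\<close>. For \<sigma> of order 1/\<epsilon> the logarithmic term is about
  1/\<epsilon>, and 1/\<epsilon> + \<epsilon> \<sigma>^2 / 4 >= \<sigma> with equality at \<sigma> =
  2/\<epsilon>. At smaller powers \<epsilon>^(-s), s < 1, the logarithm contributes s/\<epsilon>
  only, which is why the constant c stays below 1 and tends to 1 at the end.

  Two obstacles shape the upper bound. A riser of slope 2/\<epsilon> takes up the fraction
  \<epsilon> |grad f| / 2 of its step, which vanishes and is not differentiable at critical points
  of f; a smooth positive majorant of |grad f| takes its place. And a mollification near the
  boundary sees values from outside the domain, so the gradient integral stays close to the
  variation inside only because the extension carries no variation on the boundary itself.

  All auxiliary functions are kept of class C1, like the test functions: cutoffs are built from a
  ramp, mollifiers from cutoffs, and merely continuous fields are replaced by Stone-Weierstrass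
  polynomials.\<close>

definition C1_fun :: "('a::real_normed_vector \<Rightarrow> 'b::real_normed_vector) \<Rightarrow> bool" where
  "C1_fun f \<longleftrightarrow> (\<forall>x. f differentiable (at x)) \<and>
     (\<forall>v. continuous_on UNIV (\<lambda>x. frechet_derivative f (at x) v))"

lemma C1_funI:
  assumes "\<And>x. (f has_derivative D x) (at x)" "\<And>v. continuous_on UNIV (\<lambda>x. D x v)"
  shows "C1_fun f"
proof -
  have "frechet_derivative f (at x) = D x" for x
    using frechet_derivative_at[OF assms(1)] by simp
  then show ?thesis
    using assms unfolding C1_fun_def by (auto simp: differentiable_def)
qed

lemma C1_fun_has_derivative:
  "C1_fun f \<Longrightarrow> (f has_derivative frechet_derivative f (at x)) (at x)"
  by (simp add: C1_fun_def frechet_derivative_works[symmetric])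

lemma C1_fun_continuous_frechet:
  "C1_fun f \<Longrightarrow> continuous_on UNIV (\<lambda>x. frechet_derivative f (at x) v)"
  by (simp add: C1_fun_def)

lemma C1_fun_continuous: "C1_fun f \<Longrightarrow> continuous_on UNIV f"
  by (meson C1_fun_has_derivative continuous_at_imp_continuous_on has_derivative_continuous)

lemma frechet_derivative_eqI:
  "(f has_derivative D) (at x) \<Longrightarrow> frechet_derivative f (at x) = D"
  using frechet_derivative_at by metis

lemma C1_fun_const [simp]: "C1_fun (\<lambda>x. c)"
  by (rule C1_funI[where D="\<lambda>x v. 0"]) auto

lemma C1_fun_bounded_linear: "bounded_linear f \<Longrightarrow> C1_fun f"
  by (rule C1_funI[where D="\<lambda>x. f"])
    (auto simp: bounded_linear_imp_has_derivative)

lemma C1_fun_add: "C1_fun f \<Longrightarrow> C1_fun g \<Longrightarrow> C1_fun (\<lambda>x. f x + g x)"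
  by (rule C1_funI[where D="\<lambda>x v. frechet_derivative f (at x) v + frechet_derivative g (at x) v"])
    (auto intro!: has_derivative_add C1_fun_has_derivative continuous_on_add C1_fun_continuous_frechet)

lemma C1_fun_scaleR:
  assumes "C1_fun f" "C1_fun g"
  shows "C1_fun (\<lambda>x. f x *\<^sub>R g x)"
proof (rule C1_funI)
  show "((\<lambda>x. f x *\<^sub>R g x) has_derivative
      (\<lambda>v. f x *\<^sub>R frechet_derivative g (at x) v + frechet_derivative f (at x) v *\<^sub>R g x)) (at x)" for x
    by (intro has_derivative_scaleR C1_fun_has_derivative assms)
  show "continuous_on UNIV (\<lambda>x. f x *\<^sub>R frechet_derivative g (at x) v + frechet_derivative f (at x) v *\<^sub>R g x)" for v
    using assms by (intro continuous_intros C1_fun_continuous_frechet C1_fun_continuous)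
qed

lemma C1_fun_mult:
  fixes f g :: "'a::real_normed_vector \<Rightarrow> real"
  shows "C1_fun f \<Longrightarrow> C1_fun g \<Longrightarrow> C1_fun (\<lambda>x. f x * g x)"
  using C1_fun_scaleR[of f g] by simp

lemma C1_fun_linear_image:
  assumes "bounded_linear L" "C1_fun f"
  shows "C1_fun (\<lambda>x. L (f x))"
proof (rule C1_funI[where D="\<lambda>x v. L (frechet_derivative f (at x) v)"])
  show "((\<lambda>x. L (f x)) has_derivative (\<lambda>v. L (frechet_derivative f (at x) v))) (at x)" for x
    by (rule bounded_linear.has_derivative[OF assms(1) C1_fun_has_derivative[OF assms(2)]])
  show "continuous_on UNIV (\<lambda>x. L (frechet_derivative f (at x) v))" for v
    by (rule bounded_linear.continuous_on[OF assms(1) C1_fun_continuous_frechet[OF assms(2)]])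
qed

lemma C1_fun_minus: "C1_fun f \<Longrightarrow> C1_fun (\<lambda>x. - f x)"
  by (rule C1_fun_linear_image[OF bounded_linear_minus[OF bounded_linear_ident]])

lemma C1_fun_diff: "C1_fun f \<Longrightarrow> C1_fun g \<Longrightarrow> C1_fun (\<lambda>x. f x - g x)"
  using C1_fun_add[OF _ C1_fun_minus] by fastforce

lemma C1_fun_compose_real:
  fixes p :: "real \<Rightarrow> real" and f :: "'a::real_normed_vector \<Rightarrow> real"
  assumes "\<And>t. (p has_real_derivative p' t) (at t)" "continuous_on UNIV p'" "C1_fun f"
  shows "C1_fun (\<lambda>x. p (f x))"
proof (rule C1_funI[where D="\<lambda>x v. p' (f x) * frechet_derivative f (at x) v"])
  show "((\<lambda>x. p (f x)) has_derivative (\<lambda>v. p' (f x) * frechet_derivative f (at x) v)) (at x)" for x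
    using has_derivative_compose[OF C1_fun_has_derivative[OF assms(3), of x]
        has_field_derivative_imp_has_derivative[OF assms(1)]] by simp
  show "continuous_on UNIV (\<lambda>x. p' (f x) * frechet_derivative f (at x) v)" for v
    using continuous_on_compose2[OF assms(2) C1_fun_continuous[OF assms(3)]]
      C1_fun_continuous_frechet[OF assms(3)] by (intro continuous_intros) auto
qed

lemma C1_fun_real_polynomial: "real_polynomial_function p \<Longrightarrow> C1_fun p"
  by (induction rule: real_polynomial_function.induct)
    (auto intro: C1_fun_bounded_linear C1_fun_add C1_fun_mult)

lemma C1_fun_sum: "finite I \<Longrightarrow> (\<And>i. i \<in> I \<Longrightarrow> C1_fun (f i)) \<Longrightarrow> C1_fun (\<lambda>x. \<Sum>i\<in>I. f i x)"
  by (induction rule: finite_induct) (auto intro: C1_fun_add)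

text \<open>Polynomials are the source of explicit C1 functions: Stone-Weierstrass turns a merely
  continuous field on a compact set into one that may enter a test function.\<close>

lemma C1_fun_polynomial:
  fixes p :: "'a::real_normed_vector \<Rightarrow> 'b::euclidean_space"
  assumes "polynomial_function p"
  shows "C1_fun p"
proof -
  have "C1_fun (\<lambda>x. \<Sum>b\<in>Basis. (p x \<bullet> b) *\<^sub>R b)"
  proof (rule C1_fun_sum[OF finite_Basis])
    fix b :: 'b assume "b \<in> Basis"
    then have "real_polynomial_function (\<lambda>x. p x \<bullet> b)"
      using assms polynomial_function_iff_Basis_inner by blast
    then show "C1_fun (\<lambda>x. (p x \<bullet> b) *\<^sub>R b)"
      by (intro C1_fun_scaleR C1_fun_const C1_fun_real_polynomial)
  qed
  then show ?thesis by (simp add: euclidean_representation)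
qed

section \<open>Test functions: supports, bounds and closure properties\<close>

lemma C1c_iff:
  "\<phi> \<in> C1c U \<longleftrightarrow> C1_fun \<phi> \<and> compact (closure {x. \<phi> x \<noteq> 0}) \<and> closure {x. \<phi> x \<noteq> 0} \<subseteq> U"
  by (auto simp: C1c_def C1_fun_def)

lemma C1cD: "\<phi> \<in> C1c U \<Longrightarrow> C1_fun \<phi>"
  by (simp add: C1c_iff)

lemma C1cI:
  assumes "C1_fun \<phi>" "compact K" "K \<subseteq> U" "\<And>x. x \<notin> K \<Longrightarrow> \<phi> x = 0"
  shows "\<phi> \<in> C1c U"
proof -
  have "closure {x. \<phi> x \<noteq> 0} \<subseteq> K"
    using assms by (intro closure_minimal compact_imp_closed) auto
  moreover have "compact (K \<inter> closure {x. \<phi> x \<noteq> 0})"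
    using assms(2) by (intro compact_Int_closed) auto
  ultimately show ?thesis
    unfolding C1c_iff using assms(1,3) by (auto simp: inf.absorb2)
qed

lemma C1c_mono: "\<phi> \<in> C1c U \<Longrightarrow> U \<subseteq> V \<Longrightarrow> \<phi> \<in> C1c V"
  by (auto simp: C1c_iff)

lemma frechet_derivative_eq_0_outside:
  assumes "closed K" "\<And>x. x \<notin> K \<Longrightarrow> \<phi> x = 0" "x \<notin> K"
  shows "frechet_derivative \<phi> (at x) v = 0"
proof -
  have "(\<phi> has_derivative (\<lambda>_. 0)) (at x)"
    by (rule has_derivative_transform_within_open[where s="- K", OF has_derivative_const])
      (use assms in auto)
  then show ?thesis by (simp add: frechet_derivative_eqI)
qed

text \<open>One compact set serves for both conclusions: the complement of the closed support is
  open, so \<phi> vanishes near each of its points and the derivative vanishes there too.\<close>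

lemma C1cE:
  assumes "\<phi> \<in> C1c U"
  obtains K where "compact K" "K \<subseteq> U" "\<And>x. x \<notin> K \<Longrightarrow> \<phi> x = 0"
    "\<And>x v. x \<notin> K \<Longrightarrow> frechet_derivative \<phi> (at x) v = 0"
proof
  let ?K = "closure {x. \<phi> x \<noteq> 0}"
  show *: "compact ?K" "?K \<subseteq> U" using assms by (auto simp: C1c_iff)
  show 0: "\<phi> x = 0" if "x \<notin> ?K" for x using that closure_subset[of "{x. \<phi> x \<noteq> 0}"] by auto
  show "frechet_derivative \<phi> (at x) v = 0" if "x \<notin> ?K" for x v
    by (rule frechet_derivative_eq_0_outside[OF closed_closure 0 that])
qed

lemma continuous_zero_outside_compact_bounded:
  fixes f :: "'a::t2_space \<Rightarrow> 'b::real_normed_vector"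
  assumes "continuous_on UNIV f" "compact K" "\<And>x. x \<notin> K \<Longrightarrow> f x = 0"
  obtains B where "B > 0" "\<And>x. norm (f x) \<le> B"
proof -
  have "bounded (f ` K)"
    using assms compact_continuous_image compact_imp_bounded continuous_on_subset by (metis subset_UNIV)
  then obtain B where "\<And>x. x \<in> K \<Longrightarrow> norm (f x) \<le> B" "B > 0"
    unfolding bounded_pos by auto
  then have "norm (f x) \<le> B" for x
    using assms(3)[of x] by (cases "x \<in> K") auto
  with \<open>B > 0\<close> that show ?thesis by blast
qed

lemma C1c_bounded:
  assumes "\<phi> \<in> C1c U"
  obtains B where "B > 0" "\<And>x. norm (\<phi> x) \<le> B"
  using assms continuous_zero_outside_compact_bounded[OF C1_fun_continuous] 
  by (metis C1cE C1c_iff)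

text \<open>Continuity of the derivative is available only direction by direction, so the bound is
  obtained on the finitely many basis vectors and then transferred to all \<open>v\<close> by
  linearity.\<close>

lemma C1c_derivative_bounded:
  fixes \<phi> :: "real^'n \<Rightarrow> 'b::real_normed_vector"
  assumes "\<phi> \<in> C1c U"
  obtains B where "B > 0" "\<And>x v. norm (frechet_derivative \<phi> (at x) v) \<le> B * norm v"
proof -
  have C: "C1_fun \<phi>" using assms by (rule C1cD)
  obtain K where K: "compact K" "\<And>x v. x \<notin> K \<Longrightarrow> frechet_derivative \<phi> (at x) v = 0"
    using assms by (metis C1cE)
  have "\<exists>B>0. \<forall>x. norm (frechet_derivative \<phi> (at x) b) \<le> B" for b
    using continuous_zero_outside_compact_bounded[OF C1_fun_continuous_frechet[OF C] K(1), of b] K(2)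
    by metis
  then obtain B where B: "\<And>b. B b > 0" "\<And>b x. norm (frechet_derivative \<phi> (at x) b) \<le> B b"
    by metis
  have "norm (frechet_derivative \<phi> (at x) v) \<le> (\<Sum>b\<in>Basis. B b) * norm v" for x v
  proof -
    interpret D: bounded_linear "frechet_derivative \<phi> (at x)"
      using C1_fun_has_derivative[OF C] has_derivative_bounded_linear by blast
    have "frechet_derivative \<phi> (at x) v = frechet_derivative \<phi> (at x) (\<Sum>b\<in>Basis. (v \<bullet> b) *\<^sub>R b)"
      by (simp add: euclidean_representation)
    also have "\<dots> = (\<Sum>b\<in>Basis. (v \<bullet> b) *\<^sub>R frechet_derivative \<phi> (at x) b)"
      by (simp add: D.sum D.scaleR)
    also have "norm \<dots> \<le> (\<Sum>b\<in>Basis. norm v * B b)"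
      by (rule sum_norm_le) (auto intro!: mult_mono B(2) simp: Basis_le_norm)
    finally show ?thesis by (simp add: sum_distrib_left mult.commute)
  qed
  moreover have "(\<Sum>b\<in>(Basis::(real^'n) set). B b) > 0"
    using B(1) by (intro sum_pos) auto
  ultimately show ?thesis using that by blast
qed

lemma C1c_lipschitz:
  fixes \<phi> :: "real^'n \<Rightarrow> 'b::real_normed_vector"
  assumes "\<phi> \<in> C1c U"
  obtains B where "B > 0" "\<And>x v. norm (frechet_derivative \<phi> (at x) v) \<le> B * norm v"
    "\<And>x y. norm (\<phi> x - \<phi> y) \<le> B * norm (x - y)"
proof -
  obtain B where B: "B > 0" "\<And>x v. norm (frechet_derivative \<phi> (at x) v) \<le> B * norm v"
    using C1c_derivative_bounded[OF assms] by metis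
  have "norm (\<phi> x - \<phi> y) \<le> B * norm (x - y)" for x y
  proof (rule differentiable_bound[OF convex_UNIV, where f'="\<lambda>x. frechet_derivative \<phi> (at x)"])
    show "(\<phi> has_derivative frechet_derivative \<phi> (at x)) (at x)" for x
      using C1_fun_has_derivative[OF C1cD[OF assms]] by blast
    show "onorm (frechet_derivative \<phi> (at x)) \<le> B" for x
      using B by (intro onorm_bound) auto
  qed auto
  with B that show ?thesis by blast
qed

lemma C1c_add:
  assumes "\<phi> \<in> C1c U" "\<psi> \<in> C1c U"
  shows "(\<lambda>x. \<phi> x + \<psi> x) \<in> C1c U"
proof -
  obtain K where K: "compact K" "K \<subseteq> U" "\<And>x. x \<notin> K \<Longrightarrow> \<phi> x = 0" using C1cE[OF assms(1)] by metis
  obtain L where L: "compact L" "L \<subseteq> U" "\<And>x. x \<notin> L \<Longrightarrow> \<psi> x = 0" using C1cE[OF assms(2)] by metis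
  show ?thesis
    by (rule C1cI[where K="K \<union> L"])
      (use K L assms in \<open>auto intro: C1_fun_add compact_Un dest: C1cD\<close>)
qed

lemma C1c_scaleR:
  assumes "C1_fun f" "\<phi> \<in> C1c U"
  shows "(\<lambda>x. f x *\<^sub>R \<phi> x) \<in> C1c U"
proof -
  obtain K where K: "compact K" "K \<subseteq> U" "\<And>x. x \<notin> K \<Longrightarrow> \<phi> x = 0" using C1cE[OF assms(2)] by metis
  show ?thesis
    by (rule C1cI[where K=K]) (use K assms in \<open>auto intro: C1_fun_scaleR dest: C1cD\<close>)
qed

lemma C1c_scaleR':
  assumes "\<zeta> \<in> C1c U" "C1_fun f"
  shows "(\<lambda>x. \<zeta> x *\<^sub>R f x) \<in> C1c U"
proof -
  obtain K where K: "compact K" "K \<subseteq> U" "\<And>x. x \<notin> K \<Longrightarrow> \<zeta> x = 0" using C1cE[OF assms(1)] by metis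
  show ?thesis
    by (rule C1cI[where K=K]) (use K assms in \<open>auto intro: C1_fun_scaleR dest: C1cD\<close>)
qed

lemma C1c_linear_image:
  assumes "bounded_linear L" "\<phi> \<in> C1c U"
  shows "(\<lambda>x. L (\<phi> x)) \<in> C1c U"
proof -
  interpret bounded_linear L by fact
  obtain K where K: "compact K" "K \<subseteq> U" "\<And>x. x \<notin> K \<Longrightarrow> \<phi> x = 0" using C1cE[OF assms(2)] by metis
  show ?thesis
    by (rule C1cI[where K=K]) (use K assms in \<open>auto intro: C1_fun_linear_image dest: C1cD simp: zero\<close>)
qed

text \<open>A smoothed ramp whose slope is the trapezoid of height \<open>1/(1-a)\<close> with corners
  \<open>0, a, 1 - a, 1\<close>.\<close>

definition ramp :: "real \<Rightarrow> real \<Rightarrow> real" where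
  "ramp a r = ((max 0 r)\<^sup>2 - (max 0 (r - a))\<^sup>2 - (max 0 (r - (1 - a)))\<^sup>2 + (max 0 (r - 1))\<^sup>2) / (2 * a * (1 - a))"

definition ramp_slope :: "real \<Rightarrow> real \<Rightarrow> real" where
  "ramp_slope a r = (max 0 r - max 0 (r - a) - max 0 (r - (1 - a)) + max 0 (r - 1)) / (a * (1 - a))"

text \<open>The squared positive part is the simplest kink of class C1: its second derivative jumps,
  its slope does not. A combination of four shifted copies makes up \<open>ramp\<close>.\<close>

lemma has_real_derivative_max_0_power2:
  "((\<lambda>t::real. (max 0 (t - c))\<^sup>2) has_real_derivative 2 * max 0 (t - c)) (at t)"
proof -
  have *: "((\<lambda>t::real. (max 0 t)\<^sup>2) has_real_derivative 2 * max 0 s) (at s)" for s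
  proof -
    consider "s > 0" | "s < 0" | "s = 0" by linarith
    then show ?thesis
    proof cases
      case 1
      have "((\<lambda>t. t\<^sup>2) has_real_derivative 2 * s) (at s)" by (auto intro!: derivative_eq_intros)
      then show ?thesis
        by (rule has_field_derivative_transform_within_open[where S="{0<..}", THEN DERIV_cong]) (use 1 in auto)
    next
      case 2
      have "((\<lambda>t. 0) has_real_derivative 0) (at s)" by simp
      then show ?thesis
        by (rule has_field_derivative_transform_within_open[where S="{..<0}", THEN DERIV_cong]) (use 2 in auto)
    next
      case 3
      have "((\<lambda>h::real. max 0 h) \<longlongrightarrow> 0) (at 0)"
        by (rule tendsto_eq_intros tendsto_max | simp)+
      moreover have "(max 0 h)\<^sup>2 / h = max 0 h" for h :: real
        by (auto simp: max_def power2_eq_square)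
      ultimately show ?thesis using 3 by (simp add: DERIV_def)
    qed
  qed
  show ?thesis
  proof -
    have "((\<lambda>t. t - c) has_real_derivative 1) (at t)" by (auto intro!: derivative_eq_intros)
    from DERIV_chain2[OF * this] show ?thesis by simp
  qed
qed

lemma ramp_has_derivative:
  assumes "0 < a" "a < 1"
  shows "(ramp a has_real_derivative ramp_slope a r) (at r)"
proof -
  have "((\<lambda>r. ((max 0 (r - 0))\<^sup>2 - (max 0 (r - a))\<^sup>2 - (max 0 (r - (1 - a)))\<^sup>2 + (max 0 (r - 1))\<^sup>2) / (2 * a * (1 - a)))
    has_real_derivative (2 * max 0 (r - 0) - 2 * max 0 (r - a) - 2 * max 0 (r - (1 - a)) + 2 * max 0 (r - 1)) / (2 * a * (1 - a))) (at r)"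
    by (intro DERIV_cdivide DERIV_add DERIV_diff has_real_derivative_max_0_power2)
  moreover have "(2 * max 0 (r - 0) - 2 * max 0 (r - a) - 2 * max 0 (r - (1 - a)) + 2 * max 0 (r - 1)) / (2 * a * (1 - a)) = ramp_slope a r"
    using assms by (simp add: ramp_slope_def divide_simps) (simp add: algebra_simps)
  ultimately show ?thesis unfolding ramp_def[abs_def] by simp
qed

lemma ramp_slope_continuous: "0 < a \<Longrightarrow> a < 1 \<Longrightarrow> continuous_on UNIV (ramp_slope a)"
  unfolding ramp_slope_def[abs_def] by (intro continuous_intros) auto

text \<open>The factor \<open>1 / (1 - a)\<close> is the price of a continuous slope. It tends to 1
  with \<open>a\<close> and returns as the constant \<open>c\<close> in the recovery
  construction.\<close>

lemma ramp_slope_bounds: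
  assumes "0 < a" "a \<le> 1/2"
  shows "0 \<le> ramp_slope a r" "ramp_slope a r \<le> 1 / (1 - a)"
proof -
  let ?m = "max 0 r - max 0 (r - a) - max 0 (r - (1 - a)) + max 0 (r - 1)"
  have "0 \<le> ?m" "?m \<le> a" using assms by (auto simp: max_def)
  then have "0 \<le> ?m / (a * (1 - a))"
    using assms by (intro divide_nonneg_nonneg mult_nonneg_nonneg) auto
  moreover have "?m / (a * (1 - a)) \<le> a / (a * (1 - a))"
    using assms \<open>?m \<le> a\<close> by (intro divide_right_mono mult_nonneg_nonneg) auto
  ultimately show "0 \<le> ramp_slope a r" "ramp_slope a r \<le> 1 / (1 - a)"
    using assms by (auto simp: ramp_slope_def)
qed

lemma ramp_slope_eq_0:
  assumes "0 < a" "a \<le> 1/2" "r \<le> 0 \<or> r \<ge> 1"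
  shows "ramp_slope a r = 0"
  using assms by (auto simp: ramp_slope_def max_def)

lemma ramp_eq_0: "0 < a \<Longrightarrow> a \<le> 1/2 \<Longrightarrow> r \<le> 0 \<Longrightarrow> ramp a r = 0"
  by (auto simp: ramp_def max_def)

lemma ramp_eq_1: "0 < a \<Longrightarrow> a \<le> 1/2 \<Longrightarrow> r \<ge> 1 \<Longrightarrow> ramp a r = 1"
  by (auto simp: ramp_def max_def field_simps power2_eq_square)

text \<open>The slope is nonnegative, so the ramp is nondecreasing and can be compared with its
  constant values 0 to the left of 0 and 1 to the right of 1.\<close>

lemma ramp_bounds:
  assumes "0 < a" "a \<le> 1/2"
  shows "0 \<le> ramp a r" "ramp a r \<le> 1"
proof -
  have mono: "ramp a s \<le> ramp a t" if "s \<le> t" for s t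
    by (rule DERIV_nonneg_imp_nondecreasing[OF that])
      (use assms ramp_has_derivative[of a] ramp_slope_bounds[of a] in auto)
  show "0 \<le> ramp a r" using mono[of "min r 0" r] ramp_eq_0[OF assms, of "min r 0"] by auto
  show "ramp a r \<le> 1" using mono[of r "max r 1"] ramp_eq_1[OF assms, of "max r 1"] by auto
qed

section \<open>Cutoff functions\<close>

lemma C1_fun_norm_power2: "C1_fun (\<lambda>x::'a::real_inner. (norm (x - c))\<^sup>2)"
proof (rule C1_funI[where D="\<lambda>x v. 2 * ((x - c) \<bullet> v)"])
  show "((\<lambda>x. (norm (x - c))\<^sup>2) has_derivative (\<lambda>v. 2 * ((x - c) \<bullet> v))) (at x)" for x :: 'a
    unfolding power2_norm_eq_inner
    by (auto intro!: derivative_eq_intros simp: inner_commute)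
qed (intro continuous_intros)

lemma C1c_ball_bump:
  fixes c :: "real^'n"
  assumes "r > 0" "cball c (2*r) \<subseteq> U"
  obtains \<zeta> :: "real^'n \<Rightarrow> real" where "\<zeta> \<in> C1c U" "\<And>x. 0 \<le> \<zeta> x" "\<And>x. \<zeta> x \<le> 1" "\<And>x. x \<in> ball c r \<Longrightarrow> \<zeta> x = 1"
proof
  \<comment> \<open>The squared distance is smooth at the centre as well. Scaled this way, the
    argument of the ramp is at most 0 on the ball of radius \<open>r\<close> and at least 3 outside
    the ball of radius \<open>2 * r\<close>.\<close>
  let ?z = "\<lambda>x. 1 - ramp (1/2) ((norm (x - c))\<^sup>2 / r\<^sup>2 - 1)"
  have f: "C1_fun (\<lambda>x. (1/r\<^sup>2) * (norm (x - c))\<^sup>2 - 1)"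
    by (intro C1_fun_diff C1_fun_mult C1_fun_norm_power2 C1_fun_const)
  have C: "C1_fun ?z"
    using C1_fun_diff[OF C1_fun_const[of 1] C1_fun_compose_real[OF ramp_has_derivative[of "1/2"] ramp_slope_continuous[of "1/2"] f]]
    by simp
  show "?z \<in> C1c U"
  proof (rule C1cI[OF C compact_cball assms(2)])
    fix x assume "x \<notin> cball c (2*r)"
    then have "2 * r \<le> norm (x - c)" by (simp add: dist_norm norm_minus_commute)
    then have "(2*r)\<^sup>2 \<le> (norm (x - c))\<^sup>2" using assms by (intro power_mono) auto
    then have "4 \<le> (norm (x - c))\<^sup>2 / r\<^sup>2" using assms by (simp add: field_simps power2_eq_square)
    then show "?z x = 0" by (simp add: ramp_eq_1)
  qed
  show "0 \<le> ?z x" "?z x \<le> 1" for x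
    using ramp_bounds[of "1/2"] by auto
  show "?z x = 1" if "x \<in> ball c r" for x
  proof -
    have "(norm (x - c))\<^sup>2 \<le> r\<^sup>2" using that assms by (intro power_mono) (auto simp: dist_norm norm_minus_commute)
    then show ?thesis using assms by (simp add: ramp_eq_0 field_simps)
  qed
qed

text \<open>The ball bumps of a finite subcover are joined by y + (1 - y) z = 1 - (1 - y) (1 - z),
  which stays in [0, 1] and equals 1 as soon as y or z does. \<open>V\<close> is the union of the
  balls, so \<zeta> is 1 on a neighbourhood of \<open>K\<close> and not just on
  \<open>K\<close>.\<close>

lemma C1c_cutoff:
  fixes K U :: "(real^'n) set"
  assumes "compact K" "open U" "K \<subseteq> U"
  obtains \<zeta> :: "real^'n \<Rightarrow> real" and V where "\<zeta> \<in> C1c U" "\<And>x. 0 \<le> \<zeta> x" "\<And>x. \<zeta> x \<le> 1"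
    "open V" "K \<subseteq> V" "\<And>x. x \<in> V \<Longrightarrow> \<zeta> x = 1"
proof -
  have "\<exists>r>0. cball c (2*r) \<subseteq> U" if "c \<in> K" for c
  proof -
    have "c \<in> U" using assms(3) that by blast
    then have "\<exists>e>0. cball c e \<subseteq> U"
      using spec[OF open_contains_cball_eq[OF assms(2)], of c] by simp
    then obtain e where "e > 0" "cball c e \<subseteq> U" by blast
    then show ?thesis by (intro exI[of _ "e/2"]) auto
  qed
  then obtain r where r: "\<And>c. c \<in> K \<Longrightarrow> r c > 0 \<and> cball c (2 * r c) \<subseteq> U" by metis
  have cov: "K \<subseteq> (\<Union>c\<in>K. ball c (r c))"
  proof
    fix c assume "c \<in> K"
    then show "c \<in> (\<Union>c\<in>K. ball c (r c))" using r[of c] by (intro UN_I[of c]) auto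
  qed
  obtain F where F: "F \<subseteq> K" "finite F" "K \<subseteq> (\<Union>c\<in>F. ball c (r c))"
    by (rule compactE_image[OF assms(1) _ cov]) auto
  have "\<exists>\<zeta>::real^'n \<Rightarrow> real. \<zeta> \<in> C1c U \<and> (\<forall>x. 0 \<le> \<zeta> x \<and> \<zeta> x \<le> 1) \<and> (\<forall>x\<in>(\<Union>c\<in>F. ball c (r c)). \<zeta> x = 1)"
    using F(2,1)
  proof (induction rule: finite_induct)
    case empty
    show ?case by (rule exI[of _ "\<lambda>_. 0"]) (auto intro!: C1cI[where K="{}"])
  next
    case (insert c F)
    then obtain z where z: "z \<in> C1c U" "\<And>x. 0 \<le> z x" "\<And>x. z x \<le> 1" "\<And>x. x \<in> (\<Union>c\<in>F. ball c (r c)) \<Longrightarrow> z x = (1::real)"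
      by blast
    have "r c > 0" "cball c (2 * r c) \<subseteq> U" using r insert by auto
    then obtain y where y: "y \<in> C1c U" "\<And>x. 0 \<le> y x" "\<And>x. y x \<le> 1" "\<And>x. x \<in> ball c (r c) \<Longrightarrow> y x = (1::real)"
      using C1c_ball_bump by metis
    have "(\<lambda>x. y x + (1 - y x) *\<^sub>R z x) \<in> C1c U"
      by (intro C1c_add C1c_scaleR y z C1_fun_diff C1_fun_const C1cD[OF y(1)])
    moreover have "y x + (1 - y x) * z x \<le> 1" for x
      using y(2,3)[of x] z(2,3)[of x] mult_left_mono[of "z x" 1 "1 - y x"] by auto
    moreover have "0 \<le> y x + (1 - y x) * z x" for x
      using y(2,3)[of x] z(2,3)[of x] by auto
    moreover have "y x + (1 - y x) * z x = 1" if "x \<in> (\<Union>c\<in>insert c F. ball c (r c))" for x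
    proof (cases "x \<in> ball c (r c)")
      case True then show ?thesis using y(4) by simp
    next
      case False then show ?thesis using z(4) that by simp
    qed
    ultimately show ?case
      by (intro exI[of _ "\<lambda>x. y x + (1 - y x) *\<^sub>R z x"]) (use y z in simp)
  qed
  then show ?thesis using F(3) that[of _ "\<Union>c\<in>F. ball c (r c)"] by blast
qed


text \<open>The cutoffs live on neighbourhoods that shrink to \<open>K\<close>, which gives the
  pointwise limit; the fixed compact set \<open>L\<close> containing all supports provides the
  integrable majorant when the limit is taken under an integral.\<close>

lemma C1c_cutoff_sequence:
  fixes K U :: "(real^'n) set"
  assumes "compact K" "open U" "K \<subseteq> U"
  obtains \<zeta> :: "nat \<Rightarrow> real^'n \<Rightarrow> real" and L where "compact L" "L \<subseteq> U"
    "\<And>k. \<zeta> k \<in> C1c U" "\<And>k x. 0 \<le> \<zeta> k x" "\<And>k x. \<zeta> k x \<le> 1"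
    "\<And>k x. x \<notin> L \<Longrightarrow> \<zeta> k x = 0" "\<And>x. (\<lambda>k. \<zeta> k x) \<longlonglongrightarrow> indicator K x"
proof -
  obtain z :: "real^'n \<Rightarrow> real" and V where z: "z \<in> C1c U" "open V" "K \<subseteq> V" "\<And>x. x \<in> V \<Longrightarrow> z x = 1"
    using C1c_cutoff[OF assms] by metis
  obtain L where L: "compact L" "L \<subseteq> U" "\<And>x. x \<notin> L \<Longrightarrow> z x = 0"
    using C1cE[OF z(1)] by metis
  have VL: "V \<subseteq> L" using z(4) L(3) by force
  define W where "W k = V \<inter> (\<Union>c\<in>K. ball c (inverse (real (Suc k))))" for k
  have W: "open (W k)" "K \<subseteq> W k" for k
    using z(2,3) unfolding W_def by (auto intro!: bexI)
  have "\<exists>y::real^'n \<Rightarrow> real. y \<in> C1c (W k) \<and> (\<forall>x. 0 \<le> y x) \<and> (\<forall>x. y x \<le> 1) \<and> (\<forall>x\<in>K. y x = 1)" for k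
  proof -
    obtain y :: "real^'n \<Rightarrow> real" and V' where "y \<in> C1c (W k)" "\<And>x. 0 \<le> y x" "\<And>x. y x \<le> 1"
        "K \<subseteq> V'" "\<And>x. x \<in> V' \<Longrightarrow> y x = 1"
      using C1c_cutoff[OF assms(1) W[of k]] by metis
    then show ?thesis by (intro exI[of _ y]) auto
  qed
  then obtain y :: "nat \<Rightarrow> real^'n \<Rightarrow> real" where y: "\<And>k. y k \<in> C1c (W k)" "\<And>k x. 0 \<le> y k x" "\<And>k x. y k x \<le> 1"
      "\<And>k x. x \<in> K \<Longrightarrow> y k x = 1"
    by metis
  have y0: "y k x = 0" if "x \<notin> W k" for k x
    using C1cE[OF y(1)[of k]] that by (metis subsetD)
  have lim: "(\<lambda>k. y k x) \<longlonglongrightarrow> indicator K x" for x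
  proof (cases "x \<in> K")
    case True then show ?thesis using y(4) by simp
  next
    case False
    have "closed K" using assms(1) by (rule compact_imp_closed)
    then obtain e where e: "e > 0" "ball x e \<inter> K = {}"
      using False open_contains_ball[of "- K"] by (auto simp: open_Compl disjoint_eq_subset_Compl)
    have "eventually (\<lambda>k. inverse (real (Suc k)) < e) sequentially"
      using LIMSEQ_inverse_real_of_nat e(1) by (rule order_tendstoD(2))
    then have "eventually (\<lambda>k. y k x = 0) sequentially"
    proof eventually_elim
      case (elim k)
      have "x \<notin> W k"
      proof
        assume "x \<in> W k"
        then obtain c where "c \<in> K" "dist c x < inverse (real (Suc k))" unfolding W_def by auto
        then have "c \<in> ball x e \<inter> K" using elim by (auto simp: dist_commute)
        then show False using e(2) by auto
      qed
      then show ?case by (rule y0)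
    qed
    then show ?thesis using False by (simp add: tendsto_eventually)
  qed
  have WU: "W k \<subseteq> U" "W k \<subseteq> L" for k using VL L(2) unfolding W_def by auto
  show ?thesis
  proof (rule that[OF L(1,2), of y])
    show "y k \<in> C1c U" for k using y(1) WU(1) by (rule C1c_mono)
    show "y k x = 0" if "x \<notin> L" for k x using y0 that WU(2) by blast
  qed (use y lim in auto)
qed

section \<open>Integration by parts\<close>

lemma integrable_continuous_compact_support:
  fixes f :: "'a::euclidean_space \<Rightarrow> 'b::{banach, second_countable_topology}"
  assumes "continuous_on UNIV f" "compact K" "\<And>x. x \<notin> K \<Longrightarrow> f x = 0"
  shows "integrable lborel f"
proof -
  have "integrable lborel (\<lambda>x. indicator K x *\<^sub>R f x)"
    by (rule borel_integrable_compact[OF assms(2) continuous_on_subset[OF assms(1)]]) simp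
  moreover have "(\<lambda>x. indicator K x *\<^sub>R f x) = f"
    using assms(3) by (auto simp: indicator_def)
  ultimately show ?thesis by simp
qed

lemma C1c_integrable:
  fixes \<phi> :: "real^'n \<Rightarrow> 'b::{banach, second_countable_topology}"
  shows "\<phi> \<in> C1c U \<Longrightarrow> integrable lborel \<phi>"
  by (meson C1cD C1cE C1_fun_continuous integrable_continuous_compact_support)

lemma C1c_derivative_integrable:
  fixes \<phi> :: "real^'n \<Rightarrow> 'b::{banach, second_countable_topology}"
  assumes "\<phi> \<in> C1c U"
  shows "integrable lborel (\<lambda>x. frechet_derivative \<phi> (at x) v)"
proof -
  obtain K where K: "compact K" "\<And>x v. x \<notin> K \<Longrightarrow> frechet_derivative \<phi> (at x) v = 0"
    using C1cE[OF assms] by metis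
  show ?thesis
    by (rule integrable_continuous_compact_support[OF C1_fun_continuous_frechet[OF C1cD[OF assms]] K])
qed

lemma lborel_integral_translation:
  fixes f :: "'a::euclidean_space \<Rightarrow> 'b::{banach, second_countable_topology}"
  assumes "f \<in> borel_measurable borel"
  shows "(\<integral>x. f (h + x) \<partial>lborel) = (\<integral>x. f x \<partial>lborel)"
proof -
  have "(\<integral>x. f x \<partial>lborel) = (\<integral>x. f x \<partial>distr lborel borel ((+) h))"
    by (simp add: lborel_distr_plus)
  also have "\<dots> = (\<integral>x. f (h + x) \<partial>lborel)"
    using assms by (subst integral_distr) auto
  finally show ?thesis ..
qed

text \<open>Difference quotients along a sequence, in the form that dominated convergence asks for.
  They return in the truncation, where \<open>real (Suc n) * arctan (t / real (Suc n))\<close> is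
  such a quotient of \<open>arctan\<close> at 0.\<close>

lemma directional_derivative_sequence:
  fixes f :: "'a::real_normed_vector \<Rightarrow> real"
  assumes "(f has_derivative D) (at x)"
  shows "(\<lambda>n. real (Suc n) * (f (inverse (real (Suc n)) *\<^sub>R v + x) - f x)) \<longlonglongrightarrow> D v"
proof -
  interpret D: bounded_linear D using assms by (rule has_derivative_bounded_linear)
  have 1: "((\<lambda>t. t *\<^sub>R v + x) has_derivative (\<lambda>t. t *\<^sub>R v)) (at 0)"
    by (auto intro!: derivative_eq_intros)
  have "(f has_derivative D) (at (0 *\<^sub>R v + x))" using assms by simp
  from has_derivative_compose[OF 1 this]
  have "((\<lambda>t. f (t *\<^sub>R v + x)) has_derivative (\<lambda>t. D v * t)) (at 0)"
    by (simp add: D.scaleR mult.commute)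
  then have "((\<lambda>t. f (t *\<^sub>R v + x)) has_real_derivative D v) (at 0)"
    by (simp add: has_field_derivative_def)
  then have "((\<lambda>h. (f (h *\<^sub>R v + x) - f x) / h) \<longlongrightarrow> D v) (at 0)"
    by (simp add: DERIV_def)
  moreover have "filterlim (\<lambda>n. inverse (real (Suc n))) (at 0) sequentially"
    unfolding filterlim_at using LIMSEQ_inverse_real_of_nat by auto
  ultimately have "(\<lambda>n. (f (inverse (real (Suc n)) *\<^sub>R v + x) - f x) / inverse (real (Suc n))) \<longlonglongrightarrow> D v"
    by (rule filterlim_compose)
  then show ?thesis by (simp add: field_simps)
qed

text \<open>Translation invariance makes the integral of every difference quotient of \<phi> zero;
  the Lipschitz bound allows the limit to be taken under the integral.\<close>

lemma integral_frechet_derivative_C1c: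
  fixes \<phi> :: "real^'n \<Rightarrow> real"
  assumes \<phi>: "\<phi> \<in> C1c U"
  shows "(\<integral>x. frechet_derivative \<phi> (at x) v \<partial>lborel) = 0"
proof -
  have C: "C1_fun \<phi>" using \<phi> by (rule C1cD)
  have meas: "\<phi> \<in> borel_measurable borel"
    by (rule borel_measurable_continuous_onI[OF C1_fun_continuous[OF C]])
  obtain K where K: "compact K" "\<And>x. x \<notin> K \<Longrightarrow> \<phi> x = 0" using C1cE[OF \<phi>] by metis
  obtain B where B: "B > 0" "\<And>x y. norm (\<phi> x - \<phi> y) \<le> B * norm (x - y)"
    using C1c_lipschitz[OF \<phi>] by metis
  obtain R where R: "R > 0" "\<And>x. x \<in> K \<Longrightarrow> norm x \<le> R"
    using compact_imp_bounded[OF K(1)] unfolding bounded_pos by auto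
  define s where "s n x = real (Suc n) * (\<phi> (inverse (real (Suc n)) *\<^sub>R v + x) - \<phi> x)" for n x
  have "(\<lambda>n. \<integral>x. s n x \<partial>lborel) \<longlonglongrightarrow> (\<integral>x. frechet_derivative \<phi> (at x) v \<partial>lborel)"
  proof (rule integral_dominated_convergence)
    show "(\<lambda>x. frechet_derivative \<phi> (at x) v) \<in> borel_measurable lborel"
      using C1c_derivative_integrable[OF \<phi>] by blast
    show "s n \<in> borel_measurable lborel" for n
      unfolding s_def[abs_def] using meas by measurable
    \<comment> \<open>All step lengths are at most 1, so every quotient vanishes outside the ball
      that extends a ball around the support of \<phi> by \<open>norm v\<close>.\<close>
    show "integrable lborel (\<lambda>x. (B * norm v) * indicator (cball 0 (R + norm v)) x)"
      by (intro integrable_mult_right integrable_real_indicator) (auto simp: emeasure_lborel_cball_finite[unfolded infinity_ennreal_def])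
    show "AE x in lborel. (\<lambda>n. s n x) \<longlonglongrightarrow> frechet_derivative \<phi> (at x) v"
      unfolding s_def by (intro always_eventually allI directional_derivative_sequence C1_fun_has_derivative C)
    show "AE x in lborel. norm (s n x) \<le> B * norm v * indicator (cball 0 (R + norm v)) x" for n
    proof (intro always_eventually allI)
      fix x
      let ?i = "inverse (real (Suc n))"
      have i: "0 < ?i" "?i \<le> 1" by (auto simp: field_simps)
      show "norm (s n x) \<le> B * norm v * indicator (cball 0 (R + norm v)) x"
      proof (cases "x \<in> cball 0 (R + norm v)")
        case True
        have "norm (s n x) \<le> real (Suc n) * (B * norm (?i *\<^sub>R v))"
          unfolding s_def norm_mult using B(2)[of "?i *\<^sub>R v + x" x] by (intro mult_mono) auto
        also have "\<dots> = B * norm v" by (simp add: field_simps)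
        finally show ?thesis using True by simp
      next
        case False
        then have x: "norm x > R + norm v" by simp
        then have "\<phi> x = 0" using R K norm_ge_zero[of v] by (intro K(2)) fastforce
        moreover have "norm (?i *\<^sub>R v + x) > R"
        proof -
          have "norm x \<le> norm (?i *\<^sub>R v + x) + norm (?i *\<^sub>R v)"
            using norm_triangle_ineq4[of "?i *\<^sub>R v + x" "?i *\<^sub>R v"] by simp
          moreover have "norm (?i *\<^sub>R v) \<le> norm v"
            using i mult_right_mono[of ?i 1 "norm v"] by simp
          ultimately show ?thesis using x by linarith
        qed
        then have "\<phi> (?i *\<^sub>R v + x) = 0" using R by (intro K(2)) fastforce
        ultimately show ?thesis unfolding s_def using B(1) by simp
      qed
    qed
  qed
  moreover have "(\<integral>x. s n x \<partial>lborel) = 0" for n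
  proof -
    have "integrable lborel (\<lambda>x. \<phi> (inverse (real (Suc n)) *\<^sub>R v + x))"
      using C1c_integrable[OF \<phi>]
      by (subst (asm) lborel_distr_plus[symmetric, of "inverse (real (Suc n)) *\<^sub>R v"])
        (subst (asm) integrable_distr_eq, auto simp: meas)
    then show ?thesis
      unfolding s_def using C1c_integrable[OF \<phi>] meas by (simp add: lborel_integral_translation)
  qed
  ultimately show ?thesis by (simp add: LIMSEQ_const_iff)
qed

text \<open>The product of \<open>f\<close> and \<phi> is again a test function, so the integral of
  its derivative vanishes.\<close>

lemma integral_by_parts_C1c:
  fixes f \<phi> :: "real^'n \<Rightarrow> real"
  assumes f: "C1_fun f" and \<phi>: "\<phi> \<in> C1c U"
  shows "(\<integral>x. f x * frechet_derivative \<phi> (at x) v \<partial>lborel) = - (\<integral>x. frechet_derivative f (at x) v * \<phi> x \<partial>lborel)"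
proof -
  have C: "C1_fun \<phi>" using \<phi> by (rule C1cD)
  obtain K where K: "compact K" "\<And>x. x \<notin> K \<Longrightarrow> \<phi> x = 0" "\<And>x v. x \<notin> K \<Longrightarrow> frechet_derivative \<phi> (at x) v = 0"
    using C1cE[OF \<phi>] by metis
  have p: "(\<lambda>x. f x * \<phi> x) \<in> C1c U"
    using C1c_scaleR[OF f \<phi>] by simp
  have d: "frechet_derivative (\<lambda>x. f x * \<phi> x) (at x) = (\<lambda>v. f x * frechet_derivative \<phi> (at x) v + frechet_derivative f (at x) v * \<phi> x)" for x
    by (rule frechet_derivative_eqI, rule has_derivative_mult[OF C1_fun_has_derivative C1_fun_has_derivative]) (rule f C)+
  have "(\<integral>x. f x * frechet_derivative \<phi> (at x) v + frechet_derivative f (at x) v * \<phi> x \<partial>lborel) = 0"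
    using integral_frechet_derivative_C1c[OF p, of v] unfolding d .
  moreover have "integrable lborel (\<lambda>x. f x * frechet_derivative \<phi> (at x) v)"
    by (rule integrable_continuous_compact_support[OF continuous_on_mult[OF C1_fun_continuous[OF f] C1_fun_continuous_frechet[OF C]] K(1)])
      (simp add: K(3))
  moreover have "integrable lborel (\<lambda>x. frechet_derivative f (at x) v * \<phi> x)"
    by (rule integrable_continuous_compact_support[OF continuous_on_mult[OF C1_fun_continuous_frechet[OF f] C1_fun_continuous[OF C]] K(1)])
      (simp add: K(2))
  ultimately show ?thesis by simp
qed

section \<open>Locally integrable functions and duality with test functions\<close>

lemma sets_lebesgue_open: "open U \<Longrightarrow> U \<in> sets lebesgue"
  by auto

lemma lebesgue_on_integral_eq_lborel:
  fixes f :: "'a::euclidean_space \<Rightarrow> 'b::{banach, second_countable_topology}"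
  assumes "U \<in> sets lebesgue" "f \<in> borel_measurable borel" "\<And>x. x \<notin> U \<Longrightarrow> f x = 0"
  shows "(\<integral>x. f x \<partial>lebesgue_on U) = (\<integral>x. f x \<partial>lborel)"
proof -
  have "(\<integral>x. f x \<partial>lebesgue_on U) = (\<integral>x. indicator U x *\<^sub>R f x \<partial>lebesgue)"
    using assms(1) by (subst integral_restrict_space) auto
  also have "(\<lambda>x. indicator U x *\<^sub>R f x) = f"
    using assms(3) by (auto simp: indicator_def)
  finally show ?thesis using assms(2) by (simp add: integral_completion)
qed

lemma locally_integrable_continuous:
  fixes f :: "real^'n \<Rightarrow> 'b::{banach, second_countable_topology}"
  assumes "continuous_on UNIV f"
  shows "locally_integrable U f"
  unfolding locally_integrable_def set_integrable_def
proof (intro allI impI)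
  fix K assume K: "compact K \<and> K \<subseteq> U"
  have "integrable lborel (\<lambda>x. indicator K x *\<^sub>R f x)"
    using K by (intro borel_integrable_compact continuous_on_subset[OF assms]) auto
  then show "integrable lebesgue (\<lambda>x. indicator K x *\<^sub>R f x)"
    by (subst integrable_completion) auto
qed

lemma locally_integrable_on_compact:
  assumes "locally_integrable U g" "compact K" "K \<subseteq> U" "open U"
  shows "integrable (lebesgue_on U) (\<lambda>x. indicator K x *\<^sub>R g x)"
proof -
  have "integrable lebesgue (\<lambda>x. indicator K x *\<^sub>R g x)"
    using assms unfolding locally_integrable_def set_integrable_def by auto
  moreover have "(\<lambda>x. indicator U x *\<^sub>R indicator K x *\<^sub>R g x) = (\<lambda>x. indicator K x *\<^sub>R g x)"
    using assms(3) by (auto simp: indicator_def fun_eq_iff)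
  ultimately show ?thesis
    using assms(4) by (subst integrable_restrict_space) auto
qed

lemma open_compact_exhaustion:
  fixes U :: "(real^'n) set"
  assumes "open U"
  obtains C :: "nat \<Rightarrow> (real^'n) set" where "\<And>n. compact (C n)" "\<And>n. C n \<subseteq> U" "incseq C" "(\<Union>n. C n) = U"
proof -
  obtain C :: "nat \<Rightarrow> (real^'n) set" where C: "\<And>n. compact (C n)" "\<And>n. C n \<subseteq> U"
      "\<And>n. C n \<subseteq> interior (C (Suc n))" "\<Union>(range C) = U"
    by (rule open_Union_compact_subsets[OF assms], rule that; assumption)
  have "incseq C"
    by (rule incseq_SucI) (rule order_trans[OF C(3) interior_subset])
  with C that show ?thesis by metis
qed

text \<open>Integrability is given on compact subsets only; measurability on the whole of
  \<open>U\<close> comes from a pointwise limit along a compact exhaustion.\<close>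

lemma locally_integrable_measurable:
  fixes g :: "real^'n \<Rightarrow> 'b::{banach, second_countable_topology}"
  assumes "locally_integrable U g" "open U"
  shows "g \<in> borel_measurable (lebesgue_on U)"
proof -
  obtain C :: "nat \<Rightarrow> (real^'n) set" where C: "\<And>n. compact (C n)" "\<And>n. C n \<subseteq> U" "incseq C" "(\<Union>n. C n) = U"
    using open_compact_exhaustion[OF assms(2)] by metis
  show ?thesis
  proof (rule borel_measurable_LIMSEQ_metric)
    show "(\<lambda>x. indicator (C n) x *\<^sub>R g x) \<in> borel_measurable (lebesgue_on U)" for n
      by (rule borel_measurable_integrable[OF locally_integrable_on_compact[OF assms(1) C(1,2) assms(2)]])
    fix x assume "x \<in> space (lebesgue_on U)"
    then have "x \<in> U" by simp
    then obtain m where "x \<in> C m" using C(4) by blast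
    then have "eventually (\<lambda>n. indicator (C n) x *\<^sub>R g x = g x) sequentially"
      using subsetD[OF incseqD[OF C(3)]] unfolding eventually_sequentially by (intro exI[of _ m]) simp
    then show "(\<lambda>n. indicator (C n) x *\<^sub>R g x) \<longlonglongrightarrow> g x"
      by (rule tendsto_eventually)
  qed
qed

lemma locally_integrable_vec_nth:
  fixes g :: "real^'n \<Rightarrow> real^'m"
  assumes "locally_integrable U g"
  shows "locally_integrable U (\<lambda>x. g x $ i)"
  unfolding locally_integrable_def
proof (intro allI impI)
  fix K assume "compact K \<and> K \<subseteq> U"
  then have "integrable lebesgue (\<lambda>x. (indicator K x *\<^sub>R g x) $ i)"
    using assms unfolding locally_integrable_def set_integrable_def
    by (intro integrable_bounded_linear[OF bounded_linear_vec_nth]) auto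
  then show "set_integrable lebesgue K (\<lambda>x. g x $ i)"
    unfolding set_integrable_def by simp
qed

lemma locally_integrable_mult:
  fixes g \<phi> :: "real^'n \<Rightarrow> real"
  assumes "locally_integrable U g" "open U" "continuous_on UNIV \<phi>" "compact K" "K \<subseteq> U"
    "\<And>x. x \<notin> K \<Longrightarrow> \<phi> x = 0"
  shows "integrable (lebesgue_on U) (\<lambda>x. g x * \<phi> x)"
proof -
  obtain B where B: "B > 0" "\<And>x. norm (\<phi> x) \<le> B"
    using continuous_zero_outside_compact_bounded[OF assms(3,4,6)] by blast
  have m: "\<phi> \<in> borel_measurable (lebesgue_on U)"
    using borel_measurable_continuous_onI[OF assms(3)]
    by (intro measurable_restrict_space1 measurable_completion) simp
  have i: "integrable (lebesgue_on U) (\<lambda>x. B * (indicator K x *\<^sub>R g x))"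
    using locally_integrable_on_compact[OF assms(1,4,5,2)] by (intro integrable_mult_right)
  show ?thesis
  proof (rule Bochner_Integration.integrable_bound[OF i])
    show "(\<lambda>x. g x * \<phi> x) \<in> borel_measurable (lebesgue_on U)"
      using m locally_integrable_measurable[OF assms(1,2)] by (rule borel_measurable_times[rotated])
    show "AE x in lebesgue_on U. norm (g x * \<phi> x) \<le> norm (B * (indicator K x *\<^sub>R g x))"
    proof (intro always_eventually allI)
      fix x
      show "norm (g x * \<phi> x) \<le> norm (B * (indicator K x *\<^sub>R g x))"
      proof (cases "x \<in> K")
        case True
        have "\<bar>g x\<bar> * \<bar>\<phi> x\<bar> \<le> \<bar>g x\<bar> * B" using B(2)[of x] by (intro mult_left_mono) auto
        then show ?thesis using True B(1) by (simp add: abs_mult mult.commute)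
      qed (simp add: assms(6))
    qed
  qed
qed

text \<open>The best test functions approach the sign of \<open>g\<close>. Cutoffs around compact
  sets \<open>A\<close> and \<open>B\<close> inside the positivity and the negativity set have a
  difference that is bounded by 1 and converges to \<open>indicator A x - indicator B x\<close>; the
  two sets are then exhausted by compact sets up to null sets. This serves both the uniqueness of
  weak gradients and the translation estimate.\<close>

lemma C1c_duality:
  fixes g :: "real^'n \<Rightarrow> real"
  assumes U: "open U" and g: "locally_integrable U g"
    and bound: "\<And>\<phi>. \<phi> \<in> C1c U \<Longrightarrow> (\<And>x. \<bar>\<phi> x\<bar> \<le> 1) \<Longrightarrow> (\<integral>x. g x * \<phi> x \<partial>lebesgue_on U) \<le> C"
  shows "(\<integral>\<^sup>+x. ennreal \<bar>g x\<bar> \<partial>lebesgue_on U) \<le> ennreal C"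
proof -
  have gm [measurable]: "g \<in> borel_measurable (lebesgue_on U)"
    by (rule locally_integrable_measurable[OF g U])
  have compact_case: "(\<integral>\<^sup>+x. ennreal (indicator (A \<union> B) x * \<bar>g x\<bar>) \<partial>lebesgue_on U) \<le> ennreal C"
    if A: "compact A" "A \<subseteq> {x\<in>U. g x > 0}" and B: "compact B" "B \<subseteq> {x\<in>U. g x < 0}" for A B
  proof -
    have AU: "A \<subseteq> U" "B \<subseteq> U" using A B by auto
    obtain a :: "nat \<Rightarrow> real^'n \<Rightarrow> real" and L where a: "compact L" "L \<subseteq> U" "\<And>k. a k \<in> C1c U" "\<And>k x. 0 \<le> a k x" "\<And>k x. a k x \<le> 1"
        "\<And>k x. x \<notin> L \<Longrightarrow> a k x = 0" "\<And>x. (\<lambda>k. a k x) \<longlonglongrightarrow> indicator A x"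
      using C1c_cutoff_sequence[OF A(1) U AU(1)] by metis
    obtain b :: "nat \<Rightarrow> real^'n \<Rightarrow> real" and L' where b: "compact L'" "L' \<subseteq> U" "\<And>k. b k \<in> C1c U" "\<And>k x. 0 \<le> b k x" "\<And>k x. b k x \<le> 1"
        "\<And>k x. x \<notin> L' \<Longrightarrow> b k x = 0" "\<And>x. (\<lambda>k. b k x) \<longlonglongrightarrow> indicator B x"
      using C1c_cutoff_sequence[OF B(1) U AU(2)] by metis
    define f where "f k x = a k x - b k x" for k x
    have f: "f k \<in> C1c U" for k
      using C1c_add[OF a(3) C1c_linear_image[OF bounded_linear_minus[OF bounded_linear_ident] b(3)]]
      unfolding f_def[abs_def] by simp
    have f1: "\<bar>f k x\<bar> \<le> 1" for k x
      using a(4,5)[where k=k and x=x] b(4,5)[where k=k and x=x] by (auto simp: f_def)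
    have fm: "f k \<in> borel_measurable (lebesgue_on U)" for k
      using borel_measurable_continuous_onI[OF C1_fun_continuous[OF C1cD[OF f]]]
      by (intro measurable_restrict_space1 measurable_completion) simp
    have i: "integrable (lebesgue_on U) (\<lambda>x. norm (indicator (L \<union> L') x *\<^sub>R g x))"
      using a(1,2) b(1,2) by (intro integrable_norm locally_integrable_on_compact[OF g _ _ U]) auto
    let ?h = "\<lambda>x. g x * (indicator A x - indicator B x)"
    have Am: "A \<in> sets (lebesgue_on U)" "B \<in> sets (lebesgue_on U)"
      using A(1) B(1) AU U by (auto simp: sets_restrict_space_iff compact_imp_closed)
    have hm: "?h \<in> borel_measurable (lebesgue_on U)" using Am by measurable
    have lim: "AE x in lebesgue_on U. (\<lambda>k. g x * f k x) \<longlonglongrightarrow> ?h x"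
      unfolding f_def by (intro always_eventually allI tendsto_intros a b)
    have dom: "AE x in lebesgue_on U. norm (g x * f k x) \<le> norm (indicator (L \<union> L') x *\<^sub>R g x)" for k
    proof (intro always_eventually allI)
      fix x show "norm (g x * f k x) \<le> norm (indicator (L \<union> L') x *\<^sub>R g x)"
        using f1[of k x] a(6)[of x k] b(6)[of x k] mult_left_mono[of "\<bar>f k x\<bar>" 1 "\<bar>g x\<bar>"]
        by (cases "x \<in> L \<union> L'") (auto simp: f_def abs_mult)
    qed
    have gf: "(\<lambda>x. g x * f k x) \<in> borel_measurable (lebesgue_on U)" for k
      using fm by measurable
    have "(\<lambda>k. \<integral>x. g x * f k x \<partial>lebesgue_on U) \<longlonglongrightarrow> (\<integral>x. ?h x \<partial>lebesgue_on U)"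
      by (rule integral_dominated_convergence[OF hm gf i lim dom])
    then have le: "(\<integral>x. ?h x \<partial>lebesgue_on U) \<le> C"
      by (rule LIMSEQ_le_const2) (use bound[OF f f1] in auto)
    have int: "integrable (lebesgue_on U) ?h"
      by (rule integrable_dominated_convergence[OF hm gf i lim dom])
    have eq: "?h x = indicator (A \<union> B) x * \<bar>g x\<bar>" for x
      using subsetD[OF A(2), of x] subsetD[OF B(2), of x] by (cases "x \<in> A"; cases "x \<in> B") auto
    have "(\<integral>\<^sup>+x. ennreal (?h x) \<partial>lebesgue_on U) = ennreal (\<integral>x. ?h x \<partial>lebesgue_on U)"
      using int by (rule nn_integral_eq_integral) (auto simp: eq)
    then show ?thesis using le by (simp add: eq ennreal_leI)
  qed
  have sets: "{x\<in>U. g x > 0} \<in> sets lebesgue" "{x\<in>U. g x < 0} \<in> sets lebesgue"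
  proof -
    have "{x\<in>space (lebesgue_on U). g x > 0} \<in> sets (lebesgue_on U)" 
      "{x\<in>space (lebesgue_on U). g x < 0} \<in> sets (lebesgue_on U)" by measurable
    then show "{x\<in>U. g x > 0} \<in> sets lebesgue" "{x\<in>U. g x < 0} \<in> sets lebesgue"
      using U by (auto simp: sets_restrict_space_iff)
  qed
  \<comment> \<open>Lebesgue sets are countable unions of compact sets up to a null set; passing to
    finite unions makes the compact sets increasing, as monotone convergence requires.\<close>
  have approx: "\<exists>F N. (\<forall>n::nat. compact (F n)) \<and> incseq F \<and> N \<in> null_sets lebesgue \<and> S = (\<Union>n. F n) \<union> N"
    if S: "S \<in> sets lebesgue" for S :: "(real^'n) set"
  proof -
    obtain D T where D: "fsigma D" "T \<in> null_sets lebesgue" "D \<union> T = S"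
      using lebesgue_set_almost_fsigma[OF S] by metis
    obtain F :: "nat \<Rightarrow> (real^'n) set" where F: "range F \<subseteq> Collect compact" "D = \<Union>(range F)"
      using D(1) fsigma_Union_compact by metis
    have "compact (\<Union>i\<le>n. F i)" for n
      using F(1) by (intro compact_UN) auto
    moreover have "incseq (\<lambda>n. \<Union>i\<le>n. F i)" unfolding incseq_def by (intro allI impI UN_mono) auto
    moreover have "S = (\<Union>n. \<Union>i\<le>n. F i) \<union> T" using D(3) F(2) by auto
    ultimately show ?thesis using D(2) by (intro exI[of _ "\<lambda>n. \<Union>i\<le>n. F i"] exI[of _ T]) auto
  qed
  obtain F N where F: "\<And>n::nat. compact (F n)" "incseq F" "N \<in> null_sets lebesgue" "{x\<in>U. g x > 0} = (\<Union>n. F n) \<union> N"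
    using approx[OF sets(1)] by metis
  obtain G N' where G: "\<And>n::nat. compact (G n)" "incseq G" "N' \<in> null_sets lebesgue" "{x\<in>U. g x < 0} = (\<Union>n. G n) \<union> N'"
    using approx[OF sets(2)] by metis
  let ?k = "\<lambda>n x. ennreal (indicator (F n \<union> G n) x * \<bar>g x\<bar>)"
  have FU: "F n \<subseteq> U" "G n \<subseteq> U" for n using F(4) G(4) by auto
  have Fm: "F n \<in> sets (lebesgue_on U)" "G n \<in> sets (lebesgue_on U)" for n
    using F(1)[of n] G(1)[of n] FU[of n] U by (auto simp: sets_restrict_space_iff compact_imp_closed)
  have "AE x in lebesgue. x \<notin> N \<and> x \<notin> N'"
    using F(3) G(3) by (intro AE_conjI AE_not_in)
  then have "AE x in lebesgue_on U. x \<notin> N \<and> x \<notin> N'"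
    using U by (subst AE_restrict_space_iff) auto
  moreover have "AE x in lebesgue_on U. x \<in> U"
    using AE_space[of "lebesgue_on U"] by simp
  ultimately have "AE x in lebesgue_on U. ennreal \<bar>g x\<bar> \<le> (SUP n. ?k n x)"
  proof eventually_elim
    case (elim x)
    have "x \<in> {x\<in>U. g x > 0} \<Longrightarrow> \<exists>n. x \<in> F n \<union> G n"
      unfolding F(4) using elim by auto
    moreover have "x \<in> {x\<in>U. g x < 0} \<Longrightarrow> \<exists>n. x \<in> F n \<union> G n"
      unfolding G(4) using elim by auto
    ultimately consider "g x = 0" | "\<exists>n. x \<in> F n \<union> G n"
      using elim by (cases "g x" "0::real" rule: linorder_cases) auto
    then show ?case
    proof cases
      case 2
      then obtain n where "x \<in> F n \<union> G n" by auto
      then have "ennreal \<bar>g x\<bar> = ?k n x" by simp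
      also have "\<dots> \<le> (SUP n. ?k n x)" by (rule SUP_upper) simp
      finally show ?thesis .
    qed simp
  qed
  then have "(\<integral>\<^sup>+x. ennreal \<bar>g x\<bar> \<partial>lebesgue_on U) \<le> (\<integral>\<^sup>+x. (SUP n. ?k n x) \<partial>lebesgue_on U)"
    by (rule nn_integral_mono_AE)
  also have "\<dots> = (SUP n. \<integral>\<^sup>+x. ?k n x \<partial>lebesgue_on U)"
  proof (rule nn_integral_monotone_convergence_SUP)
    have "indicator (F m \<union> G m) x \<le> (indicator (F n \<union> G n) x :: real)" if "m \<le> n" for m n x
      using incseqD[OF F(2) that] incseqD[OF G(2) that] by (auto simp: indicator_def)
    then show "incseq ?k"
      unfolding incseq_def le_fun_def by (intro allI impI ennreal_leI mult_right_mono) auto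
    show "?k n \<in> borel_measurable (lebesgue_on U)" for n
      using Fm[of n] by measurable
  qed
  also have "\<dots> \<le> ennreal C"
    by (intro SUP_least compact_case F(1) G(1)) (use F(4) G(4) in auto)
  finally show ?thesis .
qed

section \<open>Weak gradients\<close>

text \<open>The difference of two weak gradients annihilates every test function, so
  \<open>C1c_duality\<close> applies to its components with the bound 0. This makes the arbitrary
  choice in \<open>weak_grad\<close> harmless.\<close>

lemma has_weak_gradient_unique:
  fixes u :: "real^'n \<Rightarrow> real"
  assumes U: "open U" and g: "has_weak_gradient U u g" and h: "has_weak_gradient U u h"
  shows "AE x in lebesgue_on U. g x = h x"
proof -
  have li: "locally_integrable U (\<lambda>x. g x $ i - h x $ i)" for i
    unfolding locally_integrable_def
  proof (intro allI impI)
    fix K assume "compact K \<and> K \<subseteq> U"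
    then have "set_integrable lebesgue K (\<lambda>x. g x - h x)"
      using g h unfolding has_weak_gradient_def locally_integrable_def by auto
    then have "integrable lebesgue (\<lambda>x. (indicator K x *\<^sub>R (g x - h x)) $ i)"
      unfolding set_integrable_def by (rule integrable_bounded_linear[OF bounded_linear_vec_nth])
    then show "set_integrable lebesgue K (\<lambda>x. g x $ i - h x $ i)"
      unfolding set_integrable_def by (simp add: vector_minus_component)
  qed
  have lig: "locally_integrable U (\<lambda>x. g x $ i)" "locally_integrable U (\<lambda>x. h x $ i)" for i
    using g h unfolding has_weak_gradient_def by (simp_all add: locally_integrable_vec_nth)
  have "AE x in lebesgue_on U. g x $ i = h x $ i" for i
  proof -
    have "(\<integral>\<^sup>+x. ennreal \<bar>g x $ i - h x $ i\<bar> \<partial>lebesgue_on U) \<le> ennreal 0"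
    proof (rule C1c_duality[OF U li])
      fix \<phi> :: "real^'n \<Rightarrow> real" assume p: "\<phi> \<in> C1c U"
      obtain K where K: "compact K" "K \<subseteq> U" "\<And>x. x \<notin> K \<Longrightarrow> \<phi> x = 0"
        using C1cE[OF p] by metis
      note int = locally_integrable_mult[OF lig(1) U C1_fun_continuous[OF C1cD[OF p]] K]
        locally_integrable_mult[OF lig(2) U C1_fun_continuous[OF C1cD[OF p]] K]
      have "(\<integral>x. g x $ i * \<phi> x \<partial>lebesgue_on U) = (\<integral>x. h x $ i * \<phi> x \<partial>lebesgue_on U)"
      proof -
        have "- (\<integral>x. g x $ i * \<phi> x \<partial>lebesgue_on U) = - (\<integral>x. h x $ i * \<phi> x \<partial>lebesgue_on U)"
          using g h p unfolding has_weak_gradient_def by (auto dest!: bspec[of _ _ \<phi>] spec[of _ i])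
        then show ?thesis by simp
      qed
      then show "(\<integral>x. (g x $ i - h x $ i) * \<phi> x \<partial>lebesgue_on U) \<le> 0"
        using int by (simp add: left_diff_distrib)
    qed
    moreover have "(\<lambda>x. g x $ i - h x $ i) \<in> borel_measurable (lebesgue_on U)"
      by (rule locally_integrable_measurable[OF li U])
    ultimately have "AE x in lebesgue_on U. ennreal \<bar>g x $ i - h x $ i\<bar> = 0"
      by (subst (asm) ennreal_0, subst nn_integral_0_iff_AE[symmetric]) auto
    then show ?thesis by eventually_elim auto
  qed
  then have "AE x in lebesgue_on U. \<forall>i. g x $ i = h x $ i"
    by (simp add: AE_all_countable)
  then show ?thesis by eventually_elim (simp add: vec_eq_iff)
qed

definition grad :: "(real^'n \<Rightarrow> real) \<Rightarrow> real^'n \<Rightarrow> real^'n" where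
  "grad f x = (\<chi> i. frechet_derivative f (at x) (axis i 1))"

lemma frechet_derivative_eq_grad:
  fixes f :: "real^'n \<Rightarrow> real"
  assumes "f differentiable (at x)"
  shows "frechet_derivative f (at x) v = grad f x \<bullet> v"
proof -
  interpret D: linear "frechet_derivative f (at x)"
    by (rule linear_frechet_derivative[OF assms])
  have "frechet_derivative f (at x) v = frechet_derivative f (at x) (\<Sum>i\<in>UNIV. v $ i *\<^sub>R axis i 1)"
    using basis_expansion[of v] by (simp add: scalar_mult_eq_scaleR)
  then show ?thesis by (simp add: D.sum D.scale grad_def inner_vec_def mult.commute)
qed

lemma continuous_on_grad: "C1_fun f \<Longrightarrow> continuous_on UNIV (grad f)"
  unfolding grad_def[abs_def] by (intro continuous_on_vec_lambda C1_fun_continuous_frechet)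

lemma has_weak_gradient_C1:
  fixes f :: "real^'n \<Rightarrow> real"
  assumes "open U" "C1_fun f"
  shows "has_weak_gradient U f (grad f)"
  unfolding has_weak_gradient_def
proof (intro conjI ballI allI)
  show "locally_integrable U f" "locally_integrable U (grad f)"
    using assms(2) by (intro locally_integrable_continuous C1_fun_continuous continuous_on_grad; assumption)+
  fix \<phi> :: "real^'n \<Rightarrow> real" and i :: 'n assume p: "\<phi> \<in> C1c U"
  have C: "C1_fun \<phi>" using p by (rule C1cD)
  obtain K where K: "K \<subseteq> U" "\<And>x. x \<notin> K \<Longrightarrow> \<phi> x = 0" "\<And>x v. x \<notin> K \<Longrightarrow> frechet_derivative \<phi> (at x) v = 0"
    using C1cE[OF p] by metis
  have "(\<integral>x. f x * frechet_derivative \<phi> (at x) (axis i 1) \<partial>lebesgue_on U) =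
    (\<integral>x. f x * frechet_derivative \<phi> (at x) (axis i 1) \<partial>lborel)"
    by (rule lebesgue_on_integral_eq_lborel[OF sets_lebesgue_open[OF assms(1)]
        borel_measurable_continuous_onI[OF continuous_on_mult[OF C1_fun_continuous[OF assms(2)] C1_fun_continuous_frechet[OF C]]]])
      (use K in \<open>auto simp: subset_iff\<close>)
  also have "\<dots> = - (\<integral>x. frechet_derivative f (at x) (axis i 1) * \<phi> x \<partial>lborel)"
    by (rule integral_by_parts_C1c[OF assms(2) p])
  also have "(\<integral>x. frechet_derivative f (at x) (axis i 1) * \<phi> x \<partial>lborel) = (\<integral>x. frechet_derivative f (at x) (axis i 1) * \<phi> x \<partial>lebesgue_on U)"
    by (rule lebesgue_on_integral_eq_lborel[OF sets_lebesgue_open[OF assms(1)]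
        borel_measurable_continuous_onI[OF continuous_on_mult[OF C1_fun_continuous_frechet[OF assms(2)] C1_fun_continuous[OF C]]], symmetric])
      (use K in \<open>auto simp: subset_iff\<close>)
  finally show "(\<integral>x. f x * frechet_derivative \<phi> (at x) (axis i 1) \<partial>lebesgue_on U) = - (\<integral>x. grad f x $ i * \<phi> x \<partial>lebesgue_on U)"
    by (simp add: grad_def)
qed

section \<open>Total variation\<close>

lemma frechet_derivative_vec_nth:
  fixes \<phi> :: "real^'n \<Rightarrow> real^'m"
  assumes "C1_fun \<phi>"
  shows "frechet_derivative (\<lambda>x. \<phi> x $ i) (at x) v = frechet_derivative \<phi> (at x) v $ i"
  using frechet_derivative_eqI[OF bounded_linear.has_derivative[OF bounded_linear_vec_nth C1_fun_has_derivative[OF assms]], of i x]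
  by simp

lemma divergence_vec_nth:
  assumes "C1_fun \<phi>"
  shows "divergence \<phi> x = (\<Sum>i\<in>UNIV. frechet_derivative (\<lambda>x. \<phi> x $ i) (at x) (axis i 1))"
  using assms by (simp add: divergence_def frechet_derivative_vec_nth)

lemma divergence_add:
  assumes "C1_fun \<phi>" "C1_fun \<psi>"
  shows "divergence (\<lambda>x. \<phi> x + \<psi> x) x = divergence \<phi> x + divergence \<psi> x"
  using frechet_derivative_eqI[OF has_derivative_add[OF C1_fun_has_derivative[OF assms(1)] C1_fun_has_derivative[OF assms(2)]], of x]
  by (simp add: divergence_def sum.distrib)

lemma C1_fun_vec_nth: "C1_fun (\<phi> :: real^'n \<Rightarrow> real^'m) \<Longrightarrow> C1_fun (\<lambda>x. \<phi> x $ i)"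
  by (rule C1_fun_linear_image[OF bounded_linear_vec_nth])

lemma continuous_on_divergence:
  assumes "C1_fun \<phi>"
  shows "continuous_on UNIV (divergence \<phi>)"
  unfolding divergence_def[abs_def]
  by (intro continuous_on_sum continuous_on_component C1_fun_continuous_frechet[OF assms])

lemma divergence_eq_0_outside:
  assumes "\<phi> \<in> C1c U" "x \<notin> U"
  shows "divergence \<phi> x = 0"
proof -
  obtain K where "K \<subseteq> U" "\<And>x v. x \<notin> K \<Longrightarrow> frechet_derivative \<phi> (at x) v = 0"
    using C1cE[OF assms(1)] by metis
  then have "frechet_derivative \<phi> (at x) v = 0" for v using assms(2) by blast
  then show ?thesis by (simp add: divergence_def)
qed

lemma divergence_bounded:
  fixes \<phi> :: "real^'n \<Rightarrow> real^'n"
  assumes "\<phi> \<in> C1c U"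
  obtains B where "B > 0" "\<And>x. \<bar>divergence \<phi> x\<bar> \<le> B"
proof -
  obtain K where K: "compact K" "\<And>x v. x \<notin> K \<Longrightarrow> frechet_derivative \<phi> (at x) v = 0"
    using C1cE[OF assms] by metis
  have "divergence \<phi> x = 0" if "x \<notin> K" for x using K(2)[OF that] by (simp add: divergence_def)
  then obtain B where "B > 0" "\<And>x. norm (divergence \<phi> x) \<le> B"
    using continuous_zero_outside_compact_bounded[OF continuous_on_divergence[OF C1cD[OF assms]] K(1)] by blast
  then show ?thesis using that by simp
qed

text \<open>Weak gradients are tested against scalar functions one coordinate at a time; applied to
  the components of \<phi> and summed, this becomes the divergence identity.\<close>

lemma weak_gradient_divergence:
  fixes u :: "real^'n \<Rightarrow> real"
  assumes U: "open U" and g: "has_weak_gradient U u g" and \<phi>: "\<phi> \<in> C1c U"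
  shows "(\<integral>x. u x * divergence \<phi> x \<partial>lebesgue_on U) = - (\<integral>x. g x \<bullet> \<phi> x \<partial>lebesgue_on U)"
    and "integrable (lebesgue_on U) (\<lambda>x. g x \<bullet> \<phi> x)"
proof -
  have C: "C1_fun \<phi>" using \<phi> by (rule C1cD)
  have li: "locally_integrable U u" "locally_integrable U g"
    using g unfolding has_weak_gradient_def by auto
  have comp: "(\<lambda>x. \<phi> x $ i) \<in> C1c U" for i
    by (rule C1c_linear_image[OF bounded_linear_vec_nth \<phi>])
  have i1: "integrable (lebesgue_on U) (\<lambda>x. u x * frechet_derivative (\<lambda>x. \<phi> x $ i) (at x) v)" for i v
  proof -
    obtain K where K: "compact K" "K \<subseteq> U" "\<And>x v. x \<notin> K \<Longrightarrow> frechet_derivative (\<lambda>x. \<phi> x $ i) (at x) v = 0"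
      using C1cE[OF comp[of i]] by metis
    show ?thesis
      by (rule locally_integrable_mult[OF li(1) U C1_fun_continuous_frechet[OF C1_fun_vec_nth[OF C]] K])
  qed
  have i2: "integrable (lebesgue_on U) (\<lambda>x. g x $ i * \<phi> x $ i)" for i
  proof -
    obtain K where K: "compact K" "K \<subseteq> U" "\<And>x. x \<notin> K \<Longrightarrow> \<phi> x $ i = 0"
      using C1cE[OF comp[of i]] by metis
    show ?thesis
      by (rule locally_integrable_mult[OF locally_integrable_vec_nth[OF li(2)] U C1_fun_continuous[OF C1_fun_vec_nth[OF C]] K])
  qed
  have "(\<integral>x. u x * divergence \<phi> x \<partial>lebesgue_on U) = (\<integral>x. (\<Sum>i\<in>UNIV. u x * frechet_derivative (\<lambda>x. \<phi> x $ i) (at x) (axis i 1)) \<partial>lebesgue_on U)"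
    by (simp add: divergence_vec_nth[OF C] sum_distrib_left)
  also have "\<dots> = (\<Sum>i\<in>UNIV. \<integral>x. u x * frechet_derivative (\<lambda>x. \<phi> x $ i) (at x) (axis i 1) \<partial>lebesgue_on U)"
    by (rule Bochner_Integration.integral_sum) (rule i1)
  also have "\<dots> = (\<Sum>i\<in>UNIV. - (\<integral>x. g x $ i * \<phi> x $ i \<partial>lebesgue_on U))"
    using g comp unfolding has_weak_gradient_def by (intro sum.cong) auto
  also have "\<dots> = - (\<integral>x. (\<Sum>i\<in>UNIV. g x $ i * \<phi> x $ i) \<partial>lebesgue_on U)"
    by (simp add: sum_negf Bochner_Integration.integral_sum[OF i2])
  finally show "(\<integral>x. u x * divergence \<phi> x \<partial>lebesgue_on U) = - (\<integral>x. g x \<bullet> \<phi> x \<partial>lebesgue_on U)"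
    by (simp add: inner_vec_def)
  show "integrable (lebesgue_on U) (\<lambda>x. g x \<bullet> \<phi> x)"
    unfolding inner_vec_def inner_real_def by (intro Bochner_Integration.integrable_sum i2)
qed

lemma TV_upper:
  "\<phi> \<in> C1c U \<Longrightarrow> (\<And>x. norm (\<phi> x) \<le> 1) \<Longrightarrow> ennreal (\<integral>x. u x * divergence \<phi> x \<partial>lebesgue_on U) \<le> TV U u"
  unfolding TV_def by (rule SUP_upper) auto

lemma TV_least:
  "(\<And>\<phi>. \<phi> \<in> C1c U \<Longrightarrow> (\<And>x. norm (\<phi> x) \<le> 1) \<Longrightarrow> ennreal (\<integral>x. u x * divergence \<phi> x \<partial>lebesgue_on U) \<le> C) \<Longrightarrow> TV U u \<le> C"
  unfolding TV_def by (rule SUP_least) auto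

text \<open>Cauchy-Schwarz at every point. This half of the identity between variation and gradient
  integral carries the lower bound for the energies.\<close>

lemma TV_le_weak_gradient:
  fixes u :: "real^'n \<Rightarrow> real"
  assumes U: "open U" and g: "has_weak_gradient U u g"
  shows "TV U u \<le> (\<integral>\<^sup>+x. ennreal (norm (g x)) \<partial>lebesgue_on U)"
proof (rule TV_least)
  fix \<phi> :: "real^'n \<Rightarrow> real^'n" assume \<phi>: "\<phi> \<in> C1c U" and 1: "\<And>x. norm (\<phi> x) \<le> 1"
  note D = weak_gradient_divergence[OF U g \<phi>]
  have "ennreal (\<integral>x. u x * divergence \<phi> x \<partial>lebesgue_on U) \<le> ennreal (norm (\<integral>x. g x \<bullet> \<phi> x \<partial>lebesgue_on U))"
    unfolding D(1) by (rule ennreal_leI) simp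
  also have "\<dots> \<le> (\<integral>\<^sup>+x. norm (g x \<bullet> \<phi> x) \<partial>lebesgue_on U)"
    by (rule integral_norm_bound_ennreal[OF D(2)])
  also have "\<dots> \<le> (\<integral>\<^sup>+x. ennreal (norm (g x)) \<partial>lebesgue_on U)"
  proof (intro nn_integral_mono ennreal_leI)
    fix x
    have "norm (g x \<bullet> \<phi> x) \<le> norm (g x) * norm (\<phi> x)" using Cauchy_Schwarz_ineq2 by simp
    also have "\<dots> \<le> norm (g x) * 1" using 1 by (intro mult_left_mono) auto
    finally show "norm (g x \<bullet> \<phi> x) \<le> norm (g x)" by simp
  qed
  finally show "ennreal (\<integral>x. u x * divergence \<phi> x \<partial>lebesgue_on U) \<le> (\<integral>\<^sup>+x. ennreal (norm (g x)) \<partial>lebesgue_on U)" .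
qed

lemma integral_divergence_lborel:
  fixes w :: "real^'n \<Rightarrow> real"
  assumes "open U" "w \<in> borel_measurable borel" "\<phi> \<in> C1c U"
  shows "(\<integral>x. w x * divergence \<phi> x \<partial>lebesgue_on U) = (\<integral>x. w x * divergence \<phi> x \<partial>lborel)"
proof (rule lebesgue_on_integral_eq_lborel)
  show "(\<lambda>x. w x * divergence \<phi> x) \<in> borel_measurable borel"
    using assms(2) borel_measurable_continuous_onI[OF continuous_on_divergence[OF C1cD[OF assms(3)]]]
    by measurable
qed (use assms in \<open>auto simp: divergence_eq_0_outside\<close>)

lemma integrable_mult_divergence:
  fixes w :: "real^'n \<Rightarrow> real"
  assumes "integrable lborel w" "\<phi> \<in> C1c U"
  shows "integrable lborel (\<lambda>x. w x * divergence \<phi> x)"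
proof -
  obtain B where B: "\<And>x. \<bar>divergence \<phi> x\<bar> \<le> B" using divergence_bounded[OF assms(2)] by metis
  have m: "divergence \<phi> \<in> borel_measurable borel"
    using borel_measurable_continuous_onI[OF continuous_on_divergence[OF C1cD[OF assms(2)]]] .
  show ?thesis
  proof (rule Bochner_Integration.integrable_bound[OF integrable_mult_right[OF assms(1), of B]])
    show "(\<lambda>x. w x * divergence \<phi> x) \<in> borel_measurable lborel"
      using m assms(1) by measurable
    show "AE x in lborel. norm (w x * divergence \<phi> x) \<le> norm (B * w x)"
    proof (intro always_eventually allI)
      fix x
      have "\<bar>w x\<bar> * \<bar>divergence \<phi> x\<bar> \<le> \<bar>w x\<bar> * \<bar>B\<bar>"
        using B[of x] by (intro mult_left_mono) auto
      then show "norm (w x * divergence \<phi> x) \<le> norm (B * w x)" by (simp add: abs_mult mult.commute)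
    qed
  qed
qed

text \<open>Only an inequality, because \<open>ennreal\<close> sends negative numbers to 0: for a =
  2 and b = -1 the left side is 1 and the right side is 2.\<close>

lemma ennreal_plus_le: "ennreal (a + b) \<le> ennreal a + ennreal b"
proof -
  have "ennreal (a + b) \<le> ennreal (max a 0 + max b 0)" by (rule ennreal_leI) auto
  also have "\<dots> = ennreal (max a 0) + ennreal (max b 0)" by (rule ennreal_plus) auto
  also have "\<dots> = ennreal a + ennreal b" by (simp add: max_def ennreal_neg)
  finally show ?thesis .
qed

text \<open>A test field on the union is split by a cutoff \<zeta> that is 1 near the part of its
  support outside \<open>B\<close>: then \<zeta> \<phi> is supported in \<open>A\<close> and (1 -
  \<zeta>) \<phi> in \<open>B\<close>, and neither has norm above 1. It will be applied to a domain
  and a neighbourhood of its boundary.\<close>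

lemma TV_Un_le:
  fixes w :: "real^'n \<Rightarrow> real"
  assumes A: "open A" and B: "open B" and w: "integrable lborel w"
  shows "TV (A \<union> B) w \<le> TV A w + TV B w"
proof (rule TV_least)
  fix \<phi> :: "real^'n \<Rightarrow> real^'n" assume \<phi>: "\<phi> \<in> C1c (A \<union> B)" and 1: "\<And>x. norm (\<phi> x) \<le> 1"
  have wm: "w \<in> borel_measurable borel" using w by auto
  obtain K where K: "compact K" "K \<subseteq> A \<union> B" "\<And>x. x \<notin> K \<Longrightarrow> \<phi> x = 0" using C1cE[OF \<phi>] by metis
  have "compact (K - B)" "K - B \<subseteq> A" using K B compact_diff by auto
  then obtain \<zeta> :: "real^'n \<Rightarrow> real" and V where z: "\<zeta> \<in> C1c A" "\<And>x. 0 \<le> \<zeta> x" "\<And>x. \<zeta> x \<le> 1"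
    "open V" "K - B \<subseteq> V" "\<And>x. x \<in> V \<Longrightarrow> \<zeta> x = 1"
    using C1c_cutoff[of "K - B" A] A by metis
  let ?a = "\<lambda>x. \<zeta> x *\<^sub>R \<phi> x" and ?b = "\<lambda>x. (1 - \<zeta> x) *\<^sub>R \<phi> x"
  have C: "C1_fun \<phi>" "C1_fun (\<lambda>x. 1 - \<zeta> x)"
    using \<phi> z(1) by (auto intro!: C1_fun_diff dest: C1cD)
  have a: "?a \<in> C1c A" by (rule C1c_scaleR'[OF z(1) C(1)])
  have b: "?b \<in> C1c B"
  proof (rule C1cI[OF C1_fun_scaleR[OF C(2,1)]])
    show "compact (K - V)" using K(1) z(4) by (rule compact_diff)
    show "K - V \<subseteq> B" using z(5) by auto
    show "(1 - \<zeta> x) *\<^sub>R \<phi> x = 0" if "x \<notin> K - V" for x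
      using that K(3) z(6) by auto
  qed
  have a1: "norm (?a x) \<le> 1" for x
    using mult_mono[of "\<bar>\<zeta> x\<bar>" 1 "norm (\<phi> x)" 1] z(2,3)[of x] 1[of x] by simp
  have b1: "norm (?b x) \<le> 1" for x
    using mult_mono[of "\<bar>1 - \<zeta> x\<bar>" 1 "norm (\<phi> x)" 1] z(2,3)[of x] 1[of x] by simp
  have div: "divergence \<phi> x = divergence ?a x + divergence ?b x" for x
    using divergence_add[OF C1cD[OF a] C1cD[OF b], of x] by (simp add: algebra_simps)
  have "(\<integral>x. w x * divergence \<phi> x \<partial>lebesgue_on (A \<union> B)) = (\<integral>x. w x * divergence ?a x + w x * divergence ?b x \<partial>lborel)"
    using A B wm \<phi> by (subst integral_divergence_lborel) (auto simp: div distrib_left)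
  also have "\<dots> = (\<integral>x. w x * divergence ?a x \<partial>lborel) + (\<integral>x. w x * divergence ?b x \<partial>lborel)"
    by (intro Bochner_Integration.integral_add integrable_mult_divergence[OF w a] integrable_mult_divergence[OF w b])
  also have "\<dots> = (\<integral>x. w x * divergence ?a x \<partial>lebesgue_on A) + (\<integral>x. w x * divergence ?b x \<partial>lebesgue_on B)"
    by (simp add: integral_divergence_lborel[OF A wm a] integral_divergence_lborel[OF B wm b])
  also have "ennreal \<dots> \<le> TV A w + TV B w"
    by (rule order_trans[OF ennreal_plus_le add_mono[OF TV_upper[OF a a1] TV_upper[OF b b1]]])
  finally show "ennreal (\<integral>x. w x * divergence \<phi> x \<partial>lebesgue_on (A \<union> B)) \<le> TV A w + TV B w" .
qed

section \<open>Convolution with test functions\<close>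

text \<open>Weight, measure and shift are kept general for two applications: averaging \<phi> along
  a segment, where \<open>T t\<close> is a multiple of a fixed vector, and mollification, where
  \<open>T\<close> is the identity. All derivatives fall on \<Psi>, so integrability of
  \<open>a\<close> suffices.\<close>

lemma
  fixes \<Psi> :: "real^'n \<Rightarrow> 'b::{banach, second_countable_topology}" and a :: "'t \<Rightarrow> real" and T :: "'t \<Rightarrow> real^'n"
  assumes a: "integrable M a" and T [measurable]: "T \<in> borel_measurable M" and \<Psi>: "\<Psi> \<in> C1c U"
  shows integrable_convolution: "\<And>y. integrable M (\<lambda>t. a t *\<^sub>R \<Psi> (y - T t))"
    and C1_fun_convolution: "C1_fun (\<lambda>y. \<integral>t. a t *\<^sub>R \<Psi> (y - T t) \<partial>M)"
    and frechet_derivative_convolution: "\<And>y v. frechet_derivative (\<lambda>y. \<integral>t. a t *\<^sub>R \<Psi> (y - T t) \<partial>M) (at y) v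
      = (\<integral>t. a t *\<^sub>R frechet_derivative \<Psi> (at (y - T t)) v \<partial>M)"
    and integrable_convolution_derivative: "\<And>y v. integrable M (\<lambda>t. a t *\<^sub>R frechet_derivative \<Psi> (at (y - T t)) v)"
proof -
  note [measurable] = borel_measurable_integrable[OF a]
  have C: "C1_fun \<Psi>" using \<Psi> by (rule C1cD)
  let ?D = "\<lambda>x. frechet_derivative \<Psi> (at x)"
  have [measurable]: "\<Psi> \<in> borel_measurable borel"
    by (rule borel_measurable_continuous_onI[OF C1_fun_continuous[OF C]])
  have [measurable]: "(\<lambda>x. ?D x v) \<in> borel_measurable borel" for v
    by (rule borel_measurable_continuous_onI[OF C1_fun_continuous_frechet[OF C]])
  obtain B0 where B0: "B0 > 0" "\<And>x. norm (\<Psi> x) \<le> B0" using C1c_bounded[OF \<Psi>] by metis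
  obtain B where B: "B > 0" "\<And>x v. norm (?D x v) \<le> B * norm v" "\<And>x y. norm (\<Psi> x - \<Psi> y) \<le> B * norm (x - y)"
    using C1c_lipschitz[OF \<Psi>] by metis
  have Dlin: "bounded_linear (?D x)" for x
    using C1_fun_has_derivative[OF C] by (rule has_derivative_bounded_linear)
  have bnd: "integrable M (\<lambda>t. a t *\<^sub>R g t)" if [measurable]: "g \<in> borel_measurable M" and "\<And>t. norm (g t) \<le> c" for g :: "'t \<Rightarrow> 'c::{banach, second_countable_topology}" and c
  proof (rule Bochner_Integration.integrable_bound[OF integrable_mult_right[OF a, of c]])
    show "AE t in M. norm (a t *\<^sub>R g t) \<le> norm (c * a t)"
    proof (intro always_eventually allI)
      fix t
      have "\<bar>a t\<bar> * norm (g t) \<le> \<bar>a t\<bar> * \<bar>c\<bar>" using that(2)[of t] by (intro mult_left_mono) auto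
      then show "norm (a t *\<^sub>R g t) \<le> norm (c * a t)" by (simp add: abs_mult mult.commute)
    qed
  qed measurable
  show int: "integrable M (\<lambda>t. a t *\<^sub>R \<Psi> (y - T t))" for y  :: "real^'n"
    by (rule bnd[of _ B0]) (use B0 in auto)
  show intD: "integrable M (\<lambda>t. a t *\<^sub>R ?D (y - T t) v)" for y v
    by (rule bnd[of _ "B * norm v"]) (use B in auto)
  let ?F = "\<lambda>y. \<integral>t. a t *\<^sub>R \<Psi> (y - T t) \<partial>M" and ?F' = "\<lambda>y v. \<integral>t. a t *\<^sub>R ?D (y - T t) v \<partial>M"
  have seq0: "(\<lambda>n. \<integral>t. \<bar>a t\<bar> * r n t \<partial>M) \<longlonglongrightarrow> 0"
    if [measurable]: "\<And>n. r n \<in> borel_measurable M" and r: "\<And>n t. 0 \<le> r n t" "\<And>n t. r n t \<le> c" "\<And>t. (\<lambda>n. r n t) \<longlonglongrightarrow> 0"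
    for r :: "nat \<Rightarrow> 't \<Rightarrow> real" and c
  proof -
    have "(\<lambda>n. \<integral>t. \<bar>a t\<bar> * r n t \<partial>M) \<longlonglongrightarrow> (\<integral>t. 0 \<partial>M)"
    proof (rule integral_dominated_convergence)
      show "integrable M (\<lambda>t. \<bar>a t\<bar> * c)" using a by (intro integrable_mult_left integrable_abs)
      show "AE t in M. (\<lambda>n. \<bar>a t\<bar> * r n t) \<longlonglongrightarrow> 0"
        using r(3) by (intro always_eventually allI tendsto_mult_right_zero)
      show "AE t in M. norm (\<bar>a t\<bar> * r n t) \<le> \<bar>a t\<bar> * c" for n
        using r(1,2) by (intro always_eventually allI) (auto intro!: mult_left_mono)
    qed measurable
    then show ?thesis by simp
  qed
  have deriv: "(?F has_derivative ?F' y) (at y)" for y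
    unfolding has_derivative_iff_norm
  proof
    show "bounded_linear (?F' y)"
    proof (rule bounded_linear_intro[where K="(\<integral>t. \<bar>a t\<bar> \<partial>M) * B"])
      fix v w and r :: real
      show "?F' y (v + w) = ?F' y v + ?F' y w"
        using intD by (simp add: linear_add[OF bounded_linear.linear[OF Dlin]] scaleR_add_right)
      have "a t *\<^sub>R ?D (y - T t) (r *\<^sub>R v) = r *\<^sub>R (a t *\<^sub>R ?D (y - T t) v)" for t
        by (simp add: linear_scale[OF bounded_linear.linear[OF Dlin]])
      then show "?F' y (r *\<^sub>R v) = r *\<^sub>R ?F' y v"
        by (simp only:) (simp del: scaleR_scaleR add: intD)
      have "norm (?F' y v) \<le> (\<integral>t. norm (a t *\<^sub>R ?D (y - T t) v) \<partial>M)"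
        by (rule integral_norm_bound)
      also have "\<dots> \<le> (\<integral>t. \<bar>a t\<bar> * (B * norm v) \<partial>M)"
        using intD a B(2) by (intro integral_mono integrable_norm integrable_mult_left integrable_abs)
          (auto intro!: mult_left_mono)
      also have "\<dots> = (\<integral>t. \<bar>a t\<bar> \<partial>M) * (B * norm v)" using a by simp
      finally show "norm (?F' y v) \<le> norm v * ((\<integral>t. \<bar>a t\<bar> \<partial>M) * B)" by (simp add: mult_ac)
    qed
    show "((\<lambda>z. norm (?F z - ?F y - ?F' y (z - y)) / norm (z - y)) \<longlongrightarrow> 0) (at y)"
      unfolding tendsto_at_iff_sequentially comp_def
    proof (intro allI impI)
      fix X assume X: "\<forall>i. X i \<in> UNIV - {y}" "X \<longlonglongrightarrow> y"
      \<comment> \<open>The normalised remainder of the first-order expansion of \<Psi> at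
        \<open>y - T t\<close>. It is at most \<open>2 * B\<close> by the Lipschitz estimate and
        tends to 0 for every \<open>t\<close>, so dominated convergence gives the derivative of the
        integral.\<close>
      define r where "r n t = norm (\<Psi> (X n - T t) - \<Psi> (y - T t) - ?D (y - T t) (X n - y)) / norm (X n - y)" for n t
      have Xy: "norm (X n - y) > 0" for n using X(1) by auto
      have cancel: "0 < m \<Longrightarrow> b * c = m * (b * (c / m))" for b c m :: real by simp
      have rm [measurable]: "r n \<in> borel_measurable M" for n unfolding r_def[abs_def] by measurable
      have r0: "0 \<le> r n t" for n t unfolding r_def by simp
      have r2: "r n t \<le> 2 * B" for n t
      proof -
        have "norm (\<Psi> (X n - T t) - \<Psi> (y - T t) - ?D (y - T t) (X n - y)) \<le> B * norm (X n - y) + B * norm (X n - y)"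
          using B(3)[of "X n - T t" "y - T t"] B(2)[of "y - T t" "X n - y"]
          by (intro order_trans[OF norm_triangle_ineq4 add_mono]) auto
        then show ?thesis unfolding r_def using Xy[of n] by (simp add: field_simps)
      qed
      have r3: "(\<lambda>n. r n t) \<longlonglongrightarrow> 0" for t
      proof -
        have "((\<lambda>z. norm (\<Psi> z - \<Psi> (y - T t) - ?D (y - T t) (z - (y - T t))) / norm (z - (y - T t))) \<longlongrightarrow> 0) (at (y - T t))"
          using C1_fun_has_derivative[OF C, of "y - T t"] unfolding has_derivative_iff_norm by blast
        moreover have "filterlim (\<lambda>n. X n - T t) (at (y - T t)) sequentially"
          unfolding filterlim_at using X by (auto intro!: tendsto_diff)
        ultimately have "(\<lambda>n. norm (\<Psi> (X n - T t) - \<Psi> (y - T t) - ?D (y - T t) (X n - T t - (y - T t))) / norm (X n - T t - (y - T t))) \<longlonglongrightarrow> 0"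
          by (rule filterlim_compose)
        then show ?thesis unfolding r_def by simp
      qed
      have lim: "(\<lambda>n. \<integral>t. \<bar>a t\<bar> * r n t \<partial>M) \<longlonglongrightarrow> 0"
        by (rule seq0[OF rm r0 r2 r3])
      show "(\<lambda>n. norm (?F (X n) - ?F y - ?F' y (X n - y)) / norm (X n - y)) \<longlonglongrightarrow> 0"
      proof (rule tendsto_sandwich[OF _ _ tendsto_const lim])
        show "eventually (\<lambda>n. norm (?F (X n) - ?F y - ?F' y (X n - y)) / norm (X n - y) \<le> (\<integral>t. \<bar>a t\<bar> * r n t \<partial>M)) sequentially"
        proof (intro always_eventually allI)
          fix n
          have "?F (X n) - ?F y - ?F' y (X n - y) = (\<integral>t. a t *\<^sub>R (\<Psi> (X n - T t) - \<Psi> (y - T t) - ?D (y - T t) (X n - y)) \<partial>M)"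
            using int intD by (simp add: scaleR_diff_right)
          then have "norm (?F (X n) - ?F y - ?F' y (X n - y)) \<le> (\<integral>t. norm (a t *\<^sub>R (\<Psi> (X n - T t) - \<Psi> (y - T t) - ?D (y - T t) (X n - y))) \<partial>M)"
            by (simp only: integral_norm_bound)
          also have "\<dots> = (\<integral>t. norm (X n - y) * (\<bar>a t\<bar> * r n t) \<partial>M)"
          proof -
            have "norm (a t *\<^sub>R (\<Psi> (X n - T t) - \<Psi> (y - T t) - ?D (y - T t) (X n - y))) = norm (X n - y) * (\<bar>a t\<bar> * r n t)" for t
              unfolding r_def norm_scaleR by (rule cancel[OF Xy])
            then show ?thesis by (simp only:)
          qed
          also have "\<dots> = norm (X n - y) * (\<integral>t. \<bar>a t\<bar> * r n t \<partial>M)"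
            by (rule integral_mult_right_zero)
          finally show "norm (?F (X n) - ?F y - ?F' y (X n - y)) / norm (X n - y) \<le> (\<integral>t. \<bar>a t\<bar> * r n t \<partial>M)"
            using Xy[of n] by (simp only: pos_divide_le_eq mult.commute)
        qed
      qed auto
    qed
  qed
  have cont: "continuous_on UNIV (\<lambda>y. ?F' y v)" for v
  proof (rule continuous_on_sequentiallyI)
    fix X :: "nat \<Rightarrow> real^'n" and y assume X: "X \<longlonglongrightarrow> y"
    show "(\<lambda>n. ?F' (X n) v) \<longlonglongrightarrow> ?F' y v"
    proof (rule integral_dominated_convergence)
      show "integrable M (\<lambda>t. \<bar>a t\<bar> * (B * norm v))" using a by (intro integrable_mult_left integrable_abs)
      show "AE t in M. (\<lambda>n. a t *\<^sub>R ?D (X n - T t) v) \<longlonglongrightarrow> a t *\<^sub>R ?D (y - T t) v"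
      proof (intro always_eventually allI tendsto_scaleR tendsto_const)
        fix t
        show "(\<lambda>n. ?D (X n - T t) v) \<longlonglongrightarrow> ?D (y - T t) v"
          by (rule continuous_on_tendsto_compose[OF C1_fun_continuous_frechet[OF C]])
            (auto intro!: tendsto_diff X)
      qed
      show "AE t in M. norm (a t *\<^sub>R ?D (X n - T t) v) \<le> \<bar>a t\<bar> * (B * norm v)" for n
        using B(2) by (intro always_eventually allI) (auto intro!: mult_left_mono)
    qed measurable
  qed
  show "C1_fun ?F" by (rule C1_funI[OF deriv cont])
  show "frechet_derivative ?F (at y) v = ?F' y v" for y v :: "real^'n"
    using frechet_derivative_eqI[OF deriv] by simp
qed

section \<open>Variation of C1 functions and the translation estimate\<close>

lemma divergence_scaleR:
  assumes "C1_fun \<phi>"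
  shows "divergence (\<lambda>x. c *\<^sub>R \<phi> x) x = c * divergence \<phi> x"
  using frechet_derivative_eqI[OF bounded_linear.has_derivative[OF bounded_linear_scaleR_right C1_fun_has_derivative[OF assms]], of c x]
  by (simp add: divergence_def sum_distrib_left)

lemma C1c_scaleR_const: "\<phi> \<in> C1c U \<Longrightarrow> (\<lambda>x. c *\<^sub>R \<phi> x) \<in> C1c U"
  by (rule C1c_linear_image[OF bounded_linear_scaleR_right])

lemma TV_bound_scaled:
  assumes "TV U u \<le> ennreal V" "V \<ge> 0" "\<phi> \<in> C1c U" "\<And>x. norm (\<phi> x) \<le> r" "r > 0"
  shows "(\<integral>x. u x * divergence \<phi> x \<partial>lebesgue_on U) \<le> r * V"
proof -
  let ?\<psi> = "\<lambda>x. (1/r) *\<^sub>R \<phi> x"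
  have "ennreal (\<integral>x. u x * divergence ?\<psi> x \<partial>lebesgue_on U) \<le> ennreal V"
    using assms by (intro order_trans[OF TV_upper assms(1)] C1c_scaleR_const) (auto simp: field_simps)
  then have "(\<integral>x. u x * divergence ?\<psi> x \<partial>lebesgue_on U) \<le> V"
    using assms(2) by simp
  moreover have "(\<lambda>x. u x * divergence ?\<psi> x) = (\<lambda>x. (1/r) * (u x * divergence \<phi> x))"
    using divergence_scaleR[OF C1cD[OF assms(3)], of "1/r"] by (simp add: mult_ac)
  ultimately have "(1/r) * (\<integral>x. u x * divergence \<phi> x \<partial>lebesgue_on U) \<le> V" by simp
  then show ?thesis using assms(5) by (simp add: field_simps)
qed

text \<open>The supremum defining \<open>TV\<close> is approached by the field - grad f / |grad f|.
  As this is not C1, the denominator is regularised by \<eta>, the quotient is replaced by a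
  polynomial on the compact closure of \<open>U\<close>, and a cutoff \<zeta> brings the support
  into \<open>U\<close>. The resulting field has norm at most 1 + \<eta>; then \<eta> tends to 0 and
  \<zeta> exhausts \<open>U\<close>.\<close>

lemma nn_integral_norm_grad_le_TV:
  fixes f :: "real^'n \<Rightarrow> real"
  assumes U: "open U" "bounded U" and f: "C1_fun f"
  shows "(\<integral>\<^sup>+x. ennreal (norm (grad f x)) \<partial>lebesgue_on U) \<le> TV U f"
proof -
  have gc: "continuous_on UNIV (grad f)" using f by (rule continuous_on_grad)
  have key: "ennreal (\<integral>x. \<zeta> x * norm (grad f x) \<partial>lborel) \<le> TV U f"
    if z: "\<zeta> \<in> C1c U" "\<And>x. 0 \<le> \<zeta> x" "\<And>x. \<zeta> x \<le> 1" for \<zeta> :: "real^'n \<Rightarrow> real"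
  proof (cases "TV U f = \<infinity>")
    case False
    then obtain V where V: "V \<ge> 0" "TV U f = ennreal V" by (cases "TV U f") auto
    obtain K where K: "compact K" "K \<subseteq> U" "\<And>x. x \<notin> K \<Longrightarrow> \<zeta> x = 0" using C1cE[OF z(1)] by metis
    have zc: "continuous_on UNIV \<zeta>" using z(1) by (intro C1_fun_continuous C1cD)
    have zi: "integrable lborel (\<lambda>x. \<zeta> x * g x)" if "continuous_on UNIV g" for g :: "real^'n \<Rightarrow> real"
      by (rule integrable_continuous_compact_support[OF continuous_on_mult[OF zc that] K(1)]) (simp add: K(3))
    let ?I = "\<integral>x. \<zeta> x * norm (grad f x) \<partial>lborel" and ?Z = "\<integral>x. \<zeta> x \<partial>lborel"
    \<comment> \<open>The loss \<eta> \<open>?Z\<close> is due to the regularised denominator, the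
      loss \<eta> \<open>?I\<close> to the polynomial approximation.\<close>
    have est: "?I - \<eta> * (?Z + ?I) \<le> (1 + \<eta>) * V" if \<eta>: "0 < \<eta>" for \<eta>
    proof -
      define d where "d x = sqrt (\<eta>\<^sup>2 + (norm (grad f x))\<^sup>2)" for x
      have d: "d x > 0" for x unfolding d_def using \<eta> by (simp add: add_pos_nonneg)
      have dn: "norm (grad f x) \<le> d x" "d x \<le> \<eta> + norm (grad f x)" for x
        unfolding d_def using \<eta> by (auto intro!: real_le_rsqrt real_le_lsqrt simp: power2_sum)
      have "continuous_on UNIV (\<lambda>x. (1 / d x) *\<^sub>R grad f x)"
        unfolding d_def using d[unfolded d_def] by (intro continuous_intros gc) (auto simp: less_imp_neq[THEN not_sym])
      then have "continuous_on (closure U) (\<lambda>x. (1 / d x) *\<^sub>R grad f x)"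
        by (rule continuous_on_subset) simp
      moreover have "compact (closure U)" using U(2) by simp
      ultimately obtain q where q: "polynomial_function q" "\<And>x. x \<in> closure U \<Longrightarrow> norm ((1 / d x) *\<^sub>R grad f x - q x) < \<eta>"
        using Stone_Weierstrass_polynomial_function[of "closure U" "\<lambda>x. (1 / d x) *\<^sub>R grad f x" \<eta>] \<eta> by metis
      have qC: "C1_fun q" using q(1) by (rule C1_fun_polynomial)
      let ?\<phi> = "\<lambda>x. \<zeta> x *\<^sub>R (- q x)"
      have \<phi>: "?\<phi> \<in> C1c U" by (rule C1c_scaleR'[OF z(1) C1_fun_minus[OF qC]])
      have nq: "norm (q x) \<le> 1 + \<eta>" if "x \<in> U" for x
      proof -
        have x: "x \<in> closure U" using that closure_subset[of U] by (rule subsetD[rotated])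
        have "norm (q x) \<le> norm ((1 / d x) *\<^sub>R grad f x) + norm ((1 / d x) *\<^sub>R grad f x - q x)"
          using norm_triangle_ineq4[of "(1 / d x) *\<^sub>R grad f x" "(1 / d x) *\<^sub>R grad f x - q x"] by simp
        also have "norm ((1 / d x) *\<^sub>R grad f x) \<le> 1" using dn(1)[of x] d[of x] by (simp add: field_simps)
        finally show ?thesis using q(2)[OF x] by linarith
      qed
      have n\<phi>: "norm (?\<phi> x) \<le> 1 + \<eta>" for x
      proof (cases "x \<in> U")
        case True
        have "\<bar>\<zeta> x\<bar> * norm (q x) \<le> 1 * (1 + \<eta>)" using z(2,3)[of x] nq[OF True] \<eta> by (intro mult_mono) auto
        then show ?thesis by simp
      next
        case False
        then have "\<zeta> x = 0" using K(2) by (intro K(3)) auto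
        then show ?thesis using \<eta> by simp
      qed
      have "(\<integral>x. \<zeta> x * (grad f x \<bullet> q x) \<partial>lborel) = - (\<integral>x. grad f x \<bullet> ?\<phi> x \<partial>lborel)" by simp
      also have "(\<integral>x. grad f x \<bullet> ?\<phi> x \<partial>lborel) = (\<integral>x. grad f x \<bullet> ?\<phi> x \<partial>lebesgue_on U)"
      proof (rule lebesgue_on_integral_eq_lborel[OF sets_lebesgue_open[OF U(1)], symmetric])
        show "(\<lambda>x. grad f x \<bullet> ?\<phi> x) \<in> borel_measurable borel"
          by (intro borel_measurable_continuous_onI continuous_intros gc zc C1_fun_continuous[OF qC])
        show "grad f x \<bullet> ?\<phi> x = 0" if "x \<notin> U" for x
          using that K(2,3) by auto
      qed
      also have "- \<dots> = (\<integral>x. f x * divergence ?\<phi> x \<partial>lebesgue_on U)"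
        by (rule weak_gradient_divergence(1)[OF U(1) has_weak_gradient_C1[OF U(1) f] \<phi>, symmetric])
      also have "\<dots> \<le> (1 + \<eta>) * V"
        using V \<eta> by (intro TV_bound_scaled[OF _ V(1) \<phi> n\<phi>]) auto
      finally have 1: "(\<integral>x. \<zeta> x * (grad f x \<bullet> q x) \<partial>lborel) \<le> (1 + \<eta>) * V" .
      have "?I - \<eta> * (?Z + ?I) = (\<integral>x. \<zeta> x * (norm (grad f x) - \<eta> * (1 + norm (grad f x))) \<partial>lborel)"
        using zi[of "\<lambda>x. 1"] zi[OF continuous_on_norm[OF gc]] by (simp add: algebra_simps)
      also have "\<dots> \<le> (\<integral>x. \<zeta> x * (grad f x \<bullet> q x) \<partial>lborel)"
      proof (rule integral_mono)
        show "integrable lborel (\<lambda>x. \<zeta> x * (norm (grad f x) - \<eta> * (1 + norm (grad f x))))"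
          by (intro zi continuous_intros gc)
        show "integrable lborel (\<lambda>x. \<zeta> x * (grad f x \<bullet> q x))"
          by (intro zi continuous_intros gc C1_fun_continuous[OF qC])
        fix x
        show "\<zeta> x * (norm (grad f x) - \<eta> * (1 + norm (grad f x))) \<le> \<zeta> x * (grad f x \<bullet> q x)"
        proof (cases "x \<in> U")
          case True
          then have x: "x \<in> closure U" using closure_subset[of U] by (rule subsetD[rotated])
          let ?V = "(1 / d x) *\<^sub>R grad f x"
          have "grad f x \<bullet> (?V - q x) \<le> norm (grad f x) * norm (?V - q x)" by (rule norm_cauchy_schwarz)
          also have "\<dots> \<le> norm (grad f x) * \<eta>" using q(2)[OF x] by (intro mult_left_mono) auto
          finally have "grad f x \<bullet> ?V - norm (grad f x) * \<eta> \<le> grad f x \<bullet> q x" by (simp add: inner_diff_right)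
          moreover have "norm (grad f x) - \<eta> \<le> grad f x \<bullet> ?V"
          proof -
            \<comment> \<open>Since d <= \<eta> + |grad f|, the product is at most |grad f|^2 -
              \<eta>^2. The first case treats a nonpositive factor, where this bound on
              \<open>d\<close> would point the wrong way.\<close>
            have "(norm (grad f x) - \<eta>) * d x \<le> (norm (grad f x))\<^sup>2"
            proof (cases "norm (grad f x) \<le> \<eta>")
              case True
              then have "(norm (grad f x) - \<eta>) * d x \<le> 0" using d[of x] by (simp add: mult_nonpos_nonneg)
              then show ?thesis using zero_le_power2[of "norm (grad f x)"] by linarith
            next
              case False
              then have "(norm (grad f x) - \<eta>) * d x \<le> (norm (grad f x) - \<eta>) * (\<eta> + norm (grad f x))"
                using dn(2)[of x] by (intro mult_left_mono) auto
              also have "\<dots> \<le> (norm (grad f x))\<^sup>2" by (simp add: algebra_simps power2_eq_square)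
              finally show ?thesis .
            qed
            then show ?thesis using d[of x] by (simp add: field_simps power2_norm_eq_inner)
          qed
          ultimately show ?thesis using z(2)[of x] by (intro mult_left_mono) (auto simp: algebra_simps)
        next
          case False
          then have "\<zeta> x = 0" using K by auto
          then show ?thesis by simp
        qed
      qed
      finally show ?thesis using 1 by linarith
    qed
    have "((\<lambda>\<eta>. ?I - \<eta> * (?Z + ?I)) \<longlongrightarrow> ?I - 0 * (?Z + ?I)) (at_right 0)"
      by (intro tendsto_intros)
    moreover have "((\<lambda>\<eta>. (1 + \<eta>) * V) \<longlongrightarrow> (1 + 0) * V) (at_right 0)"
      by (intro tendsto_intros)
    moreover have "eventually (\<lambda>\<eta>. ?I - \<eta> * (?Z + ?I) \<le> (1 + \<eta>) * V) (at_right 0)"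
      using est by (auto simp: eventually_at_right_field intro: exI[of _ 1])
    ultimately have "?I - 0 * (?Z + ?I) \<le> (1 + 0) * V"
      by (intro tendsto_le[OF trivial_limit_at_right_real])
    then show ?thesis using V by (simp add: ennreal_leI)
  qed simp
  obtain C :: "nat \<Rightarrow> (real^'n) set" where C: "\<And>n. compact (C n)" "\<And>n. C n \<subseteq> U" "incseq C" "(\<Union>n. C n) = U"
    using open_compact_exhaustion[OF U(1)] by metis
  have gm [measurable]: "grad f \<in> borel_measurable borel" using gc by (rule borel_measurable_continuous_onI)
  have Um [measurable]: "U \<in> sets borel" using U(1) by simp
  have Cm [measurable]: "C n \<in> sets borel" for n using C(1) by (simp add: compact_imp_closed)
  have "(\<integral>\<^sup>+x. ennreal (norm (grad f x)) \<partial>lebesgue_on U) = (\<integral>\<^sup>+x. ennreal (norm (grad f x)) * indicator U x \<partial>lborel)"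
    by (subst nn_integral_restrict_space) (auto simp: nn_integral_completion)
  also have "\<dots> = (\<integral>\<^sup>+x. (SUP n. ennreal (norm (grad f x)) * indicator (C n) x) \<partial>lborel)"
  proof (rule nn_integral_cong)
    fix x
    show "ennreal (norm (grad f x)) * indicator U x = (SUP n. ennreal (norm (grad f x)) * indicator (C n) x)"
    proof (cases "x \<in> U")
      case True
      then obtain n where n: "x \<in> C n" using C(4) by blast
      show ?thesis
      proof (rule antisym)
        show "ennreal (norm (grad f x)) * indicator U x \<le> (SUP n. ennreal (norm (grad f x)) * indicator (C n) x)"
          using n True by (intro SUP_upper2[of n]) auto
        show "(SUP n. ennreal (norm (grad f x)) * indicator (C n) x) \<le> ennreal (norm (grad f x)) * indicator U x"
          using True by (intro SUP_least) (auto simp: indicator_def)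
      qed
    next
      case False
      then have "x \<notin> C n" for n using C(2) by blast
      then show ?thesis using False by simp
    qed
  qed
  also have "\<dots> = (SUP n. \<integral>\<^sup>+x. ennreal (norm (grad f x)) * indicator (C n) x \<partial>lborel)"
  proof (rule nn_integral_monotone_convergence_SUP)
    have "indicator (C m) x \<le> (indicator (C n) x :: ennreal)" if "m \<le> n" for m n x
      using incseqD[OF C(3) that] by (auto simp: indicator_def)
    then show "incseq (\<lambda>n x. ennreal (norm (grad f x)) * indicator (C n) x)"
      unfolding incseq_def le_fun_def by (intro allI impI mult_left_mono) auto
  qed measurable
  also have "\<dots> \<le> TV U f"
  proof (rule SUP_least)
    fix n
    obtain \<zeta> :: "real^'n \<Rightarrow> real" and V where z: "\<zeta> \<in> C1c U" "\<And>x. 0 \<le> \<zeta> x" "\<And>x. \<zeta> x \<le> 1" "C n \<subseteq> V" "\<And>x. x \<in> V \<Longrightarrow> \<zeta> x = 1"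
      using C1c_cutoff[OF C(1) U(1) C(2)] by metis
    obtain K where K: "compact K" "\<And>x. x \<notin> K \<Longrightarrow> \<zeta> x = 0" using C1cE[OF z(1)] by metis
    have i: "integrable lborel (\<lambda>x. \<zeta> x * norm (grad f x))"
      by (rule integrable_continuous_compact_support[OF continuous_on_mult[OF C1_fun_continuous[OF C1cD[OF z(1)]] continuous_on_norm[OF gc]] K(1)])
        (simp add: K(2))
    have "(\<integral>\<^sup>+x. ennreal (norm (grad f x)) * indicator (C n) x \<partial>lborel) \<le> (\<integral>\<^sup>+x. ennreal (\<zeta> x * norm (grad f x)) \<partial>lborel)"
    proof (rule nn_integral_mono)
      fix x show "ennreal (norm (grad f x)) * indicator (C n) x \<le> ennreal (\<zeta> x * norm (grad f x))"
        using z(5)[OF subsetD[OF z(4)], of x] by (cases "x \<in> C n") auto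
    qed
    also have "\<dots> = ennreal (\<integral>x. \<zeta> x * norm (grad f x) \<partial>lborel)"
      by (rule nn_integral_eq_integral[OF i]) (auto simp: z(2))
    also have "\<dots> \<le> TV U f" by (rule key[OF z(1,2,3)])
    finally show "(\<integral>\<^sup>+x. ennreal (norm (grad f x)) * indicator (C n) x \<partial>lborel) \<le> TV U f" .
  qed
  finally show ?thesis .
qed

text \<open>By duality it suffices to test with \<phi>. The difference \<phi>(y - h) - \<phi>(y) is
  the divergence of the field -c(y) h, where c(y) is the average of \<phi> over the segment from y -
  h to y, by the fundamental theorem of calculus along that segment. As |c| <= 1, the field has norm
  at most |h|, which is the factor in the bound.\<close>

lemma nn_integral_translation_le_TV:
  fixes w :: "real^'n \<Rightarrow> real"
  assumes w: "integrable lborel w" and V: "TV UNIV w \<le> ennreal V" "V \<ge> 0"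
  shows "(\<integral>\<^sup>+x. ennreal \<bar>w (h + x) - w x\<bar> \<partial>lborel) \<le> ennreal (norm h * V)"
proof (cases "h = 0")
  case False
  have wm [measurable]: "w \<in> borel_measurable borel" using w by auto
  have wh: "integrable lborel (\<lambda>x. w (h + x))"
    using w by (subst (asm) lborel_distr_plus[symmetric, of h]) (subst (asm) integrable_distr_eq, auto)
  have li: "locally_integrable UNIV (\<lambda>x. w (h + x) - w x)"
    unfolding locally_integrable_def set_integrable_def
  proof (intro allI impI)
    fix K :: "(real^'n) set" assume "compact K \<and> K \<subseteq> UNIV"
    then have "K \<in> sets borel" by (simp add: compact_imp_closed)
    then have "integrable lborel (\<lambda>x. indicator K x *\<^sub>R (w (h + x) - w x))"
      using w wh by (intro integrable_mult_indicator Bochner_Integration.integrable_diff) auto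
    then show "integrable lebesgue (\<lambda>x. indicator K x *\<^sub>R (w (h + x) - w x))"
      by (subst integrable_completion) auto
  qed
  have "(\<integral>\<^sup>+x. ennreal \<bar>w (h + x) - w x\<bar> \<partial>lebesgue_on UNIV) \<le> ennreal (norm h * V)"
  proof (rule C1c_duality[OF open_UNIV li])
    fix \<phi> :: "real^'n \<Rightarrow> real" assume \<phi>: "\<phi> \<in> C1c UNIV" and 1: "\<And>x. \<bar>\<phi> x\<bar> \<le> 1"
    have C: "C1_fun \<phi>" using \<phi> by (rule C1cD)
    note [measurable] = borel_measurable_continuous_onI[OF C1_fun_continuous[OF C]]
    let ?a = "indicator {0..1::real} :: real \<Rightarrow> real" and ?T = "\<lambda>t::real. t *\<^sub>R h"
    have a: "integrable lborel ?a" by (intro integrable_real_indicator) auto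
    have T: "?T \<in> borel_measurable lborel" by measurable
    note conv = C1_fun_convolution[OF a T \<phi>] frechet_derivative_convolution[OF a T \<phi>]
      integrable_convolution[OF a T \<phi>]
    define c where "c y = (\<integral>t. ?a t *\<^sub>R \<phi> (y - ?T t) \<partial>lborel)" for y
    have cC: "C1_fun c" using conv(1) unfolding c_def[abs_def] .
    obtain K where K: "compact K" "\<And>x. x \<notin> K \<Longrightarrow> \<phi> x = 0" using C1cE[OF \<phi>] by metis
    obtain R where R: "R > 0" "\<And>x. x \<in> K \<Longrightarrow> norm x \<le> R"
      using compact_imp_bounded[OF K(1)] unfolding bounded_pos by auto
    have c0: "c y = 0" if "y \<notin> cball 0 (R + norm h)" for y
    proof -
      have "?a t *\<^sub>R \<phi> (y - ?T t) = 0" for t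
      proof (cases "t \<in> {0..1}")
        case True
        have "norm y \<le> norm (y - t *\<^sub>R h) + norm (t *\<^sub>R h)"
          using norm_triangle_ineq[of "y - t *\<^sub>R h" "t *\<^sub>R h"] by simp
        moreover have "norm (t *\<^sub>R h) \<le> norm h" using True mult_right_mono[of t 1 "norm h"] by simp
        ultimately have "norm (y - t *\<^sub>R h) > R" using that by simp
        then have "\<phi> (y - t *\<^sub>R h) = 0" using R(2) by (intro K(2)) fastforce
        then show ?thesis by simp
      qed simp
      then show ?thesis unfolding c_def by (simp only: Bochner_Integration.integral_zero)
    qed
    have c1: "\<bar>c y\<bar> \<le> 1" for y
    proof -
      have "norm (c y) \<le> (\<integral>t. norm (?a t *\<^sub>R \<phi> (y - ?T t)) \<partial>lborel)" unfolding c_def by (rule integral_norm_bound)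
      also have "\<dots> \<le> (\<integral>t. ?a t \<partial>lborel)"
        by (rule integral_mono[OF integrable_norm[OF conv(3)[of y]] a]) (use 1 in \<open>auto simp: indicator_def\<close>)
      also have "\<dots> = 1" by simp
      finally show ?thesis by simp
    qed
    let ?\<Phi> = "\<lambda>y. c y *\<^sub>R (- h)"
    have Phi: "?\<Phi> \<in> C1c UNIV"
      by (rule C1cI[OF C1_fun_scaleR[OF cC C1_fun_const] compact_cball[of 0 "R + norm h"]]) (auto simp: c0)
    have nPhi: "norm (?\<Phi> y) \<le> norm h" for y
      using c1[of y] mult_right_mono[of "\<bar>c y\<bar>" 1 "norm h"] by simp
    have div: "divergence ?\<Phi> y = \<phi> (y - h) - \<phi> y" for y
    proof -
      have d: "frechet_derivative ?\<Phi> (at y) = (\<lambda>v. frechet_derivative c (at y) v *\<^sub>R (- h))"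
        by (rule frechet_derivative_eqI[OF has_derivative_scaleR_left[OF C1_fun_has_derivative[OF cC]]])
      have "divergence ?\<Phi> y = - (grad c y \<bullet> h)"
        unfolding divergence_def d by (simp add: grad_def inner_vec_def sum_negf)
      also have "grad c y \<bullet> h = frechet_derivative c (at y) h"
        using cC by (intro frechet_derivative_eq_grad[symmetric]) (auto simp: C1_fun_def)
      also have "\<dots> = (\<integral>t. ?a t *\<^sub>R frechet_derivative \<phi> (at (y - ?T t)) h \<partial>lborel)"
        using conv(2)[of y h] unfolding c_def[abs_def] .
      also have "\<dots> = - (\<integral>t. (- frechet_derivative \<phi> (at (y - ?T t)) h) * ?a t \<partial>lborel)"
        by (simp add: mult.commute)
      also have "(\<integral>t. (- frechet_derivative \<phi> (at (y - ?T t)) h) * ?a t \<partial>lborel) = \<phi> (y - ?T 1) - \<phi> (y - ?T 0)"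
      proof (rule integral_FTC_Icc_real)
        fix t :: real
        have lin: "bounded_linear (frechet_derivative \<phi> (at (y - ?T t)))"
          using C1_fun_has_derivative[OF C] by (rule has_derivative_bounded_linear)
        have "((\<lambda>t. y - ?T t) has_derivative (\<lambda>s. - (s *\<^sub>R h))) (at t)"
          by (auto intro!: derivative_eq_intros)
        from has_derivative_compose[OF this C1_fun_has_derivative[OF C]]
        have "((\<lambda>t. \<phi> (y - ?T t)) has_derivative (\<lambda>s. frechet_derivative \<phi> (at (y - ?T t)) (- (s *\<^sub>R h)))) (at t)" .
        moreover have "(\<lambda>s. frechet_derivative \<phi> (at (y - ?T t)) (- (s *\<^sub>R h))) = (*) (- frechet_derivative \<phi> (at (y - ?T t)) h)"
          by (rule ext) (simp add: linear_neg[OF bounded_linear.linear[OF lin]] linear_scale[OF bounded_linear.linear[OF lin]])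
        ultimately show "((\<lambda>t. \<phi> (y - ?T t)) has_real_derivative - frechet_derivative \<phi> (at (y - ?T t)) h) (at t)"
          unfolding has_field_derivative_def by (simp only:)
        show "isCont (\<lambda>t. - frechet_derivative \<phi> (at (y - ?T t)) h) t"
          using continuous_on_compose2[OF C1_fun_continuous_frechet[OF C, of h], of UNIV "\<lambda>t. y - ?T t"]
          by (intro continuous_minus) (auto simp: continuous_on_eq_continuous_at intro!: continuous_intros)
      qed simp
      finally show ?thesis by simp
    qed
    have pi: "integrable lborel (\<lambda>x. w x * \<phi> x)" "integrable lborel (\<lambda>x. w x * \<phi> (x - h))" "integrable lborel (\<lambda>x. w (h + x) * \<phi> x)"
    proof -
      have *: "integrable lborel (\<lambda>x. g x * p x)" if g: "integrable lborel g" and [measurable]: "p \<in> borel_measurable borel" and "\<And>x. \<bar>p x\<bar> \<le> 1" for g p :: "real^'n \<Rightarrow> real"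
      proof (rule Bochner_Integration.integrable_bound[OF g])
        note [measurable] = borel_measurable_integrable[OF g]
        show "(\<lambda>x. g x * p x) \<in> borel_measurable lborel" by measurable
        show "AE x in lborel. norm (g x * p x) \<le> norm (g x)"
          using that(3) mult_left_mono[OF that(3), of "\<bar>g x\<bar>" for x] by (intro always_eventually allI) (simp add: abs_mult)
      qed
      show "integrable lborel (\<lambda>x. w x * \<phi> x)" "integrable lborel (\<lambda>x. w x * \<phi> (x - h))" "integrable lborel (\<lambda>x. w (h + x) * \<phi> x)"
        using 1 by (intro * w wh; measurable)+
    qed
    have "(\<integral>x. (w (h + x) - w x) * \<phi> x \<partial>lebesgue_on UNIV) = (\<integral>x. (w (h + x) - w x) * \<phi> x \<partial>lborel)"
      by (rule lebesgue_on_integral_eq_lborel) auto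
    also have "\<dots> = (\<integral>x. w (h + x) * \<phi> x \<partial>lborel) - (\<integral>x. w x * \<phi> x \<partial>lborel)"
      using pi by (simp add: left_diff_distrib)
    also have "(\<integral>x. w (h + x) * \<phi> x \<partial>lborel) = (\<integral>x. w x * \<phi> (x - h) \<partial>lborel)"
      using lborel_integral_translation[of "\<lambda>x. w x * \<phi> (x - h)" h] by simp
    also have "\<dots> - (\<integral>x. w x * \<phi> x \<partial>lborel) = (\<integral>x. w x * divergence ?\<Phi> x \<partial>lborel)"
      unfolding div using pi by (simp add: right_diff_distrib)
    also have "\<dots> = (\<integral>x. w x * divergence ?\<Phi> x \<partial>lebesgue_on UNIV)"
      by (rule integral_divergence_lborel[OF open_UNIV wm Phi, symmetric])
    also have "\<dots> \<le> norm h * V"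
      using False by (intro TV_bound_scaled[OF V Phi nPhi]) simp
    finally show "(\<integral>x. (w (h + x) - w x) * \<phi> x \<partial>lebesgue_on UNIV) \<le> norm h * V" .
  qed
  then show ?thesis by (simp add: lebesgue_on_UNIV_eq nn_integral_completion)
qed simp

section \<open>Mollification of functions of bounded variation\<close>

lemma lborel_distr_reflection: "distr lborel borel (\<lambda>z. x - z) = (lborel :: 'a::euclidean_space measure)"
  by (subst (2) lborel_affine[of "-1" x]) (simp_all add: density_1)

lemma lborel_integral_reflection:
  fixes f :: "'a::euclidean_space \<Rightarrow> 'b::{banach, second_countable_topology}"
  assumes "f \<in> borel_measurable borel"
  shows "(\<integral>z. f (x - z) \<partial>lborel) = (\<integral>z. f z \<partial>lborel)"
proof -
  have "(\<integral>z. f z \<partial>lborel) = (\<integral>z. f z \<partial>distr lborel borel (\<lambda>z. x - z))"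
    by (simp add: lborel_distr_reflection)
  also have "\<dots> = (\<integral>z. f (x - z) \<partial>lborel)"
    using assms by (subst integral_distr) auto
  finally show ?thesis ..
qed

lemma lborel_nn_integral_reflection:
  fixes f :: "'a::euclidean_space \<Rightarrow> ennreal"
  assumes "f \<in> borel_measurable borel"
  shows "(\<integral>\<^sup>+z. f (x - z) \<partial>lborel) = (\<integral>\<^sup>+z. f z \<partial>lborel)"
proof -
  have "(\<integral>\<^sup>+z. f z \<partial>lborel) = (\<integral>\<^sup>+z. f z \<partial>distr lborel borel (\<lambda>z. x - z))"
    by (simp add: lborel_distr_reflection)
  also have "\<dots> = (\<integral>\<^sup>+z. f (x - z) \<partial>lborel)"
    using assms by (subst nn_integral_distr) auto
  finally show ?thesis ..
qed

definition mollifier :: "real \<Rightarrow> (real^'n \<Rightarrow> real) \<Rightarrow> bool" where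
  "mollifier \<delta> \<rho> \<longleftrightarrow> \<rho> \<in> C1c (ball 0 \<delta>) \<and> (\<forall>x. 0 \<le> \<rho> x) \<and> (\<integral>x. \<rho> x \<partial>lborel) = 1"

text \<open>In the terms of the convolution lemma the integrable \<open>w\<close> is the weight and
  \<rho> the test function, so that all smoothness comes from \<rho>.\<close>

definition mollify :: "(real^'n \<Rightarrow> real) \<Rightarrow> (real^'n \<Rightarrow> real) \<Rightarrow> real^'n \<Rightarrow> real" where
  "mollify \<rho> w x = (\<integral>t. w t *\<^sub>R \<rho> (x - t) \<partial>lborel)"

text \<open>A nonnegative cutoff that is 1 on a small ball has positive integral and can be
  normalised.\<close>

lemma mollifier_exists:
  assumes "\<delta> > 0"
  obtains \<rho> :: "real^'n \<Rightarrow> real" where "mollifier \<delta> \<rho>"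
proof -
  have K0: "{0::real^'n} \<subseteq> ball 0 \<delta>" using assms by simp
  obtain \<zeta> :: "real^'n \<Rightarrow> real" and V where z: "\<zeta> \<in> C1c (ball 0 \<delta>)" "\<And>x. 0 \<le> \<zeta> x" "open V" "{0} \<subseteq> V" "\<And>x. x \<in> V \<Longrightarrow> \<zeta> x = 1"
    using C1c_cutoff[OF compact_sing open_ball K0] by metis
  obtain e where e: "e > 0" "ball 0 e \<subseteq> V" using z(3,4) open_contains_ball[of V] by auto
  let ?c = "\<integral>x. \<zeta> x \<partial>lborel"
  have i: "integrable lborel \<zeta>" by (rule C1c_integrable[OF z(1)])
  have "0 < measure lborel (ball (0::real^'n) e)"
    using content_ball_pos[OF e(1), of "0::real^'n"] by (simp add: measure_completion)
  also have "\<dots> = (\<integral>x. indicator (ball (0::real^'n) e) x \<partial>lborel)" by simp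
  also have "\<dots> \<le> ?c"
  proof (rule integral_mono[OF _ i])
    show "integrable lborel (indicator (ball (0::real^'n) e) :: _ \<Rightarrow> real)"
      using emeasure_lborel_ball_finite[of 0 e] by (intro integrable_real_indicator) auto
    fix x :: "real^'n"
    show "indicator (ball 0 e) x \<le> \<zeta> x"
      using e(2) z(2)[of x] z(5)[of x] by (cases "x \<in> ball 0 e") auto
  qed
  finally have c: "?c > 0" .
  have "(\<lambda>x. (1 / ?c) *\<^sub>R \<zeta> x) \<in> C1c (ball 0 \<delta>)" by (rule C1c_scaleR_const[OF z(1)])
  then have "mollifier \<delta> (\<lambda>x. (1 / ?c) *\<^sub>R \<zeta> x)"
    unfolding mollifier_def using c z(2) by auto
  then show ?thesis by (rule that)
qed

lemma mollifierD:
  assumes "mollifier \<delta> \<rho>"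
  shows "\<rho> \<in> C1c (ball 0 \<delta>)" "\<And>x. 0 \<le> \<rho> x" "(\<integral>x. \<rho> x \<partial>lborel) = 1" "\<rho> \<in> borel_measurable borel" "integrable lborel \<rho>"
    "\<And>x. \<rho> x \<noteq> 0 \<Longrightarrow> norm x < \<delta>"
proof -
  show 1: "\<rho> \<in> C1c (ball 0 \<delta>)" "\<And>x. 0 \<le> \<rho> x" "(\<integral>x. \<rho> x \<partial>lborel) = 1"
    using assms by (auto simp: mollifier_def)
  show "\<rho> \<in> borel_measurable borel" by (rule borel_measurable_continuous_onI[OF C1_fun_continuous[OF C1cD[OF 1(1)]]])
  show "integrable lborel \<rho>" by (rule C1c_integrable[OF 1(1)])
  obtain K where K: "K \<subseteq> ball 0 \<delta>" "\<And>x. x \<notin> K \<Longrightarrow> \<rho> x = 0" using C1cE[OF 1(1)] by metis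
  show "norm x < \<delta>" if "\<rho> x \<noteq> 0" for x
  proof -
    have "x \<in> K" using K(2)[of x] that by auto
    then have "x \<in> ball 0 \<delta>" using K(1) by (rule subsetD[rotated])
    then show ?thesis by simp
  qed
qed

lemma
  assumes "integrable lborel w" "mollifier \<delta> \<rho>"
  shows C1_fun_mollify: "C1_fun (mollify \<rho> w)"
    and integrable_mollify: "integrable lborel (\<lambda>t. w t *\<^sub>R \<rho> (x - t))"
proof -
  have T: "(\<lambda>t::real^'a. t) \<in> borel_measurable lborel" by simp
  note * = C1_fun_convolution[OF assms(1) T mollifierD(1)[OF assms(2)]]
    integrable_convolution[OF assms(1) T mollifierD(1)[OF assms(2)]]
  show "C1_fun (mollify \<rho> w)" using *(1) unfolding mollify_def[abs_def] .
  show "integrable lborel (\<lambda>t. w t *\<^sub>R \<rho> (x - t))" by (rule *(2))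
qed

lemma mollifier_reflection:
  assumes "mollifier \<delta> \<rho>"
  shows "integrable lborel (\<lambda>t. \<rho> (x - t))" "(\<integral>t. \<rho> (x - t) \<partial>lborel) = 1"
proof -
  show "(\<integral>t. \<rho> (x - t) \<partial>lborel) = 1"
    using mollifierD(3,4)[OF assms] by (simp add: lborel_integral_reflection)
  \<comment> \<open>A nonintegrable function has integral 0 by convention, so the value 1 already
    proves integrability.\<close>
  then show "integrable lborel (\<lambda>t. \<rho> (x - t))"
    using not_integrable_integral_eq by fastforce
qed

text \<open>As \<rho> has integral 1, the difference of the mollification and \<open>w\<close> is an
  average of w(x - z) - w(x) with weight \<rho>(z). After the integrals are exchanged, each z
  contributes at most |z| V by the translation estimate, and |z| < \<delta> wherever \<rho>(z) is
  not 0.\<close>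

lemma nn_integral_mollify_diff:
  fixes w :: "real^'n \<Rightarrow> real"
  assumes w: "integrable lborel w" and V: "TV UNIV w \<le> ennreal V" "V \<ge> 0" and \<rho>: "mollifier \<delta> \<rho>"
  shows "(\<integral>\<^sup>+x. ennreal \<bar>mollify \<rho> w x - w x\<bar> \<partial>lborel) \<le> ennreal (\<delta> * V)"
proof -
  note [measurable] = mollifierD(4)[OF \<rho>]
  have [measurable]: "w \<in> borel_measurable borel" using w by auto
  note r0 = mollifierD(2)[OF \<rho>]
  have pt: "ennreal \<bar>mollify \<rho> w x - w x\<bar> \<le> (\<integral>\<^sup>+z. ennreal (\<rho> z * \<bar>w (- z + x) - w x\<bar>) \<partial>lborel)" for x
  proof -
    have i: "integrable lborel (\<lambda>t. w t * \<rho> (x - t))" "integrable lborel (\<lambda>t. w x * \<rho> (x - t))"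
      using integrable_mollify[OF w \<rho>] mollifier_reflection[OF \<rho>] by auto
    have "(\<integral>t. (w t - w x) * \<rho> (x - t) \<partial>lborel) = (\<integral>t. w t * \<rho> (x - t) \<partial>lborel) - (\<integral>t. w x * \<rho> (x - t) \<partial>lborel)"
      using i by (simp add: left_diff_distrib)
    also have "\<dots> = mollify \<rho> w x - w x"
      using mollifier_reflection[OF \<rho>, of x] by (simp add: mollify_def)
    finally have eq: "mollify \<rho> w x - w x = (\<integral>t. (w t - w x) * \<rho> (x - t) \<partial>lborel)" ..
    have "integrable lborel (\<lambda>t. (w t - w x) * \<rho> (x - t))"
      using i by (simp add: left_diff_distrib)
    then have "ennreal (norm (mollify \<rho> w x - w x)) \<le> (\<integral>\<^sup>+t. norm ((w t - w x) * \<rho> (x - t)) \<partial>lborel)"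
      unfolding eq by (rule integral_norm_bound_ennreal)
    also have "\<dots> = (\<integral>\<^sup>+t. ennreal (\<rho> (x - t) * \<bar>w t - w x\<bar>) \<partial>lborel)"
      using r0 by (simp add: abs_mult mult.commute)
    also have "\<dots> = (\<integral>\<^sup>+z. ennreal (\<rho> (x - (x - z)) * \<bar>w (x - z) - w x\<bar>) \<partial>lborel)"
      by (rule lborel_nn_integral_reflection[symmetric]) measurable
    finally show ?thesis by simp
  qed
  have "(\<integral>\<^sup>+x. ennreal \<bar>mollify \<rho> w x - w x\<bar> \<partial>lborel) \<le> (\<integral>\<^sup>+x. \<integral>\<^sup>+z. ennreal (\<rho> z * \<bar>w (- z + x) - w x\<bar>) \<partial>lborel \<partial>lborel)"
    by (intro nn_integral_mono pt)
  also have "\<dots> = (\<integral>\<^sup>+z. \<integral>\<^sup>+x. ennreal (\<rho> z * \<bar>w (- z + x) - w x\<bar>) \<partial>lborel \<partial>lborel)"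
    by (rule lborel_pair.Fubini'[symmetric]) measurable
  also have "\<dots> \<le> (\<integral>\<^sup>+z. ennreal (\<rho> z) * ennreal (\<delta> * V) \<partial>lborel)"
  proof (rule nn_integral_mono)
    fix z
    show "(\<integral>\<^sup>+x. ennreal (\<rho> z * \<bar>w (- z + x) - w x\<bar>) \<partial>lborel) \<le> ennreal (\<rho> z) * ennreal (\<delta> * V)"
    proof (cases "\<rho> z = 0")
      case False
      have "(\<integral>\<^sup>+x. ennreal (\<rho> z * \<bar>w (- z + x) - w x\<bar>) \<partial>lborel) = ennreal (\<rho> z) * (\<integral>\<^sup>+x. ennreal \<bar>w (- z + x) - w x\<bar> \<partial>lborel)"
        using r0 by (simp add: ennreal_mult nn_integral_cmult)
      also have "\<dots> \<le> ennreal (\<rho> z) * ennreal (norm (- z) * V)"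
        by (intro mult_left_mono nn_integral_translation_le_TV[OF w V]) simp
      also have "\<dots> \<le> ennreal (\<rho> z) * ennreal (\<delta> * V)"
        using mollifierD(6)[OF \<rho> False] V(2) by (intro mult_left_mono ennreal_leI mult_right_mono) auto
      finally show ?thesis .
    qed simp
  qed
  also have "\<dots> = (\<integral>\<^sup>+z. ennreal (\<rho> z) \<partial>lborel) * ennreal (\<delta> * V)"
    by (rule nn_integral_multc) measurable
  also have "(\<integral>\<^sup>+z. ennreal (\<rho> z) \<partial>lborel) = 1"
    using nn_integral_eq_integral[OF mollifierD(5)[OF \<rho>]] r0 mollifierD(3)[OF \<rho>] by simp
  finally show ?thesis by simp
qed

text \<open>Mollification is moved to the test field: \<psi> is the convolution of \<phi> with the
  reflected mollifier. Averaging keeps its norm at most 1, and its support grows by at most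
  \<delta>, which \<open>sub\<close> keeps inside \<open>U'\<close>.\<close>

lemma TV_mollify_le:
  fixes w :: "real^'n \<Rightarrow> real"
  assumes w: "integrable lborel w" and \<rho>: "mollifier \<delta> \<rho>" and U: "open U" and U': "open U'"
    and sub: "\<And>x. x \<in> U \<Longrightarrow> cball x \<delta> \<subseteq> U'"
  shows "TV U (mollify \<rho> w) \<le> TV U' w"
proof (rule TV_least)
  fix \<phi> :: "real^'n \<Rightarrow> real^'n" assume \<phi>: "\<phi> \<in> C1c U" and 1: "\<And>x. norm (\<phi> x) \<le> 1"
  have C: "C1_fun \<phi>" using \<phi> by (rule C1cD)
  note r0 = mollifierD(2)[OF \<rho>]
  note [measurable] = mollifierD(4)[OF \<rho>] borel_measurable_continuous_onI[OF continuous_on_divergence[OF C]]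
    borel_measurable_continuous_onI[OF C1_fun_continuous[OF C]]
    borel_measurable_continuous_onI[OF C1_fun_continuous[OF C1_fun_mollify[OF w \<rho>]]]
  have wm [measurable]: "w \<in> borel_measurable borel" using w by auto
  have a: "integrable lborel (\<lambda>z. \<rho> (- z))" "(\<integral>z. \<rho> (- z) \<partial>lborel) = 1"
    using mollifier_reflection[OF \<rho>, of 0] by auto
  have T: "(\<lambda>z::real^'n. z) \<in> borel_measurable lborel" by simp
  note conv = C1_fun_convolution[OF a(1) T \<phi>] frechet_derivative_convolution[OF a(1) T \<phi>]
    integrable_convolution[OF a(1) T \<phi>] integrable_convolution_derivative[OF a(1) T \<phi>]
  define \<psi> where "\<psi> t = (\<integral>z. \<rho> (- z) *\<^sub>R \<phi> (t - z) \<partial>lborel)" for t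
  have \<psi>C: "C1_fun \<psi>" using conv(1) unfolding \<psi>_def[abs_def] .
  obtain K where K: "compact K" "K \<subseteq> U" "\<And>x. x \<notin> K \<Longrightarrow> \<phi> x = 0" "\<And>x v. x \<notin> K \<Longrightarrow> frechet_derivative \<phi> (at x) v = 0"
    using C1cE[OF \<phi>] by metis
  let ?L = "{x + y |x y. x \<in> K \<and> y \<in> cball 0 \<delta>}"
  have \<psi>: "\<psi> \<in> C1c U'"
  proof (rule C1cI[OF \<psi>C])
    show "compact ?L" by (intro compact_sums K compact_cball)
    show "?L \<subseteq> U'"
    proof
      fix t assume "t \<in> ?L"
      then obtain x y where "t = x + y" "x \<in> K" "norm y \<le> \<delta>" by auto
      then have "t \<in> cball x \<delta>" by (simp add: dist_norm)
      then show "t \<in> U'" using subsetD[OF sub, of x t] subsetD[OF K(2) \<open>x \<in> K\<close>] by simp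
    qed
    fix t assume t: "t \<notin> ?L"
    have "\<rho> (- z) *\<^sub>R \<phi> (t - z) = 0" for z
    proof (rule ccontr)
      assume "\<rho> (- z) *\<^sub>R \<phi> (t - z) \<noteq> 0"
      then have "\<rho> (- z) \<noteq> 0" "\<phi> (t - z) \<noteq> 0" by auto
      then have "norm z < \<delta>" "t - z \<in> K" using mollifierD(6)[OF \<rho>, of "- z"] K(3) by auto
      then have "(t - z) + z \<in> ?L" by (intro CollectI exI conjI) (auto simp: dist_norm)
      then show False using t by simp
    qed
    then show "\<psi> t = 0" unfolding \<psi>_def by (simp only: Bochner_Integration.integral_zero)
  qed
  have \<psi>1: "norm (\<psi> t) \<le> 1" for t
  proof -
    have "norm (\<psi> t) \<le> (\<integral>z. norm (\<rho> (- z) *\<^sub>R \<phi> (t - z)) \<partial>lborel)" unfolding \<psi>_def by (rule integral_norm_bound)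
    also have "\<dots> \<le> (\<integral>z. \<rho> (- z) \<partial>lborel)"
    proof (rule integral_mono[OF integrable_norm[OF conv(3)[of t]] a(1)])
      show "norm (\<rho> (- z) *\<^sub>R \<phi> (t - z)) \<le> \<rho> (- z)" for z
        using mult_left_mono[OF 1[of "t - z"] r0[of "- z"]] r0[of "- z"] by simp
    qed
    finally show ?thesis using a(2) by simp
  qed
  have div: "divergence \<psi> t = (\<integral>x. \<rho> (x - t) * divergence \<phi> x \<partial>lborel)" for t
  proof -
    have "divergence \<psi> t = (\<Sum>i\<in>UNIV. (\<integral>z. \<rho> (- z) *\<^sub>R frechet_derivative \<phi> (at (t - z)) (axis i 1) \<partial>lborel) $ i)"
      using conv(2)[of t] unfolding divergence_def \<psi>_def[abs_def] by simp
    also have "\<dots> = (\<Sum>i\<in>UNIV. (\<integral>z. (\<rho> (- z) *\<^sub>R frechet_derivative \<phi> (at (t - z)) (axis i 1)) $ i \<partial>lborel))"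
      by (intro sum.cong refl integral_bounded_linear[OF bounded_linear_vec_nth, symmetric] conv(4))
    also have "\<dots> = (\<integral>z. (\<Sum>i\<in>UNIV. (\<rho> (- z) *\<^sub>R frechet_derivative \<phi> (at (t - z)) (axis i 1)) $ i) \<partial>lborel)"
      by (intro Bochner_Integration.integral_sum[symmetric] integrable_bounded_linear[OF bounded_linear_vec_nth] conv(4))
    also have "\<dots> = (\<integral>z. \<rho> ((t - z) - t) * divergence \<phi> (t - z) \<partial>lborel)"
      by (simp add: divergence_def sum_distrib_left)
    also have "\<dots> = (\<integral>x. \<rho> (x - t) * divergence \<phi> x \<partial>lborel)"
      by (rule lborel_integral_reflection) measurable
    finally show ?thesis .
  qed
  have div0: "divergence \<phi> x = 0" if "x \<notin> K" for x
    using K(4)[OF that] by (simp add: divergence_def)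
  let ?f = "\<lambda>x t. w t * \<rho> (x - t) * divergence \<phi> x"
  \<comment> \<open>Integrated in \<open>t\<close> first, the absolute value gives the mollification
    of \<open>\<bar>w t\<bar>\<close> times \<open>\<bar>divergence \<phi> x\<bar>\<close>, a
    continuous function of compact support; this justifies Fubini.\<close>
  have fi: "integrable (lborel \<Otimes>\<^sub>M lborel) (case_prod ?f)"
  proof (rule lborel_pair.Fubini_integrable)
    show "case_prod ?f \<in> borel_measurable (lborel \<Otimes>\<^sub>M lborel)" by measurable
    have wa: "integrable lborel (\<lambda>t. \<bar>w t\<bar>)" using w by (rule integrable_abs)
    have "(\<integral>t. norm (case (x, t) of (x, t) \<Rightarrow> ?f x t) \<partial>lborel) = mollify \<rho> (\<lambda>t. \<bar>w t\<bar>) x * \<bar>divergence \<phi> x\<bar>" for x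
      using r0 by (simp add: mollify_def abs_mult)
    moreover have "integrable lborel (\<lambda>x. mollify \<rho> (\<lambda>t. \<bar>w t\<bar>) x * \<bar>divergence \<phi> x\<bar>)"
      by (rule integrable_continuous_compact_support[OF continuous_on_mult[OF C1_fun_continuous[OF C1_fun_mollify[OF wa \<rho>]]
            continuous_on_rabs[OF continuous_on_divergence[OF C]]] K(1)]) (simp add: div0)
    ultimately show "integrable lborel (\<lambda>x. \<integral>t. norm (case (x, t) of (x, t) \<Rightarrow> ?f x t) \<partial>lborel)"
      by (simp only:)
    show "AE x in lborel. integrable lborel (\<lambda>t. case (x, t) of (x, t) \<Rightarrow> ?f x t)"
      using integrable_mollify[OF w \<rho>] by (intro always_eventually allI) simp
  qed
  have "(\<integral>x. mollify \<rho> w x * divergence \<phi> x \<partial>lebesgue_on U) = (\<integral>x. mollify \<rho> w x * divergence \<phi> x \<partial>lborel)"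
    by (rule integral_divergence_lborel[OF U _ \<phi>]) measurable
  also have "\<dots> = (\<integral>x. \<integral>t. ?f x t \<partial>lborel \<partial>lborel)"
    by (simp add: mollify_def)
  also have "\<dots> = (\<integral>t. \<integral>x. ?f x t \<partial>lborel \<partial>lborel)"
    by (rule lborel_pair.Fubini_integral[OF fi, symmetric])
  also have "\<dots> = (\<integral>t. w t * divergence \<psi> t \<partial>lborel)"
    by (simp add: div mult.assoc)
  also have "\<dots> = (\<integral>t. w t * divergence \<psi> t \<partial>lebesgue_on U')"
    by (rule integral_divergence_lborel[OF U' wm \<psi>, symmetric])
  finally show "ennreal (\<integral>x. mollify \<rho> w x * divergence \<phi> x \<partial>lebesgue_on U) \<le> TV U' w"
    using TV_upper[OF \<psi> \<psi>1, of w] by simp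
qed

lemma nn_integral_lebesgue_on_le_lborel:
  fixes g :: "'a::euclidean_space \<Rightarrow> ennreal"
  assumes "U \<in> sets lebesgue" "g \<in> borel_measurable borel"
  shows "(\<integral>\<^sup>+x. g x \<partial>lebesgue_on U) \<le> (\<integral>\<^sup>+x. g x \<partial>lborel)"
proof -
  have "(\<integral>\<^sup>+x. g x \<partial>lebesgue_on U) = (\<integral>\<^sup>+x. g x * indicator U x \<partial>lebesgue)"
    using assms(1) by (subst nn_integral_restrict_space) auto
  also have "\<dots> \<le> (\<integral>\<^sup>+x. g x \<partial>lebesgue)"
    by (rule nn_integral_mono) (auto simp: indicator_def)
  finally show ?thesis using assms(2) by (simp add: nn_integral_completion)
qed

lemma square_sum_le: "(a + b)\<^sup>2 \<le> 2 * a\<^sup>2 + 2 * b\<^sup>2" for a b :: real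
  using zero_le_power2[of "a - b"] by (simp add: power2_sum power2_diff)

text \<open>A C1 substitute for truncation: the slope lies in (0, 1], which gives the contraction,
  and the values lie in an interval of length pi M.\<close>

lemma scaled_arctan:
  assumes "M > 0"
  shows "((\<lambda>t. M * arctan (t / M)) has_real_derivative 1 / (1 + (t / M)\<^sup>2)) (at t)"
    and "\<bar>M * arctan (s / M) - M * arctan (t / M)\<bar> \<le> \<bar>s - t\<bar>"
    and "\<bar>M * arctan (s / M) - M * arctan (t / M)\<bar> \<le> pi * M"
proof -
  show D: "((\<lambda>t. M * arctan (t / M)) has_real_derivative 1 / (1 + (t / M)\<^sup>2)) (at t)" for t
  proof -
    have "((\<lambda>t. M * arctan (t / M)) has_real_derivative M * (inverse (1 + (t / M)\<^sup>2) * (1 / M))) (at t)"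
      by (intro DERIV_cmult DERIV_chain2[OF DERIV_arctan] DERIV_cdivide DERIV_ident)
    moreover have "M * (inverse (1 + (t / M)\<^sup>2) * (1 / M)) = 1 / (1 + (t / M)\<^sup>2)"
      using assms by (simp add: divide_inverse)
    ultimately show ?thesis by (simp only:)
  qed
  have "norm (M * arctan (s / M) - M * arctan (t / M)) \<le> 1 * norm (s - t)"
  proof (rule field_differentiable_bound[OF convex_UNIV, where f'="\<lambda>t. 1 / (1 + (t / M)\<^sup>2)"])
    show "norm (1 / (1 + (z / M)\<^sup>2)) \<le> 1" for z
      by (simp add: divide_le_eq_1_pos add_pos_nonneg)
  qed (use D in auto)
  then show "\<bar>M * arctan (s / M) - M * arctan (t / M)\<bar> \<le> \<bar>s - t\<bar>" by simp
  have "\<bar>arctan (s / M) - arctan (t / M)\<bar> \<le> pi"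
    using arctan_bounded[of "s / M"] arctan_bounded[of "t / M"] by (auto simp: abs_if)
  then have "M * \<bar>arctan (s / M) - arctan (t / M)\<bar> \<le> M * pi" using assms by (intro mult_left_mono) auto
  moreover have "\<bar>M * arctan (s / M) - M * arctan (t / M)\<bar> = M * \<bar>arctan (s / M) - arctan (t / M)\<bar>"
    using assms by (simp add: right_diff_distrib[symmetric] abs_mult)
  ultimately show "\<bar>M * arctan (s / M) - M * arctan (t / M)\<bar> \<le> pi * M" by (simp add: mult.commute)
qed

text \<open>The mollification \<open>W\<close> only converges in \<open>L\<^sup>1\<close>; composing it with the bounded contraction
  \<open>M arctan (t / M)\<close> upgrades this to \<open>L\<^sup>2\<close> without increasing the gradient.\<close>

lemma C1_approximation_L2_TV:
  fixes w :: "real^'n \<Rightarrow> real"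
  assumes U: "open U" "bounded U" and w: "integrable lborel w" and V: "TV UNIV w < \<infinity>"
    and w2: "(\<integral>\<^sup>+x. ennreal ((w x)\<^sup>2) \<partial>lebesgue_on U) < \<infinity>"
    and bd: "\<And>\<eta>. \<eta> > 0 \<Longrightarrow> \<exists>A. open A \<and> frontier U \<subseteq> A \<and> TV A w \<le> ennreal \<eta>"
    and \<eta>: "\<eta> > 0"
  obtains f where "C1_fun f" "(\<integral>\<^sup>+x. ennreal ((f x - w x)\<^sup>2) \<partial>lebesgue_on U) \<le> ennreal \<eta>"
    "(\<integral>\<^sup>+x. ennreal (norm (grad f x)) \<partial>lebesgue_on U) \<le> TV U w + ennreal \<eta>"
proof -
  have wm [measurable]: "w \<in> borel_measurable borel" using w by auto
  have Um: "U \<in> sets lebesgue" using U(1) by simp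
  obtain W where W: "TV UNIV w \<le> ennreal W" "W \<ge> 0"
    using V by (cases "TV UNIV w") auto
  have wmU: "w \<in> borel_measurable (lebesgue_on U)"
    by (intro measurable_restrict_space1 measurable_completion) simp
  \<comment> \<open>Truncation by itself converges in L2: the contraction property at 0 bounds the
    error by 2 |w|, whence the factor 4 in the majorant.\<close>
  have "(\<lambda>n. \<integral>\<^sup>+x. ennreal ((real (Suc n) * arctan (w x / real (Suc n)) - w x)\<^sup>2) \<partial>lebesgue_on U) \<longlonglongrightarrow> (\<integral>\<^sup>+x. 0 \<partial>lebesgue_on U)"
  proof (rule nn_integral_dominated_convergence)
    show "(\<integral>\<^sup>+x. 4 * ennreal ((w x)\<^sup>2) \<partial>lebesgue_on U) < \<infinity>"
      using w2 wmU by (subst nn_integral_cmult) (auto simp: ennreal_mult_less_top)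
    show "AE x in lebesgue_on U. (\<lambda>n. ennreal ((real (Suc n) * arctan (w x / real (Suc n)) - w x)\<^sup>2)) \<longlonglongrightarrow> 0"
    proof (intro always_eventually allI)
      fix x
      have "(arctan has_derivative (\<lambda>h. h)) (at 0)"
      proof -
        have "(*) (1::real) = (\<lambda>h. h)" by (rule ext) simp
        then show ?thesis using DERIV_arctan[of 0] by (simp add: has_field_derivative_def)
      qed
      from directional_derivative_sequence[OF this, of "w x"]
      have "(\<lambda>n. real (Suc n) * arctan (w x / real (Suc n))) \<longlonglongrightarrow> w x"
        by (simp add: divide_inverse mult.commute)
      then have "(\<lambda>n. (real (Suc n) * arctan (w x / real (Suc n)) - w x)\<^sup>2) \<longlonglongrightarrow> (w x - w x)\<^sup>2"
        by (intro tendsto_intros)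
      then show "(\<lambda>n. ennreal ((real (Suc n) * arctan (w x / real (Suc n)) - w x)\<^sup>2)) \<longlonglongrightarrow> 0"
        using tendsto_ennrealI by fastforce
    qed
    show "AE x in lebesgue_on U. ennreal ((real (Suc n) * arctan (w x / real (Suc n)) - w x)\<^sup>2) \<le> 4 * ennreal ((w x)\<^sup>2)" for n
    proof (intro always_eventually allI)
      fix x
      have "\<bar>real (Suc n) * arctan (w x / real (Suc n)) - w x\<bar> \<le> 2 * \<bar>w x\<bar>"
        using scaled_arctan(2)[of "real (Suc n)" "w x" 0] by auto
      then have "(real (Suc n) * arctan (w x / real (Suc n)) - w x)\<^sup>2 \<le> (2 * \<bar>w x\<bar>)\<^sup>2"
        by (rule abs_le_square_iff[THEN iffD1, OF order_trans]) auto
      then have "ennreal ((real (Suc n) * arctan (w x / real (Suc n)) - w x)\<^sup>2) \<le> ennreal (4 * (w x)\<^sup>2)"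
        by (intro ennreal_leI) (simp add: power2_eq_square)
      then show "ennreal ((real (Suc n) * arctan (w x / real (Suc n)) - w x)\<^sup>2) \<le> 4 * ennreal ((w x)\<^sup>2)"
        by (simp add: ennreal_mult)
    qed
  qed (use wmU in measurable)
  then have "(\<lambda>n. \<integral>\<^sup>+x. ennreal ((real (Suc n) * arctan (w x / real (Suc n)) - w x)\<^sup>2) \<partial>lebesgue_on U) \<longlonglongrightarrow> 0" by simp
  then have "eventually (\<lambda>n. (\<integral>\<^sup>+x. ennreal ((real (Suc n) * arctan (w x / real (Suc n)) - w x)\<^sup>2) \<partial>lebesgue_on U) < ennreal (\<eta> / 4)) sequentially"
    using \<eta> by (intro order_tendstoD(2)) auto
  then obtain n where n: "(\<integral>\<^sup>+x. ennreal ((real (Suc n) * arctan (w x / real (Suc n)) - w x)\<^sup>2) \<partial>lebesgue_on U) < ennreal (\<eta> / 4)"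
    by (auto simp: eventually_sequentially)
  define M where "M = real (Suc n)"
  have M: "M > 0" unfolding M_def by simp
  define trunc where "trunc t = M * arctan (t / M)" for t
  have chi: "(trunc has_real_derivative 1 / (1 + (t / M)\<^sup>2)) (at t)" "\<bar>trunc s - trunc t\<bar> \<le> \<bar>s - t\<bar>" "\<bar>trunc s - trunc t\<bar> \<le> pi * M" for s t
    using scaled_arctan[OF M] unfolding trunc_def[abs_def] by auto
  obtain A where A: "open A" "frontier U \<subseteq> A" "TV A w \<le> ennreal \<eta>" using bd[OF \<eta>] by blast
  have "closure U \<subseteq> U \<union> A" using A(2) U(1) by (auto simp: frontier_def interior_open)
  moreover have "compact (closure U)" using U(2) by simp
  ultimately obtain d where d: "d > 0" "(\<Union>x\<in>closure U. cball x d) \<subseteq> U \<union> A"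
    using compact_subset_open_imp_cball_epsilon_subset[of "closure U" "U \<union> A"] A(1) U(1) by blast
  \<comment> \<open>\<open>d\<close> keeps the \<delta>-neighbourhood of \<open>U\<close> inside
    \<open>U \<union> A\<close>; the second bound makes the mollification error 2 pi M \<delta> W at
    most \<eta> / 2, and W + 1 allows for W = 0.\<close>
  define \<delta> where "\<delta> = min d (\<eta> / (4 * pi * M * (W + 1)))"
  have \<delta>: "\<delta> > 0" unfolding \<delta>_def using d(1) \<eta> M W(2) by auto
  obtain \<rho> :: "real^'n \<Rightarrow> real" where \<rho>: "mollifier \<delta> \<rho>" using mollifier_exists[OF \<delta>] by metis
  let ?W = "mollify \<rho> w"
  have WC: "C1_fun ?W" by (rule C1_fun_mollify[OF w \<rho>])
  note [measurable] = borel_measurable_continuous_onI[OF C1_fun_continuous[OF WC]]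
  let ?f = "\<lambda>x. trunc (?W x)"
  have cc: "continuous_on UNIV (\<lambda>t. 1 / (1 + (t / M)\<^sup>2))"
    using M by (intro continuous_intros) (auto simp: add_nonneg_eq_0_iff)
  have fC: "C1_fun ?f" by (rule C1_fun_compose_real[OF chi(1) cc WC])
  have chim [measurable]: "trunc \<in> borel_measurable borel"
    unfolding trunc_def[abs_def] by (intro borel_measurable_continuous_onI continuous_intros) (use M in auto)
  have gr: "norm (grad ?f x) \<le> norm (grad ?W x)" for x
  proof -
    let ?c = "1 / (1 + (?W x / M)\<^sup>2)"
    have "(?f has_derivative (\<lambda>v. ?c * frechet_derivative ?W (at x) v)) (at x)"
      using has_derivative_compose[OF C1_fun_has_derivative[OF WC] has_field_derivative_imp_has_derivative[OF chi(1)]] .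
    then have "grad ?f x = ?c *\<^sub>R grad ?W x"
      by (simp add: grad_def frechet_derivative_eqI vec_eq_iff)
    moreover have "0 \<le> ?c" "?c \<le> 1" by (auto simp: divide_le_eq_1_pos add_pos_nonneg)
    ultimately show ?thesis using mult_right_mono[of ?c 1 "norm (grad ?W x)"] by simp
  qed
  have sub: "cball x \<delta> \<subseteq> U \<union> A" if "x \<in> U" for x
  proof -
    have "x \<in> closure U" using that closure_subset[of U] by (rule subsetD[rotated])
    then have "cball x d \<subseteq> U \<union> A" using d(2) by auto
    moreover have "cball x \<delta> \<subseteq> cball x d" unfolding \<delta>_def by (rule subset_cball) simp
    ultimately show ?thesis by (rule order_trans[rotated])
  qed
  have "(\<integral>\<^sup>+x. ennreal (norm (grad ?f x)) \<partial>lebesgue_on U) \<le> (\<integral>\<^sup>+x. ennreal (norm (grad ?W x)) \<partial>lebesgue_on U)"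
    by (intro nn_integral_mono ennreal_leI gr)
  also have "\<dots> \<le> TV U ?W" by (rule nn_integral_norm_grad_le_TV[OF U WC])
  \<comment> \<open>On \<open>U\<close> the mollification sees \<open>w\<close> only on
    \<open>U \<union> A\<close>, and the boundary layer \<open>A\<close> carries variation at most
    \<eta>.\<close>
  also have "\<dots> \<le> TV (U \<union> A) w" by (rule TV_mollify_le[OF w \<rho> U(1) _ sub]) (use U(1) A(1) in auto)
  also have "\<dots> \<le> TV U w + TV A w" by (rule TV_Un_le[OF U(1) A(1) w])
  also have "\<dots> \<le> TV U w + ennreal \<eta>" by (intro add_left_mono A(3))
  finally have F1: "(\<integral>\<^sup>+x. ennreal (norm (grad ?f x)) \<partial>lebesgue_on U) \<le> TV U w + ennreal \<eta>" .
  have "(\<integral>\<^sup>+x. ennreal \<bar>?W x - w x\<bar> \<partial>lebesgue_on U) \<le> (\<integral>\<^sup>+x. ennreal \<bar>?W x - w x\<bar> \<partial>lborel)"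
    by (rule nn_integral_lebesgue_on_le_lborel[OF Um]) measurable
  also have "\<dots> \<le> ennreal (\<delta> * W)" by (rule nn_integral_mollify_diff[OF w W \<rho>])
  finally have L1: "(\<integral>\<^sup>+x. ennreal \<bar>?W x - w x\<bar> \<partial>lebesgue_on U) \<le> ennreal (\<delta> * W)" .
  \<comment> \<open>One factor of the square \<open>?a\<^sup>2\<close> is estimated by the
    oscillation pi M, the other by the contraction property; this is how closeness in L1 yields
    closeness in L2.\<close>
  have pt: "(?f x - w x)\<^sup>2 \<le> (2 * pi * M) * \<bar>?W x - w x\<bar> + 2 * (trunc (w x) - w x)\<^sup>2" for x
  proof -
    let ?a = "?f x - trunc (w x)" and ?b = "trunc (w x) - w x"
    have "(?f x - w x)\<^sup>2 = (?a + ?b)\<^sup>2" by simp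
    also have "\<dots> \<le> 2 * ?a\<^sup>2 + 2 * ?b\<^sup>2"
      by (rule square_sum_le)
    also have "?a\<^sup>2 \<le> (pi * M) * \<bar>?W x - w x\<bar>"
    proof -
      have "?a\<^sup>2 = \<bar>?a\<bar> * \<bar>?a\<bar>" by (simp add: power2_eq_square)
      also have "\<dots> \<le> (pi * M) * \<bar>?W x - w x\<bar>" using chi(2,3) M by (intro mult_mono) auto
      finally show ?thesis .
    qed
    finally show ?thesis by simp
  qed
  have "(\<integral>\<^sup>+x. ennreal ((?f x - w x)\<^sup>2) \<partial>lebesgue_on U) \<le> (\<integral>\<^sup>+x. ennreal (2 * pi * M) * ennreal \<bar>?W x - w x\<bar> + 2 * ennreal ((trunc (w x) - w x)\<^sup>2) \<partial>lebesgue_on U)"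
  proof (rule nn_integral_mono)
    fix x
    have "ennreal ((?f x - w x)\<^sup>2) \<le> ennreal ((2 * pi * M) * \<bar>?W x - w x\<bar> + 2 * (trunc (w x) - w x)\<^sup>2)"
      by (rule ennreal_leI[OF pt])
    also have "\<dots> = ennreal (2 * pi * M) * ennreal \<bar>?W x - w x\<bar> + 2 * ennreal ((trunc (w x) - w x)\<^sup>2)"
      using M by (simp add: ennreal_plus ennreal_mult)
    finally show "ennreal ((?f x - w x)\<^sup>2) \<le> ennreal (2 * pi * M) * ennreal \<bar>?W x - w x\<bar> + 2 * ennreal ((trunc (w x) - w x)\<^sup>2)" .
  qed
  also have "\<dots> = ennreal (2 * pi * M) * (\<integral>\<^sup>+x. ennreal \<bar>?W x - w x\<bar> \<partial>lebesgue_on U) + 2 * (\<integral>\<^sup>+x. ennreal ((trunc (w x) - w x)\<^sup>2) \<partial>lebesgue_on U)"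
  proof -
    have m: "(\<lambda>x. ennreal \<bar>?W x - w x\<bar>) \<in> borel_measurable (lebesgue_on U)" "(\<lambda>x. ennreal ((trunc (w x) - w x)\<^sup>2)) \<in> borel_measurable (lebesgue_on U)"
      by (intro measurable_restrict_space1 measurable_completion; measurable)+
    then show ?thesis by (subst nn_integral_add) (auto simp: nn_integral_cmult)
  qed
  also have "\<dots> \<le> ennreal (2 * pi * M) * ennreal (\<delta> * W) + 2 * ennreal (\<eta> / 4)"
    using n L1 unfolding trunc_def M_def by (intro add_mono mult_left_mono) auto
  also have "\<dots> = ennreal (2 * pi * M * (\<delta> * W) + \<eta> / 2)"
    using M \<delta> W(2) \<eta> by (subst ennreal_plus) (auto simp: ennreal_mult[symmetric] ennreal_numeral[symmetric] simp del: ennreal_numeral)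
  also have "\<dots> \<le> ennreal \<eta>"
  proof (rule ennreal_leI)
    have "\<delta> * (4 * pi * M * (W + 1)) \<le> \<eta>"
    proof -
      have "\<delta> \<le> \<eta> / (4 * pi * M * (W + 1))" unfolding \<delta>_def by simp
      moreover have "4 * pi * M * (W + 1) > 0" using M W(2) by simp
      ultimately show ?thesis by (simp add: pos_le_divide_eq)
    qed
    moreover have "\<delta> * (4 * pi * M * W) \<le> \<delta> * (4 * pi * M * (W + 1))"
      using \<delta> M W(2) by (intro mult_left_mono) auto
    ultimately show "2 * pi * M * (\<delta> * W) + \<eta> / 2 \<le> \<eta>" by (simp add: algebra_simps)
  qed
  finally have F2: "(\<integral>\<^sup>+x. ennreal ((?f x - w x)\<^sup>2) \<partial>lebesgue_on U) \<le> ennreal \<eta>" .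
  show ?thesis by (rule that[OF fC F2 F1])
qed

section \<open>The space \<open>L\<^sup>2\<close>\<close>

text \<open>Estimates are made with the square, to stay clear of the root and of the infinite case
  in \<open>Lp_norm\<close>; \<open>Lp_norm_2_power2\<close> and \<open>Lp_norm_2_less_iff\<close>
  translate back.\<close>

definition sq_integral :: "'a measure \<Rightarrow> ('a \<Rightarrow> 'b::real_normed_vector) \<Rightarrow> ennreal" where
  "sq_integral M u = (\<integral>\<^sup>+x. ennreal ((norm (u x))\<^sup>2) \<partial>M)"

lemma Lp_norm_2:
  "Lp_norm 2 M u = (if sq_integral M u = \<infinity> then \<infinity> else ennreal (sqrt (enn2real (sq_integral M u))))"
proof -
  have "norm (u x) powr enn2real 2 = (norm (u x))\<^sup>2" for x
    by (simp add: powr_numeral)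
  then show ?thesis
    by (simp add: Lp_norm_def sq_integral_def Let_def powr_half_sqrt)
qed

lemma Lp_norm_2_power2: "(Lp_norm 2 M u)\<^sup>2 = sq_integral M u"
proof (cases "sq_integral M u")
  case (real r)
  then show ?thesis by (simp add: Lp_norm_2 ennreal_power)
next
  case top
  then show ?thesis by (simp add: Lp_norm_2 power2_eq_square ennreal_top_mult)
qed

lemma ennreal_power2_le_iff: "x\<^sup>2 \<le> y\<^sup>2 \<longleftrightarrow> x \<le> y" for x y :: ennreal
proof
  show "x \<le> y \<Longrightarrow> x\<^sup>2 \<le> y\<^sup>2" by (simp add: power_mono)
  assume *: "x\<^sup>2 \<le> y\<^sup>2"
  show "x \<le> y"
  proof (cases x; cases y)
    fix a b assume "x = ennreal a" "0 \<le> a" "y = ennreal b" "0 \<le> b"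
    then show ?thesis using * by (simp add: ennreal_power abs_le_square_iff[symmetric])
  next
    fix b assume "x = top" "y = ennreal b" "0 \<le> b"
    then show ?thesis using * by (simp add: ennreal_power ennreal_top_mult power2_eq_square top_unique ennreal_mult[symmetric])
  qed auto
qed

lemma ennreal_power2_less_iff: "x\<^sup>2 < y\<^sup>2 \<longleftrightarrow> x < y" for x y :: ennreal
  using ennreal_power2_le_iff[of y x] by (simp add: not_le[symmetric])

lemma Lp_norm_2_less_iff:
  assumes "r \<ge> 0"
  shows "Lp_norm 2 M u < ennreal r \<longleftrightarrow> sq_integral M u < ennreal (r\<^sup>2)"
  using ennreal_power2_less_iff[of "Lp_norm 2 M u" "ennreal r"] assms
  by (simp add: Lp_norm_2_power2 ennreal_power)

lemma Lp_2_iff: "u \<in> Lp 2 M \<longleftrightarrow> u \<in> borel_measurable M \<and> sq_integral M u < \<infinity>"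
  by (auto simp: Lp_def Lp_norm_2 top.not_eq_extremum)

text \<open>The square is expanded and the mixed term estimated by Cauchy-Schwarz. Only
  measurability is assumed, so infinite norms are covered.\<close>

lemma Lp_norm_2_triangle:
  fixes u v :: "'a \<Rightarrow> real"
  assumes u [measurable]: "u \<in> borel_measurable M" and v [measurable]: "v \<in> borel_measurable M"
  shows "Lp_norm 2 M (\<lambda>x. u x + v x) \<le> Lp_norm 2 M u + Lp_norm 2 M v"
proof -
  let ?a = "Lp_norm 2 M u" and ?b = "Lp_norm 2 M v"
  let ?P = "\<integral>\<^sup>+x. ennreal \<bar>u x\<bar> * ennreal \<bar>v x\<bar> \<partial>M"
  have "?P\<^sup>2 \<le> (\<integral>\<^sup>+x. (ennreal \<bar>u x\<bar>)\<^sup>2 \<partial>M) * (\<integral>\<^sup>+x. (ennreal \<bar>v x\<bar>)\<^sup>2 \<partial>M)"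
    by (rule Cauchy_Schwarz_nn_integral) measurable
  also have "\<dots> = ?a\<^sup>2 * ?b\<^sup>2"
    by (simp add: Lp_norm_2_power2 sq_integral_def ennreal_power)
  finally have "?P\<^sup>2 \<le> (?a * ?b)\<^sup>2" by (simp add: power_mult_distrib)
  then have P: "?P \<le> ?a * ?b" by (simp only: ennreal_power2_le_iff)
  have "sq_integral M (\<lambda>x. u x + v x) \<le> (\<integral>\<^sup>+x. ennreal (\<bar>u x\<bar>\<^sup>2) + 2 * (ennreal \<bar>u x\<bar> * ennreal \<bar>v x\<bar>) + ennreal (\<bar>v x\<bar>\<^sup>2) \<partial>M)"
    unfolding sq_integral_def
  proof (rule nn_integral_mono)
    fix x
    have "(norm (u x + v x))\<^sup>2 \<le> (\<bar>u x\<bar> + \<bar>v x\<bar>)\<^sup>2" by (intro power_mono) (auto simp: abs_triangle_ineq)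
    also have "\<dots> = \<bar>u x\<bar>\<^sup>2 + 2 * (\<bar>u x\<bar> * \<bar>v x\<bar>) + \<bar>v x\<bar>\<^sup>2" by (simp add: power2_sum)
    finally have "ennreal ((norm (u x + v x))\<^sup>2) \<le> ennreal (\<bar>u x\<bar>\<^sup>2 + 2 * (\<bar>u x\<bar> * \<bar>v x\<bar>) + \<bar>v x\<bar>\<^sup>2)" by (rule ennreal_leI)
    also have "\<dots> = ennreal (\<bar>u x\<bar>\<^sup>2) + 2 * (ennreal \<bar>u x\<bar> * ennreal \<bar>v x\<bar>) + ennreal (\<bar>v x\<bar>\<^sup>2)"
      by (simp add: ennreal_plus ennreal_mult del: power2_abs)
    finally show "ennreal ((norm (u x + v x))\<^sup>2) \<le> ennreal (\<bar>u x\<bar>\<^sup>2) + 2 * (ennreal \<bar>u x\<bar> * ennreal \<bar>v x\<bar>) + ennreal (\<bar>v x\<bar>\<^sup>2)" .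
  qed
  also have "\<dots> = sq_integral M u + 2 * ?P + sq_integral M v"
    by (simp add: nn_integral_add nn_integral_cmult sq_integral_def)
  also have "\<dots> \<le> ?a\<^sup>2 + 2 * (?a * ?b) + ?b\<^sup>2"
    unfolding Lp_norm_2_power2 by (intro add_mono mult_left_mono P) auto
  also have "\<dots> = (?a + ?b)\<^sup>2" by (simp add: power2_eq_square distrib_left distrib_right ac_simps mult_2)
  finally have "(Lp_norm 2 M (\<lambda>x. u x + v x))\<^sup>2 \<le> (?a + ?b)\<^sup>2" by (simp add: Lp_norm_2_power2)
  then show ?thesis by (simp only: ennreal_power2_le_iff)
qed

lemma Lp_norm_2_minus_commute:
  fixes u v :: "'a \<Rightarrow> real"
  shows "Lp_norm 2 M (\<lambda>x. u x - v x) = Lp_norm 2 M (\<lambda>x. v x - u x)"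
  by (simp add: Lp_norm_2 sq_integral_def power2_commute)

lemma Lp_norm_2_triangle_diff:
  fixes u v w :: "'a \<Rightarrow> real"
  assumes "u \<in> borel_measurable M" "v \<in> borel_measurable M" "w \<in> borel_measurable M"
  shows "Lp_norm 2 M (\<lambda>x. u x - w x) \<le> Lp_norm 2 M (\<lambda>x. u x - v x) + Lp_norm 2 M (\<lambda>x. v x - w x)"
  using Lp_norm_2_triangle[of "\<lambda>x. u x - v x" M "\<lambda>x. v x - w x"] assms by simp

lemma Lp_2_diff:
  fixes u v :: "'a \<Rightarrow> real"
  assumes "u \<in> Lp 2 M" "v \<in> Lp 2 M"
  shows "(\<lambda>x. u x - v x) \<in> Lp 2 M"
proof -
  have m: "u \<in> borel_measurable M" "v \<in> borel_measurable M" using assms by (auto simp: Lp_def)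
  have "Lp_norm 2 M (\<lambda>x. u x + - v x) \<le> Lp_norm 2 M u + Lp_norm 2 M (\<lambda>x. - v x)"
    using m by (intro Lp_norm_2_triangle) auto
  also have "Lp_norm 2 M (\<lambda>x. - v x) = Lp_norm 2 M v" by (simp add: Lp_norm_2 sq_integral_def)
  finally have "Lp_norm 2 M (\<lambda>x. u x - v x) \<le> Lp_norm 2 M u + Lp_norm 2 M v" by simp
  also have "\<dots> < \<infinity>" using assms by (simp add: Lp_def)
  finally show ?thesis using m by (simp add: Lp_def)
qed

lemma openin_L2_ball:
  fixes \<Omega> :: "(real^'n) set"
  assumes "u \<in> L2 \<Omega>"
  shows "openin (L2_topology \<Omega>) {v\<in>L2 \<Omega>. Lp_norm 2 (lebesgue_on \<Omega>) (\<lambda>x. v x - u x) < ennreal r}"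
  unfolding openin_L2_topology
proof (intro conjI ballI)
  let ?N = "\<lambda>v u. Lp_norm 2 (lebesgue_on \<Omega>) (\<lambda>x. v x - u x)"
  fix v assume v: "v \<in> {v\<in>L2 \<Omega>. ?N v u < ennreal r}"
  then obtain a where a: "?N v u = ennreal a" "0 \<le> a" "a < r"
    by (cases "?N v u") (auto simp: ennreal_less_iff)
  show "\<exists>s>0. \<forall>w\<in>L2 \<Omega>. ?N w v < ennreal s \<longrightarrow> w \<in> {v\<in>L2 \<Omega>. ?N v u < ennreal r}"
  proof (intro exI[of _ "r - a"] conjI ballI impI)
    fix w assume w: "w \<in> L2 \<Omega>" "?N w v < ennreal (r - a)"
    have "?N w u \<le> ?N w v + ?N v u"
      using assms v w by (intro Lp_norm_2_triangle_diff) (auto simp: Lp_def)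
    also have "\<dots> < ennreal (r - a) + ennreal a"
      using w(2) a by (cases "?N w v") (auto simp: ennreal_less_iff ennreal_plus[symmetric] simp del: ennreal_plus)
    also have "\<dots> = ennreal r" using a by (simp add: ennreal_plus[symmetric] del: ennreal_plus)
    finally show "w \<in> {v\<in>L2 \<Omega>. ?N v u < ennreal r}" using w by simp
  qed (use a in simp)
qed auto

text \<open>Balls of the seminorm are open by the triangle inequality, and every open set contains a
  ball about each of its points, so convergence can be checked with the norm.\<close>

lemma limitin_L2_topology:
  fixes \<Omega> :: "(real^'n) set"
  assumes u: "u \<in> L2 \<Omega>"
  shows "limitin (L2_topology \<Omega>) v u F \<longleftrightarrow>
    (\<forall>r>0. eventually (\<lambda>e. v e \<in> L2 \<Omega> \<and> Lp_norm 2 (lebesgue_on \<Omega>) (\<lambda>x. v e x - u x) < ennreal r) F)"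
proof
  assume L: "limitin (L2_topology \<Omega>) v u F"
  show "\<forall>r>0. eventually (\<lambda>e. v e \<in> L2 \<Omega> \<and> Lp_norm 2 (lebesgue_on \<Omega>) (\<lambda>x. v e x - u x) < ennreal r) F"
  proof (intro allI impI)
    fix r :: real assume "r > 0"
    then have "u \<in> {v\<in>L2 \<Omega>. Lp_norm 2 (lebesgue_on \<Omega>) (\<lambda>x. v x - u x) < ennreal r}"
      using u by (simp add: Lp_norm_2_less_iff sq_integral_def)
    then have "eventually (\<lambda>e. v e \<in> {v\<in>L2 \<Omega>. Lp_norm 2 (lebesgue_on \<Omega>) (\<lambda>x. v x - u x) < ennreal r}) F"
      using L openin_L2_ball[OF u, of r] unfolding limitin_def by blast
    then show "eventually (\<lambda>e. v e \<in> L2 \<Omega> \<and> Lp_norm 2 (lebesgue_on \<Omega>) (\<lambda>x. v e x - u x) < ennreal r) F"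
      by simp
  qed
next
  assume R: "\<forall>r>0. eventually (\<lambda>e. v e \<in> L2 \<Omega> \<and> Lp_norm 2 (lebesgue_on \<Omega>) (\<lambda>x. v e x - u x) < ennreal r) F"
  show "limitin (L2_topology \<Omega>) v u F"
    unfolding limitin_def
  proof (intro conjI allI impI)
    show "u \<in> topspace (L2_topology \<Omega>)" using u by simp
    fix U assume U: "openin (L2_topology \<Omega>) U \<and> u \<in> U"
    then obtain r where r: "r > (0::real)" "\<And>v. v \<in> L2 \<Omega> \<Longrightarrow> Lp_norm 2 (lebesgue_on \<Omega>) (\<lambda>x. v x - u x) < ennreal r \<Longrightarrow> v \<in> U"
      unfolding openin_L2_topology by blast
    from R r(1) have "eventually (\<lambda>e. v e \<in> L2 \<Omega> \<and> Lp_norm 2 (lebesgue_on \<Omega>) (\<lambda>x. v e x - u x) < ennreal r) F" by blast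
    then show "eventually (\<lambda>e. v e \<in> U) F" by eventually_elim (use r(2) in blast)
  qed
qed

section \<open>Continuous functions and their energies on bounded open sets\<close>

lemma emeasure_lebesgue_on_bounded:
  fixes U :: "(real^'n) set"
  assumes "open U" "bounded U"
  shows "emeasure (lebesgue_on U) U < \<infinity>" "finite_measure (lebesgue_on U)"
proof -
  have "emeasure lebesgue U < \<infinity>"
    using assms emeasure_bounded_finite[OF assms(2)] by simp
  moreover have "emeasure (lebesgue_on U) U = emeasure lebesgue U"
    using assms(1) by (intro emeasure_restrict_space) auto
  ultimately show "emeasure (lebesgue_on U) U < \<infinity>" by simp
  then show "finite_measure (lebesgue_on U)"
    by (intro finite_measureI) simp
qed

lemma continuous_bounded_on_closure:
  fixes g :: "real^'n \<Rightarrow> 'b::real_normed_vector"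
  assumes "continuous_on UNIV g" "bounded U"
  obtains B where "B > 0" "\<And>x. x \<in> U \<Longrightarrow> norm (g x) \<le> B"
proof -
  have "compact (g ` closure U)"
    using assms by (intro compact_continuous_image continuous_on_subset[OF assms(1)]) auto
  then have "bounded (g ` closure U)" by (rule compact_imp_bounded)
  then obtain B where "B > 0" "\<And>x. x \<in> closure U \<Longrightarrow> norm (g x) \<le> B"
    unfolding bounded_pos by auto
  then show ?thesis using that closure_subset[of U] by (meson subsetD)
qed

lemma continuous_in_Lp_2:
  fixes g :: "real^'n \<Rightarrow> 'b::{second_countable_topology,real_normed_vector}"
  assumes U: "open U" "bounded U" and g: "continuous_on UNIV g"
  shows "g \<in> Lp 2 (lebesgue_on U)"
proof -
  obtain B where B: "\<And>x. x \<in> U \<Longrightarrow> norm (g x) \<le> B" using continuous_bounded_on_closure[OF g U(2)] by metis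
  have "sq_integral (lebesgue_on U) g \<le> (\<integral>\<^sup>+x. ennreal (B\<^sup>2) \<partial>lebesgue_on U)"
    unfolding sq_integral_def
  proof (rule nn_integral_mono)
    fix x assume "x \<in> space (lebesgue_on U)"
    then have "norm (g x) \<le> B" using B by simp
    then show "ennreal ((norm (g x))\<^sup>2) \<le> ennreal (B\<^sup>2)" by (intro ennreal_leI power_mono) auto
  qed
  also have "\<dots> < \<infinity>" using emeasure_lebesgue_on_bounded(1)[OF U] by (simp add: ennreal_mult_less_top)
  finally show ?thesis
    using borel_measurable_continuous_onI[OF g]
    by (auto simp: Lp_2_iff intro!: measurable_restrict_space1 measurable_completion)
qed

lemma C1_fun_in_H1:
  fixes f :: "real^'n \<Rightarrow> real"
  assumes "open U" "bounded U" "C1_fun f"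
  shows "f \<in> H1 U"
  unfolding W1p_def
  using continuous_in_Lp_2[OF assms(1,2) C1_fun_continuous[OF assms(3)]] continuous_in_Lp_2[OF assms(1,2) continuous_on_grad[OF assms(3)]]
    has_weak_gradient_C1[OF assms(1,3)] by blast

lemma weak_grad_H1:
  assumes "u \<in> H1 \<Omega>"
  shows "has_weak_gradient \<Omega> u (weak_grad \<Omega> u)"
  using assms unfolding weak_grad_def W1p_def by (metis (mono_tags, lifting) mem_Collect_eq someI_ex)

text \<open>\<open>weak_grad\<close> is an arbitrary choice among the weak gradients; uniqueness
  almost everywhere lets the classical gradient replace it under the integral.\<close>

lemma energy_C1_fun:
  fixes f :: "real^'n \<Rightarrow> real"
  assumes "open U" "bounded U" "C1_fun f"
  shows "energy U p f = (\<integral>\<^sup>+x. ennreal (p (norm (grad f x))) \<partial>lebesgue_on U)"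
proof -
  have H: "f \<in> H1 U" by (rule C1_fun_in_H1[OF assms])
  have "AE x in lebesgue_on U. weak_grad U f x = grad f x"
    by (rule has_weak_gradient_unique[OF assms(1) weak_grad_H1[OF H] has_weak_gradient_C1[OF assms(1,3)]])
  then have "(\<integral>\<^sup>+x. ennreal (p (norm (weak_grad U f x))) \<partial>lebesgue_on U) = (\<integral>\<^sup>+x. ennreal (p (norm (grad f x))) \<partial>lebesgue_on U)"
    by (intro nn_integral_cong_AE) (auto elim: eventually_mono)
  then show ?thesis using H by (simp add: energy_def)
qed

section \<open>Bounds for the integrand\<close>

text \<open>For |\<sigma>| > \<epsilon>^(-s) the logarithmic term is at least s / \<epsilon>, and s
  / \<epsilon> + \<epsilon> \<sigma>^2 / 4 >= sqrt s |\<sigma>| is the inequality of arithmetic and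
  geometric means; this is the origin of \<open>sqrt s\<close>. For smaller |\<sigma>| the
  logarithmic term alone is large enough, except near 0, where the error \<epsilon> |ln \<epsilon>|
  is spent.\<close>

lemma phi_lower_bound_eventually:
  assumes s: "0 < s" "s < 1"
  shows "eventually (\<lambda>\<epsilon>. \<forall>\<sigma>. sqrt s * \<bar>\<sigma>\<bar> - \<epsilon> * \<bar>ln \<epsilon>\<bar> \<le> phi \<epsilon> \<sigma>) (at_right 0)"
proof -
  \<comment> \<open>For small \<epsilon> this puts the threshold \<epsilon>^(-s) below the value of
    the logarithmic term at \<sigma> = 1, which settles the middle range.\<close>
  have "((\<lambda>\<epsilon>::real. \<epsilon> powr (-s) * (2 * \<epsilon> * \<bar>ln \<epsilon>\<bar>)) \<longlongrightarrow> 0) (at_right 0)"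
    using s by real_asymp
  then have "eventually (\<lambda>\<epsilon>::real. \<epsilon> powr (-s) * (2 * \<epsilon> * \<bar>ln \<epsilon>\<bar>) < ln 2) (at_right 0)"
    by (rule order_tendstoD(2)) simp
  moreover have "eventually (\<lambda>\<epsilon>::real. \<epsilon> \<in> {0<..<1}) (at_right 0)"
    by (rule eventually_at_right_real) simp
  ultimately show ?thesis
  proof eventually_elim
    case (elim \<epsilon>)
    then have e: "0 < \<epsilon>" "\<epsilon> < 1" and ln: "ln \<epsilon> < 0" by auto
    define L where "L = \<epsilon> * \<bar>ln \<epsilon>\<bar>"
    have L: "L > 0" unfolding L_def using e ln by (intro mult_pos_pos) auto
    have small: "\<epsilon> powr (-s) \<le> ln 2 / (2 * L)"
      using elim(1) L by (simp add: L_def field_simps)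
    have s1: "sqrt s \<le> 1" using s by simp
    have phiL: "phi \<epsilon> \<sigma> = ln (1 + \<sigma>\<^sup>2) / (2 * L) + \<epsilon> / 4 * \<sigma>\<^sup>2" for \<sigma>
      by (simp add: phi_def L_def mult_ac)
    show ?case
    proof
      fix \<sigma> :: real
      let ?t = "\<bar>\<sigma>\<bar>"
      have tri: "sqrt s * ?t \<le> ?t" using mult_right_mono[OF s1, of ?t] by simp
      consider "?t \<le> 1" | "1 < ?t" "?t \<le> \<epsilon> powr (-s)" | "\<epsilon> powr (-s) < ?t" by linarith
      then have "sqrt s * ?t - L \<le> phi \<epsilon> \<sigma>"
      proof cases
        \<comment> \<open>Here \<open>ln (1 + \<sigma>\<^sup>2)\<close> is at least half of
          \<open>\<sigma>\<^sup>2\<close>, so what remains is that the parabola \<sigma>^2 / (4 L)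
          lies above its tangent |\<sigma>| - L.\<close>
        case 1
        have "\<sigma>\<^sup>2 \<le> 1" using 1 by (simp add: abs_square_le_1)
        then have "\<sigma>\<^sup>2 / 2 \<le> ln (1 + \<sigma>\<^sup>2)"
        proof -
          have D: "0 < 1 + \<sigma>\<^sup>2" by (simp add: add_pos_nonneg)
          have "ln (inverse (1 + \<sigma>\<^sup>2)) \<le> inverse (1 + \<sigma>\<^sup>2) - 1"
            using D by (intro ln_le_minus_one) simp
          then have "1 - inverse (1 + \<sigma>\<^sup>2) \<le> ln (1 + \<sigma>\<^sup>2)" using D by (simp add: ln_inverse)
          moreover have "1 - inverse (1 + \<sigma>\<^sup>2) = \<sigma>\<^sup>2 / (1 + \<sigma>\<^sup>2)" using D by (simp add: field_simps)
          ultimately have "\<sigma>\<^sup>2 / (1 + \<sigma>\<^sup>2) \<le> ln (1 + \<sigma>\<^sup>2)" by simp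
          moreover have "\<sigma>\<^sup>2 / 2 \<le> \<sigma>\<^sup>2 / (1 + \<sigma>\<^sup>2)"
            using \<open>\<sigma>\<^sup>2 \<le> 1\<close> by (intro divide_left_mono) (auto simp: add_pos_nonneg)
          ultimately show ?thesis by linarith
        qed
        then have "\<sigma>\<^sup>2 / 2 / (2 * L) \<le> ln (1 + \<sigma>\<^sup>2) / (2 * L)" using L by (intro divide_right_mono) auto
        moreover have "?t - L \<le> \<sigma>\<^sup>2 / 2 / (2 * L)"
        proof -
          have "(?t - L) * (4 * L) \<le> \<sigma>\<^sup>2" using zero_le_power2[of "?t - 2 * L"]
            by (simp add: power2_eq_square algebra_simps)
          then show ?thesis using L by (simp add: field_simps)
        qed
        moreover have "0 \<le> \<epsilon> / 4 * \<sigma>\<^sup>2" using e by simp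
        ultimately show ?thesis using tri phiL[of \<sigma>] by linarith
      next
        case 2
        have "1 \<le> \<sigma>\<^sup>2" using 2(1) one_le_power[of ?t 2] by simp
        then have "ln 2 \<le> ln (1 + \<sigma>\<^sup>2)" by (simp add: add_pos_nonneg)
        then have "ln 2 / (2 * L) \<le> ln (1 + \<sigma>\<^sup>2) / (2 * L)" using L by (intro divide_right_mono) auto
        moreover have "0 \<le> \<epsilon> / 4 * \<sigma>\<^sup>2" using e by simp
        ultimately show ?thesis using 2(2) small tri phiL[of \<sigma>] L by linarith
      next
        case 3
        have t0: "0 < ?t" using 3 e by (smt (verit) powr_gt_zero)
        have "ln (\<epsilon> powr (-s)) \<le> ln ?t" by (subst ln_le_cancel_iff) (use 3 t0 e in auto)
        then have "s * \<bar>ln \<epsilon>\<bar> \<le> ln ?t" using e ln by (simp add: ln_powr)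
        moreover have "2 * ln ?t \<le> ln (1 + \<sigma>\<^sup>2)"
        proof -
          have "2 * ln ?t = ln (?t\<^sup>2)" using ln_realpow[of ?t 2] by (simp only: of_nat_numeral)
          also have "\<dots> \<le> ln (1 + \<sigma>\<^sup>2)" using t0 by (simp add: add_pos_nonneg)
          finally show ?thesis .
        qed
        ultimately have "2 * (s * \<bar>ln \<epsilon>\<bar>) / (2 * L) \<le> ln (1 + \<sigma>\<^sup>2) / (2 * L)"
          using L by (intro divide_right_mono) auto
        moreover have "2 * (s * \<bar>ln \<epsilon>\<bar>) / (2 * L) = s / \<epsilon>" using e ln by (simp add: L_def field_simps)
        moreover have "sqrt s * ?t \<le> s / \<epsilon> + \<epsilon> / 4 * \<sigma>\<^sup>2"
        proof -
          have "0 \<le> (2 * sqrt s - \<epsilon> * ?t)\<^sup>2" by simp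
          then have "4 * (sqrt s * ?t * \<epsilon>) \<le> 4 * s + \<epsilon>\<^sup>2 * \<sigma>\<^sup>2"
            using s by (simp add: power2_diff power_mult_distrib mult_ac)
          then show ?thesis using e by (simp add: field_simps power2_eq_square)
        qed
        ultimately show ?thesis using phiL[of \<sigma>] L by linarith
      qed
      then show "sqrt s * \<bar>\<sigma>\<bar> - \<epsilon> * \<bar>ln \<epsilon>\<bar> \<le> phi \<epsilon> \<sigma>" by (simp add: L_def)
    qed
  qed
qed

lemma phi_nonneg: "0 < \<epsilon> \<Longrightarrow> 0 \<le> phi \<epsilon> \<sigma>"
  unfolding phi_def by (intro add_nonneg_nonneg mult_nonneg_nonneg) auto

lemma eps_ln_le_1: "0 < \<epsilon> \<Longrightarrow> \<epsilon> < 1 \<Longrightarrow> \<epsilon> * \<bar>ln \<epsilon>\<bar> \<le> (1::real)"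
proof -
  assume e: "0 < \<epsilon>" "\<epsilon> < 1"
  have "ln (1 / \<epsilon>) \<le> 1 / \<epsilon> - 1" using e by (intro ln_le_minus_one) simp
  then have "\<bar>ln \<epsilon>\<bar> \<le> 1 / \<epsilon>" using e by (simp add: ln_div)
  then show ?thesis using e by (simp add: field_simps)
qed

text \<open>Compactness concerns every \<epsilon> in (0, 1), while the previous bound is for small
  \<epsilon>. With s = 1/4 it has slope 1/2 below some \<open>d\<close>; for \<epsilon> >= d the
  quadratic term alone yields this slope, and 1 / (4 d) arises from completing the square.\<close>

lemma phi_lower_bound_uniform:
  obtains C where "C \<ge> 0" "\<And>\<epsilon> \<sigma>. 0 < \<epsilon> \<Longrightarrow> \<epsilon> < 1 \<Longrightarrow> 1 / 2 * \<bar>\<sigma>\<bar> - C \<le> phi \<epsilon> \<sigma>"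
proof -
  obtain d where d: "d > 0" "\<And>\<epsilon>. 0 < \<epsilon> \<Longrightarrow> \<epsilon> < d \<Longrightarrow> \<forall>\<sigma>. sqrt (1/4) * \<bar>\<sigma>\<bar> - \<epsilon> * \<bar>ln \<epsilon>\<bar> \<le> phi \<epsilon> \<sigma>"
    using phi_lower_bound_eventually[of "1/4"] unfolding eventually_at_right_field by auto
  have sq: "sqrt (1/4) = 1/2" by (simp add: real_sqrt_divide)
  show ?thesis
  proof (rule that[of "1 + 1 / (4 * d)"])
    fix \<epsilon> \<sigma> :: real assume e: "0 < \<epsilon>" "\<epsilon> < 1"
    show "1 / 2 * \<bar>\<sigma>\<bar> - (1 + 1 / (4 * d)) \<le> phi \<epsilon> \<sigma>"
    proof (cases "\<epsilon> < d")
      case True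
      then have "1 / 2 * \<bar>\<sigma>\<bar> - \<epsilon> * \<bar>ln \<epsilon>\<bar> \<le> phi \<epsilon> \<sigma>" using d(2)[OF e(1)] sq by simp
      moreover have "0 \<le> 1 / (4 * d)" using d(1) by simp
      ultimately show ?thesis using eps_ln_le_1[OF e] by linarith
    next
      case False
      have "0 \<le> (d * \<bar>\<sigma>\<bar> - 1)\<^sup>2" by simp
      then have "2 * \<bar>\<sigma>\<bar> * d \<le> d\<^sup>2 * \<sigma>\<^sup>2 + 1"
        by (simp add: power2_diff power_mult_distrib mult_ac)
      then have "1 / 2 * \<bar>\<sigma>\<bar> - 1 / (4 * d) \<le> d / 4 * \<sigma>\<^sup>2" using d(1) by (simp add: field_simps power2_eq_square)
      also have "\<dots> \<le> \<epsilon> / 4 * \<sigma>\<^sup>2" using False by (intro mult_right_mono) auto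
      also have "\<dots> \<le> phi \<epsilon> \<sigma>" 
      proof -
        have "0 \<le> 1 / (2 * \<epsilon> * \<bar>ln \<epsilon>\<bar>) * ln (1 + \<sigma>\<^sup>2)" 
          using e by (intro mult_nonneg_nonneg divide_nonneg_nonneg abs_ge_zero ln_ge_zero) auto
        then show ?thesis by (simp add: phi_def)
      qed
      finally show ?thesis by simp
    qed
  qed (use d(1) in simp)
qed

lemma convexification_lower_bound:
  assumes "0 < \<epsilon>" "0 \<le> c" "\<And>\<sigma>. c * \<bar>\<sigma>\<bar> - d \<le> phi \<epsilon> \<sigma>"
  shows "c * \<bar>\<sigma>\<bar> - d \<le> convexification (phi \<epsilon>) \<sigma>"
proof -
  have "convex_on UNIV (\<lambda>\<sigma>::real. c * \<bar>\<sigma>\<bar> - d)"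
  proof (rule convex_onI)
    fix t x y :: real assume t: "0 < t" "t < 1"
    have "\<bar>(1 - t) * x + t * y\<bar> \<le> (1 - t) * \<bar>x\<bar> + t * \<bar>y\<bar>"
      using abs_triangle_ineq[of "(1 - t) * x" "t * y"] t by (simp add: abs_mult)
    then have "c * \<bar>(1 - t) * x + t * y\<bar> \<le> c * ((1 - t) * \<bar>x\<bar> + t * \<bar>y\<bar>)"
      using assms(2) by (rule mult_left_mono)
    then show "c * \<bar>(1 - t) *\<^sub>R x + t *\<^sub>R y\<bar> - d \<le> (1 - t) * (c * \<bar>x\<bar> - d) + t * (c * \<bar>y\<bar> - d)"
      by (simp add: algebra_simps)
  qed simp
  \<comment> \<open>The zero function witnesses that some convex minorant exists, which
    \<open>convexification_greatest\<close> requires; the new minorant is then compared with the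
    greatest one.\<close>
  then have "(\<lambda>\<sigma>. c * \<bar>\<sigma>\<bar> - d) \<le> convexification (phi \<epsilon>)"
    using assms(3) by (intro convexification_greatest(3)[of "\<lambda>_. 0" "phi \<epsilon>"])
      (auto simp: le_fun_def phi_nonneg[OF assms(1)] convex_on_def)
  then show ?thesis by (simp add: le_fun_def)
qed

lemma convexification_phi_le:
  assumes "0 < \<epsilon>"
  shows "convexification (phi \<epsilon>) \<sigma> \<le> phi \<epsilon> \<sigma>"
proof -
  have "convexification (phi \<epsilon>) \<le> phi \<epsilon>"
    by (rule convexification_greatest(2)[of "\<lambda>_. 0"])
      (auto simp: le_fun_def phi_nonneg[OF assms] convex_on_def)
  then show ?thesis by (simp add: le_fun_def)
qed

lemma phi_mono:
  assumes "0 < \<epsilon>" "0 \<le> \<sigma>" "\<sigma> \<le> \<tau>"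
  shows "phi \<epsilon> \<sigma> \<le> phi \<epsilon> \<tau>"
proof -
  have sq: "\<sigma>\<^sup>2 \<le> \<tau>\<^sup>2" using assms by (intro power_mono) auto
  then have "ln (1 + \<sigma>\<^sup>2) \<le> ln (1 + \<tau>\<^sup>2)" by (simp add: add_pos_nonneg)
  then show ?thesis
    unfolding phi_def using assms sq by (intro add_mono mult_left_mono) auto
qed

lemma phi_0: "phi \<epsilon> 0 = 0"
  by (simp add: phi_def)

text \<open>The integrand at c times the optimal slope, relative to 2 / \<epsilon>. The logarithm
  contributes 1/2 to the limit, since the logarithm of \<epsilon>^(-2) is twice |ln \<epsilon>|, and
  the quadratic term c^2 / 2; for c = 1 the sum is 1. The correction \<epsilon> K is of lower
  order.\<close>

lemma phi_transition_cost:
  fixes c K :: real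
  assumes "c > 0" "K \<ge> 0"
  shows "((\<lambda>\<epsilon>. \<epsilon> / 2 * phi \<epsilon> (c * (2 / \<epsilon> + \<epsilon> * K))) \<longlongrightarrow> (1 + c\<^sup>2) / 2) (at_right 0)"
proof (cases "K = 0")
  case True
  show ?thesis
    unfolding phi_def True using assms(1) by real_asymp
next
  case False
  with assms(2) have "K > 0" by simp
  with assms(1) show ?thesis
    unfolding phi_def by real_asymp
qed

section \<open>Recovery sequences for continuously differentiable functions\<close>

lemma nn_integral_lebesgue_on_eq_lborel:
  fixes g :: "'a::euclidean_space \<Rightarrow> ennreal"
  assumes "U \<in> sets borel" "g \<in> borel_measurable borel"
  shows "(\<integral>\<^sup>+x. g x \<partial>lebesgue_on U) = (\<integral>\<^sup>+x. g x * indicator U x \<partial>lborel)"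
proof -
  have "(\<integral>\<^sup>+x. g x \<partial>lebesgue_on U) = (\<integral>\<^sup>+x. g x * indicator U x \<partial>lebesgue)"
    using assms(1) by (subst nn_integral_restrict_space) auto
  also have "\<dots> = (\<integral>\<^sup>+x. g x * indicator U x \<partial>lborel)"
    using assms by (intro nn_integral_completion) measurable
  finally show ?thesis .
qed

text \<open>For \<tau> uniform in [0, 1] the fractional part of A + \<tau> is uniform as well. The
  two intervals collect the shifts without and with a carry to the next integer, and their lengths
  add up to \<open>l\<close>.\<close>

lemma emeasure_frac_shift_le:
  assumes l: "0 \<le> l" "l \<le> (1::real)"
  shows "emeasure lborel {\<tau>\<in>{0..1}. 0 < frac (A + \<tau>) \<and> frac (A + \<tau>) < l} \<le> ennreal l"
proof -
  define b where "b = frac A"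
  have b: "0 \<le> b" "b < 1" by (auto simp: b_def frac_lt_1)
  let ?I = "{0..<max 0 (l - b)}" and ?J = "{1 - b<..min 1 (1 - b + l)}"
  have sub: "{\<tau>\<in>{0..1}. 0 < frac (A + \<tau>) \<and> frac (A + \<tau>) < l} \<subseteq> ?I \<union> ?J"
  proof
    fix \<tau> assume "\<tau> \<in> {\<tau>\<in>{0..1}. 0 < frac (A + \<tau>) \<and> frac (A + \<tau>) < l}"
    then have t: "0 \<le> \<tau>" "\<tau> \<le> 1" "0 < frac (A + \<tau>)" "frac (A + \<tau>) < l" by auto
    have A: "A = of_int \<lfloor>A\<rfloor> + b" by (simp add: b_def frac_def)
    show "\<tau> \<in> ?I \<union> ?J"
    proof (cases "b + \<tau> < 1")
      case True
      have "\<lfloor>A + \<tau>\<rfloor> = \<lfloor>A\<rfloor>" using True t b A by (intro floor_unique) linarith+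
      then have "frac (A + \<tau>) = b + \<tau>" using A by (simp add: frac_def)
      then show ?thesis using t by auto
    next
      case False
      have "\<lfloor>A + \<tau>\<rfloor> = \<lfloor>A\<rfloor> + 1" using False t b A by (intro floor_unique; simp only: of_int_add of_int_1; linarith)
      then have "frac (A + \<tau>) = b + \<tau> - 1" using A by (simp add: frac_def)
      then show ?thesis using t by auto
    qed
  qed
  have "emeasure lborel {\<tau>\<in>{0..1}. 0 < frac (A + \<tau>) \<and> frac (A + \<tau>) < l} \<le> emeasure lborel (?I \<union> ?J)"
    using sub by (intro emeasure_mono) auto
  also have "\<dots> \<le> emeasure lborel ?I + emeasure lborel ?J"
    by (intro emeasure_subadditive) auto
  also have "\<dots> = ennreal (max 0 (l - b)) + ennreal (min 1 (1 - b + l) - (1 - b))"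
    using b l by (simp add: emeasure_lborel_Ico emeasure_lborel_Ioc)
  also have "\<dots> = ennreal (max 0 (l - b) + (min 1 (1 - b + l) - (1 - b)))"
    using b l by (subst ennreal_plus) auto
  also have "max 0 (l - b) + (min 1 (1 - b + l) - (1 - b)) = l" using b l by auto
  finally show ?thesis .
qed

text \<open>The first moment method: by Fubini the mean over \<tau> of the measure of the section is
  at most the integral of \<open>l\<close>, so it cannot exceed that integral by \<open>e\<close>
  for every \<tau>. Finiteness of the integral makes the added \<open>e\<close> a genuine
  gap.\<close>

lemma exists_small_section:
  fixes S :: "'a::euclidean_space \<Rightarrow> real \<Rightarrow> bool"
  assumes U: "U \<in> sets borel" and S: "{(x, \<tau>). S x \<tau>} \<in> sets (borel \<Otimes>\<^sub>M borel)"
    and l: "\<And>x. x \<in> U \<Longrightarrow> emeasure lborel {\<tau>\<in>{0..1}. S x \<tau>} \<le> l x" and lm: "l \<in> borel_measurable borel"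
    and fin: "(\<integral>\<^sup>+x. l x * indicator U x \<partial>lborel) < \<infinity>" and e: "e > 0"
  obtains \<tau> where "\<tau> \<in> {0..1}" "(\<integral>\<^sup>+x. indicator {x. S x \<tau>} x * indicator U x \<partial>lborel) < (\<integral>\<^sup>+x. l x * indicator U x \<partial>lborel) + ennreal e"
proof -
  let ?L = "\<integral>\<^sup>+x. l x * indicator U x \<partial>lborel"
  let ?F = "\<lambda>x \<tau>. indicator {(x, \<tau>). S x \<tau>} (x, \<tau>) * indicator U x * indicator {0..1} \<tau> :: ennreal"
  have Fm: "case_prod ?F \<in> borel_measurable (lborel \<Otimes>\<^sub>M lborel)"
  proof -
    have "{(x, \<tau>). S x \<tau>} \<in> sets (lborel \<Otimes>\<^sub>M lborel)"
      using S by (simp cong: sets_pair_measure_cong)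
    then show ?thesis using U by measurable
  qed
  have "\<exists>\<tau>\<in>{0..1}. (\<integral>\<^sup>+x. indicator {x. S x \<tau>} x * indicator U x \<partial>lborel) < ?L + ennreal e"
  proof (rule ccontr)
    assume "\<not> ?thesis"
    then have ge: "?L + ennreal e \<le> (\<integral>\<^sup>+x. indicator {x. S x \<tau>} x * indicator U x \<partial>lborel)" if "\<tau> \<in> {0..1}" for \<tau>
      using that by (auto simp: not_less)
    have "?L + ennreal e = (\<integral>\<^sup>+\<tau>. (?L + ennreal e) * indicator {0..1::real} \<tau> \<partial>lborel)"
      by (simp add: nn_integral_cmult_indicator)
    also have "\<dots> \<le> (\<integral>\<^sup>+\<tau>. \<integral>\<^sup>+x. ?F x \<tau> \<partial>lborel \<partial>lborel)"
    proof (rule nn_integral_mono)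
      fix \<tau> :: real
      have "(\<integral>\<^sup>+x. ?F x \<tau> \<partial>lborel) = (\<integral>\<^sup>+x. indicator {x. S x \<tau>} x * indicator U x \<partial>lborel)" if "\<tau> \<in> {0..1}"
        using that by (intro nn_integral_cong) (auto simp: indicator_def)
      then show "(?L + ennreal e) * indicator {0..1} \<tau> \<le> (\<integral>\<^sup>+x. ?F x \<tau> \<partial>lborel)"
        using ge[of \<tau>] by (cases "\<tau> \<in> {0..1}") auto
    qed
    also have "\<dots> = (\<integral>\<^sup>+x. \<integral>\<^sup>+\<tau>. ?F x \<tau> \<partial>lborel \<partial>lborel)"
      by (rule lborel_pair.Fubini'[OF Fm])
    also have "\<dots> \<le> ?L"
    proof (rule nn_integral_mono)
      fix x
      have Sx: "{\<tau>\<in>{0..1}. S x \<tau>} \<in> sets borel"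
      proof -
        have "Pair x -` {(x, \<tau>). S x \<tau>} \<in> sets borel" using S by (rule sets_Pair1)
        moreover have "{\<tau>\<in>{0..1}. S x \<tau>} = Pair x -` {(x, \<tau>). S x \<tau>} \<inter> {0..1}" by auto
        ultimately show ?thesis by simp
      qed
      have "(\<integral>\<^sup>+\<tau>. ?F x \<tau> \<partial>lborel) = (\<integral>\<^sup>+\<tau>. indicator U x * indicator {\<tau>\<in>{0..1}. S x \<tau>} \<tau> \<partial>lborel)"
        by (intro nn_integral_cong) (auto simp: indicator_def)
      also have "\<dots> = indicator U x * emeasure lborel {\<tau>\<in>{0..1}. S x \<tau>}"
        using Sx by (intro nn_integral_cmult_indicator) simp
      also have "\<dots> \<le> l x * indicator U x"
        using l[of x] by (cases "x \<in> U") auto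
      finally show "(\<integral>\<^sup>+\<tau>. ?F x \<tau> \<partial>lborel) \<le> l x * indicator U x" .
    qed
    finally show False using fin e by (cases "?L") (auto simp: ennreal_plus[symmetric] simp del: ennreal_plus)
  qed
  then show ?thesis using that by blast
qed

text \<open>The staircase has steps of height \<open>\<epsilon>\<close>, and every riser takes up the fraction \<open>l = s \<epsilon> / 2\<close> of a
  step, which makes its slope about \<open>2 / \<epsilon>\<close>, the point where \<open>phi \<epsilon> \<sigma> / \<sigma>\<close> is minimal. Averaging over
  the shift \<open>\<tau>\<close> replaces the equidistribution of the risers.\<close>

lemma staircase:
  fixes f r :: "real^'n \<Rightarrow> real"
  assumes f: "C1_fun f" and r: "C1_fun r" and rpos: "\<And>x. r x > 0" and a: "0 < a" "a \<le> 1/2" and \<epsilon>: "0 < \<epsilon>" and \<tau>: "\<tau> \<in> {0..1}"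
    and B: "\<And>x. x \<in> U \<Longrightarrow> \<bar>f x\<bar> \<le> B" and lam: "\<And>x. x \<in> U \<Longrightarrow> \<epsilon> / (2 * r x) \<le> 1"
    and slope: "\<And>x. x \<in> U \<Longrightarrow> r x * norm (grad f x) \<le> 1" and K: "\<And>x. x \<in> U \<Longrightarrow> norm (grad r x) \<le> K * r x"
  obtains v where "C1_fun v" "\<And>x. x \<in> U \<Longrightarrow> \<bar>v x - f x\<bar> \<le> 2 * \<epsilon>"
    "\<And>x. x \<in> U \<Longrightarrow> \<not> (0 < frac (f x / \<epsilon> + \<tau>) \<and> frac (f x / \<epsilon> + \<tau>) < \<epsilon> / (2 * r x)) \<Longrightarrow> grad v x = 0"
    "\<And>x. x \<in> U \<Longrightarrow> norm (grad v x) \<le> 1 / (1 - a) * (2 / \<epsilon> + \<epsilon> * K)"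
proof -
  \<comment> \<open>For x in \<open>U\<close> the integer part of f x / \<epsilon> + \<tau> lies
    between -N and N, so finitely many risers represent the staircase on \<open>U\<close>.\<close>
  define N :: int where "N = \<lceil>\<bar>B\<bar> / \<epsilon>\<rceil> + 2"
  let ?A = "{-N..N}"
  \<comment> \<open>With T = f x / \<epsilon> + \<tau> and l = \<epsilon> / (2 r x) this is (T - k)
    / l: the riser with index k runs while T passes from k to k + l.\<close>
  define Y where "Y k x = 2 / \<epsilon> * ((f x / \<epsilon> + \<tau> - of_int k) * r x)" for k :: int and x
  define v where "v x = \<epsilon> * (- of_int N + (\<Sum>k\<in>?A. ramp a (Y k x)))" for x
  have a1: "a < 1" using a by simp
  have Y: "C1_fun (Y k)" for k
  proof -
    have "C1_fun (\<lambda>x. 2 / \<epsilon> * (((1 / \<epsilon>) * f x + \<tau> - of_int k) * r x))"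
      by (intro C1_fun_mult C1_fun_const C1_fun_add C1_fun_diff f r)
    then show ?thesis unfolding Y_def[abs_def] by simp
  qed
  have rY: "C1_fun (\<lambda>x. ramp a (Y k x))" for k
    by (rule C1_fun_compose_real[OF ramp_has_derivative[OF a(1) a1] ramp_slope_continuous[OF a(1) a1] Y])
  have vC: "C1_fun v"
    unfolding v_def[abs_def] by (intro C1_fun_mult C1_fun_const C1_fun_add C1_fun_sum rY) simp
  have dY: "frechet_derivative (Y k) (at x) w = 2 / \<epsilon> * (frechet_derivative f (at x) w / \<epsilon> * r x + (f x / \<epsilon> + \<tau> - of_int k) * frechet_derivative r (at x) w)" for k x w
  proof -
    have "(Y k has_derivative (\<lambda>w. 2 / \<epsilon> * ((f x / \<epsilon> + \<tau> - of_int k) * frechet_derivative r (at x) w + frechet_derivative f (at x) w / \<epsilon> * r x))) (at x)"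
    proof -
      have "((\<lambda>x. f x / \<epsilon> + \<tau> - of_int k) has_derivative (\<lambda>w. frechet_derivative f (at x) w / \<epsilon>)) (at x)"
        using \<epsilon> by (auto intro!: derivative_eq_intros C1_fun_has_derivative[OF f])
      from has_derivative_mult_right[OF has_derivative_mult[OF this C1_fun_has_derivative[OF r]], of "2 / \<epsilon>"]
      show ?thesis unfolding Y_def[abs_def] .
    qed
    then show ?thesis by (simp add: frechet_derivative_eqI add.commute)
  qed
  have dv: "frechet_derivative v (at x) w = \<epsilon> * (\<Sum>k\<in>?A. ramp_slope a (Y k x) * frechet_derivative (Y k) (at x) w)" for x w
  proof -
    have d1: "((\<lambda>x. ramp a (Y k x)) has_derivative (\<lambda>w. ramp_slope a (Y k x) * frechet_derivative (Y k) (at x) w)) (at x)" for k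
      using has_derivative_compose[OF C1_fun_has_derivative[OF Y] has_field_derivative_imp_has_derivative[OF ramp_has_derivative[OF a(1) a1]]] .
    have "(v has_derivative (\<lambda>w. \<epsilon> * (0 + (\<Sum>k\<in>?A. ramp_slope a (Y k x) * frechet_derivative (Y k) (at x) w)))) (at x)"
      unfolding v_def[abs_def]
      by (intro has_derivative_mult_right has_derivative_add has_derivative_const has_derivative_sum d1)
    then show ?thesis by (simp add: frechet_derivative_eqI)
  qed
  have main: "\<bar>v x - f x\<bar> \<le> 2 * \<epsilon> \<and> (\<not> (0 < frac (f x / \<epsilon> + \<tau>) \<and> frac (f x / \<epsilon> + \<tau>) < \<epsilon> / (2 * r x)) \<longrightarrow> grad v x = 0)
      \<and> norm (grad v x) \<le> 1 / (1 - a) * (2 / \<epsilon> + \<epsilon> * K)" if x: "x \<in> U" for x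
  proof -
    define T where "T = f x / \<epsilon> + \<tau>"
    define k0 where "k0 = \<lfloor>T\<rfloor>"
    define l where "l = \<epsilon> / (2 * r x)"
    have l: "0 < l" "l \<le> 1" using lam[OF x] \<epsilon> rpos[of x] by (auto simp: l_def)
    have Yl: "Y k x = (T - of_int k) / l" for k
      using rpos[of x] \<epsilon> by (simp add: Y_def T_def l_def field_simps)
    have T: "of_int k0 \<le> T" "T < of_int k0 + 1" by (auto simp: k0_def)
    have fr: "frac T = T - of_int k0" by (simp add: frac_def k0_def)
    have Tb: "\<bar>T\<bar> \<le> \<bar>B\<bar> / \<epsilon> + 1"
    proof -
      have "\<bar>f x / \<epsilon>\<bar> \<le> \<bar>B\<bar> / \<epsilon>" using B[OF x] \<epsilon> by (simp add: divide_right_mono)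
      then show ?thesis using \<tau> unfolding T_def by (simp add: abs_if split: if_splits)
    qed
    have kN: "k0 \<in> ?A"
    proof -
      have "\<bar>T\<bar> \<le> of_int N - 1" using Tb unfolding N_def by linarith
      then show ?thesis using T by simp linarith
    qed
    \<comment> \<open>As l <= 1, the risers with index below \<open>k0\<close> are finished and
      those above have not begun; only the one with index \<open>k0\<close> can be active at
      x.\<close>
    have below: "Y k x \<ge> 1" if "k < k0" for k
    proof -
      have "of_int k + 1 \<le> (of_int k0 :: real)" using that by linarith
      then have "l \<le> T - of_int k" using T l by linarith
      then show ?thesis using l by (simp add: Yl)
    qed
    have above: "Y k x \<le> 0" if "k > k0" for k
    proof -
      have "of_int k0 + 1 \<le> (of_int k :: real)" using that by linarith
      then have "T - of_int k \<le> 0" using T by linarith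
      then show ?thesis using l by (simp add: Yl divide_nonpos_pos)
    qed
    have "(\<Sum>k\<in>?A. ramp a (Y k x)) = (\<Sum>k\<in>?A. (if k < k0 then 1 else 0) + (if k = k0 then ramp a (Y k0 x) else 0))"
    proof (rule sum.cong[OF refl])
      fix k
      show "ramp a (Y k x) = (if k < k0 then 1 else 0) + (if k = k0 then ramp a (Y k0 x) else 0)"
        using below[of k] above[of k] ramp_eq_1[OF a, of "Y k x"] ramp_eq_0[OF a, of "Y k x"]
        by (cases k k0 rule: linorder_cases) auto
    qed
    also have "\<dots> = of_int (card {k\<in>?A. k < k0}) + ramp a (Y k0 x)"
      using kN by (simp add: sum.distrib sum.If_cases Int_def)
    also have "{k\<in>?A. k < k0} = {-N..<k0}" using kN by auto
    also have "of_int (card {-N..<k0}) = (of_int (k0 + N) :: real)" using kN by simp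
    finally have vx: "v x = \<epsilon> * (of_int k0 + ramp a (Y k0 x))" by (simp add: v_def)
    have "f x = \<epsilon> * (T - \<tau>)" using \<epsilon> by (simp add: T_def)
    then have "v x - f x = \<epsilon> * (of_int k0 + ramp a (Y k0 x) - T + \<tau>)"
      by (simp add: vx algebra_simps)
    \<comment> \<open>The ramp, T - \<open>k0\<close> and \<tau> all lie in [0, 1], whence an error
      of at most two steps.\<close>
    moreover have "\<bar>of_int k0 + ramp a (Y k0 x) - T + \<tau>\<bar> \<le> 2"
      using T \<tau> ramp_bounds[OF a, of "Y k0 x"] by (simp add: abs_le_iff)
    ultimately have c1: "\<bar>v x - f x\<bar> \<le> 2 * \<epsilon>"
      using \<epsilon> by (simp add: abs_mult mult.commute)
    have dv1: "frechet_derivative v (at x) w = \<epsilon> * (ramp_slope a (Y k0 x) * frechet_derivative (Y k0) (at x) w)" for w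
    proof -
      have "(\<Sum>k\<in>?A. ramp_slope a (Y k x) * frechet_derivative (Y k) (at x) w)
        = (\<Sum>k\<in>?A. if k = k0 then ramp_slope a (Y k0 x) * frechet_derivative (Y k0) (at x) w else 0)"
      proof (rule sum.cong[OF refl])
        fix k
        show "ramp_slope a (Y k x) * frechet_derivative (Y k) (at x) w = (if k = k0 then ramp_slope a (Y k0 x) * frechet_derivative (Y k0) (at x) w else 0)"
          using below[of k] above[of k] ramp_slope_eq_0[OF a, of "Y k x"]
          by (cases k k0 rule: linorder_cases) auto
      qed
      then show ?thesis using kN by (simp add: dv)
    qed
    have cancel: "\<epsilon> * (b * (2 / \<epsilon> * (D / \<epsilon> * q + Z * R))) = b * ((2 * q / \<epsilon>) * D + (2 * Z) * R)" for b D q Z R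
    proof -
      have "\<epsilon> * (b * (2 / \<epsilon> * (D / \<epsilon> * q + Z * R))) = b * (2 * (D / \<epsilon> * q + Z * R))" using \<epsilon> by simp
      then show ?thesis by (simp add: algebra_simps)
    qed
    have "frechet_derivative v (at x) w = ramp_slope a (Y k0 x) * ((2 * r x / \<epsilon>) * frechet_derivative f (at x) w + (2 * (T - of_int k0)) * frechet_derivative r (at x) w)" for w
      unfolding dv1 dY cancel T_def ..
    then have "grad v x = ramp_slope a (Y k0 x) *\<^sub>R ((2 * r x / \<epsilon>) *\<^sub>R grad f x + (2 * (T - of_int k0)) *\<^sub>R grad r x)"
      by (simp add: grad_def vec_eq_iff)
    moreover have zero: "ramp_slope a (Y k0 x) = 0" if "\<not> (0 < T - of_int k0 \<and> T - of_int k0 < l)"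
    proof -
      have "Y k0 x \<le> 0 \<or> Y k0 x \<ge> 1" using that T l unfolding Yl by (auto simp: divide_nonpos_pos)
      then show ?thesis by (rule ramp_slope_eq_0[OF a])
    qed
    ultimately have g: "grad v x = ramp_slope a (Y k0 x) *\<^sub>R ((2 * r x / \<epsilon>) *\<^sub>R grad f x + (2 * (T - of_int k0)) *\<^sub>R grad r x)"
      and g0: "\<not> (0 < frac T \<and> frac T < l) \<Longrightarrow> grad v x = 0"
      by (simp_all add: fr)
    have Kn: "K \<ge> 0" using order_trans[OF norm_ge_zero K[OF x]] rpos[of x] by (simp add: zero_le_mult_iff)
    have pos: "0 \<le> 1 / (1 - a) * (2 / \<epsilon> + \<epsilon> * K)" using a \<epsilon> Kn by simp
    have "norm (grad v x) \<le> 1 / (1 - a) * (2 / \<epsilon> + \<epsilon> * K)"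
    proof (cases "0 < frac T \<and> frac T < l")
      case False then show ?thesis using g0 pos by simp
    next
      case True
      have e1: "norm ((2 * r x / \<epsilon>) *\<^sub>R grad f x) \<le> 2 / \<epsilon>"
      proof -
        have "norm ((2 * r x / \<epsilon>) *\<^sub>R grad f x) = (2 / \<epsilon>) * (r x * norm (grad f x))" using rpos[of x] \<epsilon> by simp
        also have "\<dots> \<le> (2 / \<epsilon>) * 1" using slope[OF x] \<epsilon> by (intro mult_left_mono) auto
        finally show ?thesis by simp
      qed
      \<comment> \<open>The varying width of the risers brings in the gradient of \<open>r\<close>.
        On the active riser T - \<open>k0\<close> < l = \<epsilon> / (2 r x), and |grad r| <= K r
        cancels the factor 1 / r.\<close>
      have e2: "norm ((2 * (T - of_int k0)) *\<^sub>R grad r x) \<le> \<epsilon> * K"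
      proof -
        have "norm ((2 * (T - of_int k0)) *\<^sub>R grad r x) = 2 * (T - of_int k0) * norm (grad r x)" using T by simp
        also have "\<dots> \<le> (2 * l) * (K * r x)" using True fr K[OF x] T l by (intro mult_mono) auto
        also have "\<dots> = \<epsilon> * K" using rpos[of x] by (simp add: l_def field_simps)
        finally show ?thesis .
      qed
      have "norm (grad v x) \<le> ramp_slope a (Y k0 x) * (2 / \<epsilon> + \<epsilon> * K)"
        unfolding g norm_scaleR abs_of_nonneg[OF ramp_slope_bounds(1)[OF a]]
        by (rule mult_left_mono[OF norm_triangle_le[OF add_mono[OF e1 e2]] ramp_slope_bounds(1)[OF a]])
      also have "\<dots> \<le> 1 / (1 - a) * (2 / \<epsilon> + \<epsilon> * K)"
        using ramp_slope_bounds(2)[OF a, of "Y k0 x"] \<epsilon> Kn by (intro mult_right_mono) auto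
      finally show ?thesis .
    qed
    then show ?thesis using c1 g0 by (auto simp: T_def l_def)
  qed
  show ?thesis by (rule that[OF vC]) (use main in blast)+
qed


text \<open>The regularisation by \<open>t\<close> keeps the reciprocal of |p| smooth at the zeros
  of \<open>p\<close>.\<close>

lemma C1_fun_inverse_hypotenuse:
  fixes p :: "'a::real_normed_vector \<Rightarrow> real"
  assumes t: "t > 0" and p: "C1_fun p"
  shows "C1_fun (\<lambda>x. 1 / sqrt (t\<^sup>2 + (p x)\<^sup>2))"
proof -
  have pos: "0 < t\<^sup>2 + y\<^sup>2" for y using t by (simp add: add_pos_nonneg)
  have "((\<lambda>y. 1 / sqrt (t\<^sup>2 + y\<^sup>2)) has_real_derivative - y / (sqrt (t\<^sup>2 + y\<^sup>2) * (t\<^sup>2 + y\<^sup>2))) (at y)" for y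
    using pos[of y] by (auto intro!: derivative_eq_intros simp: field_simps power2_eq_square)
  moreover have "continuous_on UNIV (\<lambda>y. - y / (sqrt (t\<^sup>2 + y\<^sup>2) * (t\<^sup>2 + y\<^sup>2)))"
    using pos by (intro continuous_intros) (auto simp: less_imp_neq[OF pos, symmetric])
  ultimately show ?thesis using p by (rule C1_fun_compose_real)
qed

text \<open>On \<open>U\<close> the function \<open>s\<close> is a smooth majorant of |grad f|
  exceeding it by at most 4 t, and r = 1 / s sets the width of the risers. For a good shift the
  risers occupy less than \<epsilon> / 2 times (g + 4 t m + t); there the integrand is at most
  \<open>phi \<epsilon> (c * (2 / \<epsilon> + \<epsilon> * K))\<close>, elsewhere it is 0, and the
  product of the two bounds has the limit (1 + c^2) / 2 (g + 4 t m + t).\<close>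

lemma recovery_C1_fun:
  fixes f :: "real^'n \<Rightarrow> real"
  assumes U: "open U" "bounded U" and f: "C1_fun f" and \<eta>: "\<eta> > 0"
  shows "eventually (\<lambda>\<epsilon>. \<exists>v. C1_fun v \<and> (\<forall>x\<in>U. \<bar>v x - f x\<bar> \<le> 2 * \<epsilon>) \<and>
    (\<integral>\<^sup>+x. ennreal (phi \<epsilon> (norm (grad v x))) \<partial>lebesgue_on U) \<le> (\<integral>\<^sup>+x. ennreal (norm (grad f x)) \<partial>lebesgue_on U) + ennreal \<eta>) (at_right 0)"
proof -
  have gc: "continuous_on UNIV (grad f)" using f by (rule continuous_on_grad)
  have Ub: "U \<in> sets borel" using U(1) by simp
  define m where "m = measure (lebesgue_on U) U"
  have m0: "m \<ge> 0" by (simp add: m_def)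
  have m: "emeasure (lebesgue_on U) U = ennreal m"
    using emeasure_lebesgue_on_bounded(1)[OF U] by (simp add: m_def emeasure_eq_ennreal_measure)
  obtain Bf where Bf: "Bf > 0" "\<And>x. x \<in> U \<Longrightarrow> norm (f x) \<le> Bf"
    using continuous_bounded_on_closure[OF C1_fun_continuous[OF f] U(2)] by metis
  obtain Bg where Bg: "Bg > 0" "\<And>x. x \<in> U \<Longrightarrow> norm (grad f x) \<le> Bg"
    using continuous_bounded_on_closure[OF gc U(2)] by metis
  let ?G = "\<integral>\<^sup>+x. ennreal (norm (grad f x)) \<partial>lebesgue_on U"
  have "?G \<le> (\<integral>\<^sup>+x. ennreal Bg \<partial>lebesgue_on U)"
    using Bg(2) by (intro nn_integral_mono ennreal_leI) auto
  also have "\<dots> < \<infinity>" by (simp add: m ennreal_mult_less_top)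
  finally obtain g where g: "?G = ennreal g" "g \<ge> 0" by (cases ?G) auto
  \<comment> \<open>This is the limit, as \<epsilon> tends to 0, of the bound for the energies,
    viewed as a function of \<open>t\<close>. At t = 0 it is g, so some positive t brings it below g
    + \<eta>; t is fixed before \<epsilon>.\<close>
  have "((\<lambda>t. (1 + (1 / (1 - t))\<^sup>2) / 2 * (g + 4 * t * m + t)) \<longlongrightarrow> (1 + (1 / (1 - 0))\<^sup>2) / 2 * (g + 4 * 0 * m + 0)) (at_right 0)"
    by (intro tendsto_intros) auto
  then have "eventually (\<lambda>t. (1 + (1 / (1 - t))\<^sup>2) / 2 * (g + 4 * t * m + t) < g + \<eta>) (at_right 0)"
    by (rule order_tendstoD(2)) (use \<eta> in simp)
  moreover have "eventually (\<lambda>t::real. t \<in> {0<..<1/2}) (at_right 0)"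
    by (rule eventually_at_right_real) simp
  ultimately have "eventually (\<lambda>t. (1 + (1 / (1 - t))\<^sup>2) / 2 * (g + 4 * t * m + t) < g + \<eta> \<and> t \<in> {0<..<1/2}) (at_right 0)"
    by (rule eventually_conj)
  then obtain t where t: "(1 + (1 / (1 - t))\<^sup>2) / 2 * (g + 4 * t * m + t) < g + \<eta>" "0 < t" "t < 1/2"
    using eventually_happens'[OF trivial_limit_at_right_real] by fastforce
  define c where "c = 1 / (1 - t)"
  have c: "c > 0" using t by (simp add: c_def)
  have "compact (closure U)" "continuous_on (closure U) (\<lambda>x. norm (grad f x) + 2 * t)"
    using U(2) by (auto intro!: continuous_intros continuous_on_subset[OF gc])
  \<comment> \<open>The offset 2 t with tolerance t places p between |grad f| + t and |grad f| + 3
    t, so p is a positive majorant; the square root in \<open>s\<close> adds at most one more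
    t.\<close>
  then obtain p where p: "real_polynomial_function p" "\<And>x. x \<in> closure U \<Longrightarrow> \<bar>norm (grad f x) + 2 * t - p x\<bar> < t"
    using Stone_Weierstrass_real_polynomial_function t(2) by metis
  have pC: "C1_fun p" using p(1) by (rule C1_fun_real_polynomial)
  define s where "s x = sqrt (t\<^sup>2 + (p x)\<^sup>2)" for x
  define r where "r x = 1 / s x" for x
  have spos: "s x > 0" for x using t(2) by (simp add: s_def add_pos_nonneg)
  have rpos: "r x > 0" for x using spos by (simp add: r_def)
  have rC: "C1_fun r" unfolding r_def[abs_def] s_def using t(2) pC by (rule C1_fun_inverse_hypotenuse)
  have sc: "continuous_on UNIV s"
    unfolding s_def[abs_def] by (intro continuous_intros C1_fun_continuous pC)
  have sU: "norm (grad f x) \<le> s x" "s x \<le> norm (grad f x) + 4 * t" if "x \<in> U" for x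
  proof -
    have "x \<in> closure U" using that closure_subset[of U] by (rule subsetD[rotated])
    from p(2)[OF this] have px: "norm (grad f x) \<le> p x" "p x \<le> norm (grad f x) + 3 * t" by (auto simp: abs_if split: if_splits)
    have p0: "0 \<le> p x" using px(1) norm_ge_zero by (rule order_trans[rotated])
    have "p x \<le> s x" unfolding s_def by (rule real_le_rsqrt) simp
    then show "norm (grad f x) \<le> s x" using px(1) by simp
    have "s x \<le> t + p x" unfolding s_def using t(2) p0 by (intro real_le_lsqrt) (auto simp: power2_sum)
    then show "s x \<le> norm (grad f x) + 4 * t" using px(2) by simp
  qed
  obtain S where S: "S > 0" "\<And>x. x \<in> U \<Longrightarrow> norm (s x) \<le> S"
    using continuous_bounded_on_closure[OF sc U(2)] by metis
  \<comment> \<open>As r = 1 / s, a bound for s |grad r| is the condition |grad r| <= K r of the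
    staircase.\<close>
  obtain K where K: "K > 0" "\<And>x. x \<in> U \<Longrightarrow> norm (s x * norm (grad r x)) \<le> K"
    using continuous_bounded_on_closure[OF continuous_on_mult[OF sc continuous_on_norm[OF continuous_on_grad[OF rC]]] U(2)] by metis
  have "((\<lambda>\<epsilon>. \<epsilon> / 2 * phi \<epsilon> (c * (2 / \<epsilon> + \<epsilon> * K)) * (g + 4 * t * m + t)) \<longlongrightarrow> (1 + c\<^sup>2) / 2 * (g + 4 * t * m + t)) (at_right 0)"
    using c K(1) by (intro tendsto_mult_right phi_transition_cost) auto
  then have "eventually (\<lambda>\<epsilon>. \<epsilon> / 2 * phi \<epsilon> (c * (2 / \<epsilon> + \<epsilon> * K)) * (g + 4 * t * m + t) < g + \<eta>) (at_right 0)"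
    by (rule order_tendstoD(2)) (use t(1) in \<open>simp add: c_def\<close>)
  \<comment> \<open>Below 2 / S every riser fits into its step, that is \<epsilon> / (2 r x) <=
    1.\<close>
  moreover have "eventually (\<lambda>\<epsilon>::real. \<epsilon> \<in> {0<..<2 / S}) (at_right 0)"
    by (rule eventually_at_right_real) (use S(1) in simp)
  ultimately show ?thesis
  proof eventually_elim
    case (elim \<epsilon>)
    then have e: "0 < \<epsilon>" "\<epsilon> * S < 2" using S(1) by (auto simp: field_simps)
    have half: "\<epsilon> / (2 * r x) = \<epsilon> / 2 * s x" for x using spos[of x] by (simp add: r_def)
    have lam: "\<epsilon> / (2 * r x) \<le> 1" if "x \<in> U" for x
    proof -
      have "\<epsilon> * s x \<le> \<epsilon> * S" using S(2)[OF that] e by (intro mult_left_mono) auto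
      then have "\<epsilon> * s x < 2" using e(2) by (rule order_le_less_trans)
      then show ?thesis unfolding half by simp
    qed
    let ?S = "\<lambda>x \<tau>. 0 < frac (f x / \<epsilon> + \<tau>) \<and> frac (f x / \<epsilon> + \<tau>) < \<epsilon> / (2 * r x)"
    have fm [measurable]: "f \<in> borel_measurable borel" by (rule borel_measurable_continuous_onI[OF C1_fun_continuous[OF f]])
    have rm [measurable]: "r \<in> borel_measurable borel" by (rule borel_measurable_continuous_onI[OF C1_fun_continuous[OF rC]])
    have sm [measurable]: "s \<in> borel_measurable borel" by (rule borel_measurable_continuous_onI[OF sc])
    have gm [measurable]: "grad f \<in> borel_measurable borel" by (rule borel_measurable_continuous_onI[OF gc])
    have Sm: "{(x, \<tau>). ?S x \<tau>} \<in> sets (borel \<Otimes>\<^sub>M borel)"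
    proof -
      have "{z \<in> space (borel \<Otimes>\<^sub>M borel). ?S (fst z) (snd z)} \<in> sets (borel \<Otimes>\<^sub>M borel)"
        unfolding frac_def by measurable
      moreover have "{z \<in> space (borel \<Otimes>\<^sub>M borel). ?S (fst z) (snd z)} = {(x, \<tau>). ?S x \<tau>}"
        by (auto simp: space_pair_measure)
      ultimately show ?thesis by simp
    qed
    have sl: "emeasure lborel {\<tau>\<in>{0..1}. ?S x \<tau>} \<le> ennreal (\<epsilon> / 2 * s x)" if "x \<in> U" for x
    proof -
      have "0 \<le> \<epsilon> / 2 * s x" using e(1) spos[of x] by (intro mult_nonneg_nonneg) auto
      then show ?thesis using lam[OF that] unfolding half by (rule emeasure_frac_shift_le)
    qed
    have Lle: "(\<integral>\<^sup>+x. ennreal (\<epsilon> / 2 * s x) * indicator U x \<partial>lborel) \<le> ennreal (\<epsilon> / 2 * (g + 4 * t * m))"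
    proof -
      have "(\<integral>\<^sup>+x. ennreal (\<epsilon> / 2 * s x) * indicator U x \<partial>lborel) = (\<integral>\<^sup>+x. ennreal (\<epsilon> / 2 * s x) \<partial>lebesgue_on U)"
        by (rule nn_integral_lebesgue_on_eq_lborel[OF Ub, symmetric]) measurable
      also have "\<dots> \<le> (\<integral>\<^sup>+x. ennreal (\<epsilon> / 2) * (ennreal (norm (grad f x)) + ennreal (4 * t)) \<partial>lebesgue_on U)"
      proof (rule nn_integral_mono)
        fix x assume "x \<in> space (lebesgue_on U)"
        then have "\<epsilon> / 2 * s x \<le> \<epsilon> / 2 * (norm (grad f x) + 4 * t)"
          using sU(2)[of x] e by (intro mult_left_mono) auto
        then have "ennreal (\<epsilon> / 2 * s x) \<le> ennreal (\<epsilon> / 2 * (norm (grad f x) + 4 * t))" by (rule ennreal_leI)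
        also have "\<dots> = ennreal (\<epsilon> / 2) * (ennreal (norm (grad f x)) + ennreal (4 * t))"
        proof -
          have "ennreal (\<epsilon> / 2 * (norm (grad f x) + 4 * t)) = ennreal (\<epsilon> / 2) * ennreal (norm (grad f x) + 4 * t)"
            using e t by (intro ennreal_mult) auto
          also have "ennreal (norm (grad f x) + 4 * t) = ennreal (norm (grad f x)) + ennreal (4 * t)"
            using t by (intro ennreal_plus) auto
          finally show ?thesis .
        qed
        finally show "ennreal (\<epsilon> / 2 * s x) \<le> ennreal (\<epsilon> / 2) * (ennreal (norm (grad f x)) + ennreal (4 * t))" .
      qed
      also have "\<dots> = ennreal (\<epsilon> / 2) * (?G + ennreal (4 * t) * ennreal m)"
      proof -
        have "(\<lambda>x. ennreal (norm (grad f x))) \<in> borel_measurable (lebesgue_on U)"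
          by (intro measurable_restrict_space1 measurable_completion) measurable
        then show ?thesis by (simp add: nn_integral_cmult nn_integral_add m)
      qed
      also have "\<dots> = ennreal (\<epsilon> / 2 * (g + 4 * t * m))"
        using e g t m0 by (simp add: ennreal_mult[symmetric] ennreal_plus[symmetric] del: ennreal_plus)
      finally show ?thesis .
    qed
    have Lfin: "(\<integral>\<^sup>+x. ennreal (\<epsilon> / 2 * s x) * indicator U x \<partial>lborel) < \<infinity>"
      using Lle by (rule order_le_less_trans) simp
    have lm: "(\<lambda>x. ennreal (\<epsilon> / 2 * s x)) \<in> borel_measurable borel" by measurable
    have et: "\<epsilon> / 2 * t > 0" using e t by simp
    \<comment> \<open>The mean measure of the risers is at most the integral of \<epsilon> s / 2;
      the slack is given the same order \<epsilon>, so that it survives the multiplication by the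
      large integrand only as \<open>t\<close>.\<close>
    obtain \<tau> where \<tau>: "\<tau> \<in> {0..1}" "(\<integral>\<^sup>+x. indicator {x. ?S x \<tau>} x * indicator U x \<partial>lborel) < (\<integral>\<^sup>+x. ennreal (\<epsilon> / 2 * s x) * indicator U x \<partial>lborel) + ennreal (\<epsilon> / 2 * t)"
      by (rule exists_small_section[OF Ub Sm sl lm Lfin et])
    have slope: "r x * norm (grad f x) \<le> 1" if "x \<in> U" for x
      using sU(1)[OF that] spos[of x] by (simp add: r_def)
    have Kr: "norm (grad r x) \<le> K * r x" if "x \<in> U" for x
      using K(2)[OF that] spos[of x] by (simp add: r_def field_simps abs_mult)
    have Bf': "\<bar>f x\<bar> \<le> Bf" if "x \<in> U" for x using Bf(2)[OF that] by simp
    have th: "t \<le> 1/2" using t by simp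
    obtain v where v: "C1_fun v" "\<And>x. x \<in> U \<Longrightarrow> \<bar>v x - f x\<bar> \<le> 2 * \<epsilon>"
        "\<And>x. x \<in> U \<Longrightarrow> \<not> ?S x \<tau> \<Longrightarrow> grad v x = 0" "\<And>x. x \<in> U \<Longrightarrow> norm (grad v x) \<le> 1 / (1 - t) * (2 / \<epsilon> + \<epsilon> * K)"
      using staircase[OF f rC rpos t(2) th e(1) \<tau>(1) Bf' lam slope Kr] by metis
    let ?P = "phi \<epsilon> (c * (2 / \<epsilon> + \<epsilon> * K))"
    have P0: "0 \<le> ?P" by (rule phi_nonneg[OF e(1)])
    have Sm1: "{x. ?S x \<tau>} \<in> sets borel"
      unfolding frac_def by measurable
    have "(\<integral>\<^sup>+x. ennreal (phi \<epsilon> (norm (grad v x))) \<partial>lebesgue_on U) \<le> (\<integral>\<^sup>+x. ennreal ?P * indicator {x. ?S x \<tau>} x \<partial>lebesgue_on U)"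
    proof (rule nn_integral_mono)
      fix x assume "x \<in> space (lebesgue_on U)"
      then have x: "x \<in> U" by simp
      show "ennreal (phi \<epsilon> (norm (grad v x))) \<le> ennreal ?P * indicator {x. ?S x \<tau>} x"
      proof (cases "?S x \<tau>")
        case True
        have "phi \<epsilon> (norm (grad v x)) \<le> ?P"
          using v(4)[OF x] unfolding c_def by (intro phi_mono e(1)) auto
        then show ?thesis using True by (simp add: ennreal_leI)
      next
        case False
        then show ?thesis using v(3)[OF x] by (simp add: phi_0)
      qed
    qed
    also have "\<dots> = ennreal ?P * (\<integral>\<^sup>+x. indicator {x. ?S x \<tau>} x * indicator U x \<partial>lborel)"
      using Sm1 Ub by (subst nn_integral_lebesgue_on_eq_lborel[OF Ub]) (auto simp: mult.assoc nn_integral_cmult)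
    also have "\<dots> \<le> ennreal ?P * (ennreal (\<epsilon> / 2 * (g + 4 * t * m)) + ennreal (\<epsilon> / 2 * t))"
      using \<tau>(2) Lle by (intro mult_left_mono) (auto intro: order_trans[OF less_imp_le add_right_mono])
    also have "\<dots> = ennreal (\<epsilon> / 2 * ?P * (g + 4 * t * m + t))"
    proof -
      have "ennreal ?P * (ennreal (\<epsilon> / 2 * (g + 4 * t * m)) + ennreal (\<epsilon> / 2 * t)) = ennreal (?P * (\<epsilon> / 2 * (g + 4 * t * m) + \<epsilon> / 2 * t))"
        using P0 e g(2) t m0 by (simp add: ennreal_mult[symmetric] ennreal_plus[symmetric] del: ennreal_plus)
      also have "?P * (\<epsilon> / 2 * (g + 4 * t * m) + \<epsilon> / 2 * t) = \<epsilon> / 2 * ?P * (g + 4 * t * m + t)" by (simp add: algebra_simps)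
      finally show ?thesis .
    qed
    also have "\<dots> \<le> ennreal (g + \<eta>)" using elim(1) by (intro ennreal_leI) simp
    also have "\<dots> = ?G + ennreal \<eta>" using g \<eta> by (simp add: ennreal_plus)
    finally show ?case using v(1,2) by (intro exI[of _ v]) auto
  qed
qed

section \<open>Extension of functions of bounded variation\<close>

lemma Lp_norm_1: "Lp_norm 1 M u = (\<integral>\<^sup>+x. ennreal (norm (u x)) \<partial>M)"
proof (cases "(\<integral>\<^sup>+x. ennreal (norm (u x)) \<partial>M)")
  case (real r)
  then show ?thesis by (simp add: Lp_norm_def)
next
  case top
  then show ?thesis by (simp add: Lp_norm_def)
qed

lemma TV_cong_AE:
  fixes u w :: "real^'n \<Rightarrow> real"
  assumes U: "open U" and u: "u \<in> borel_measurable (lebesgue_on U)" and w: "w \<in> borel_measurable (lebesgue_on U)"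
    and eq: "AE x in lebesgue_on U. u x = w x"
  shows "TV U u = TV U w"
proof -
  have "(\<integral>x. u x * divergence \<phi> x \<partial>lebesgue_on U) = (\<integral>x. w x * divergence \<phi> x \<partial>lebesgue_on U)" if "\<phi> \<in> C1c U" for \<phi>
  proof (rule integral_cong_AE)
    have "divergence \<phi> \<in> borel_measurable borel"
      by (rule borel_measurable_continuous_onI[OF continuous_on_divergence[OF C1cD[OF that]]])
    then have "divergence \<phi> \<in> borel_measurable (lebesgue_on U)"
      by (intro measurable_restrict_space1 measurable_completion) simp
    then show "(\<lambda>x. u x * divergence \<phi> x) \<in> borel_measurable (lebesgue_on U)"
      "(\<lambda>x. w x * divergence \<phi> x) \<in> borel_measurable (lebesgue_on U)"
      using u w by (auto intro: borel_measurable_times)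
    show "AE x in lebesgue_on U. u x * divergence \<phi> x = w x * divergence \<phi> x"
      using eq by eventually_elim simp
  qed
  then show ?thesis unfolding TV_def by (intro SUP_cong) auto
qed

lemma TV_le_variation_1: "TV U (u 0) \<le> variation 1 U u"
  unfolding TV_def
proof (rule SUP_least)
  fix \<phi> :: "real^'a \<Rightarrow> real^'a" assume "\<phi> \<in> {\<phi> \<in> C1c U. \<forall>x. norm (\<phi> x) \<le> 1}"
  then show "ennreal (\<integral>x. u 0 x * divergence \<phi> x \<partial>lebesgue_on U) \<le> variation 1 U u"
    unfolding variation_def by (intro SUP_upper2[of "\<lambda>_. \<phi>"]) (auto simp: power_le_one)
qed

text \<open>The operator is taken with m = 1 and A = UNIV, and its value is replaced by a Borel
  representative, because the convolution calculus works over \<open>lborel\<close>. A zero of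
  \<open>variation_measure\<close>, an infimum over open neighbourhoods, means that some
  neighbourhoods of the boundary carry arbitrarily small variation.\<close>

lemma extension_BV:
  fixes \<Omega> :: "(real^'n) set"
  assumes \<Omega>: "extension_domain \<Omega>"
  obtains C :: real where "C \<ge> 0"
    "\<forall>u\<in>BV \<Omega>. \<exists>w. integrable lborel w \<and> (AE x in lebesgue_on \<Omega>. w x = u x) \<and>
      TV UNIV w \<le> ennreal C * BV_norm \<Omega> u \<and> (\<integral>\<^sup>+x. ennreal \<bar>w x\<bar> \<partial>lborel) \<le> ennreal C * BV_norm \<Omega> u \<and>
      (\<forall>\<eta>>0. \<exists>A. open A \<and> frontier \<Omega> \<subseteq> A \<and> TV A w \<le> ennreal \<eta>)"
proof -
  have op: "open \<Omega>" using \<Omega> by (simp add: extension_domain_def)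
  have "\<exists>T. bounded_linear_BV 1 \<Omega> T \<and>
      (\<forall>u\<in>prod_space 1 (BV \<Omega>). \<forall>j<1. AE x in lebesgue. x \<in> \<Omega> \<longrightarrow> T u j x = u j x) \<and>
      (\<forall>u\<in>prod_space 1 (BV \<Omega>). variation_measure 1 (T u) (frontier \<Omega>) = 0)"
    using conjunct2[OF conjunct2[OF \<Omega>[unfolded extension_domain_def]], THEN spec, of UNIV, THEN spec, of 1]
    by (simp only: open_UNIV subset_UNIV order_refl simp_thms) blast
  then obtain T where T: "bounded_linear_BV 1 \<Omega> T"
    "\<And>u j. u \<in> prod_space 1 (BV \<Omega>) \<Longrightarrow> j < 1 \<Longrightarrow> AE x in lebesgue. x \<in> \<Omega> \<longrightarrow> T u j x = u j x"
    "\<And>u. u \<in> prod_space 1 (BV \<Omega>) \<Longrightarrow> variation_measure 1 (T u) (frontier \<Omega>) = 0"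
    by blast
  obtain C' :: real where C': "\<And>u. u \<in> prod_space 1 (BV \<Omega>) \<Longrightarrow> prod_norm 1 (BV_norm UNIV) (T u) \<le> ennreal C' * prod_norm 1 (BV_norm \<Omega>) u"
    using T(1) unfolding bounded_linear_BV_def by blast
  show ?thesis
  \<comment> \<open>The operator bound may come with a negative constant, which
    \<open>ennreal\<close> reads as 0.\<close>
  proof (rule that[of "max C' 0"], simp, rule ballI)
    fix u assume u: "u \<in> BV \<Omega>"
    let ?u = "\<lambda>_::nat. u"
    have pu: "?u \<in> prod_space 1 (BV \<Omega>)" using u by (simp add: prod_space_def)
    define w0 where "w0 = T ?u 0"
    have w0: "w0 \<in> BV UNIV"
      using T(1) pu unfolding bounded_linear_BV_def prod_space_def w0_def by auto
    have w0m: "w0 \<in> borel_measurable lebesgue" and w0i: "(\<integral>\<^sup>+x. ennreal \<bar>w0 x\<bar> \<partial>lebesgue) < \<infinity>"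
      using w0 by (simp_all add: BV_def Lp_def Lp_norm_1 lebesgue_on_UNIV_eq)
    obtain w where w: "w \<in> borel_measurable lborel" "AE x in lborel. w0 x = w x"
      using completion_ex_borel_measurable_real[OF w0m] by blast
    have weq: "AE x in lebesgue. w0 x = w x" using w(2) by (rule AE_completion)
    have wm: "w \<in> borel_measurable borel" using w(1) by simp
    have wml: "w \<in> borel_measurable lebesgue" using w(1) by (rule measurable_completion)
    have TVeq: "TV U w = TV U w0" if "open U" for U
    proof (rule TV_cong_AE[OF that])
      show "w \<in> borel_measurable (lebesgue_on U)" "w0 \<in> borel_measurable (lebesgue_on U)"
        using wml w0m by (auto intro: measurable_restrict_space1)
      have "AE x in lebesgue. w x = w0 x" using weq by eventually_elim simp
      then show "AE x in lebesgue_on U. w x = w0 x"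
        using that by (subst AE_restrict_space_iff) (auto elim: eventually_mono)
    qed
    have wnorm: "(\<integral>\<^sup>+x. ennreal \<bar>w x\<bar> \<partial>lborel) = (\<integral>\<^sup>+x. ennreal \<bar>w0 x\<bar> \<partial>lebesgue)"
    proof -
      have "(\<integral>\<^sup>+x. ennreal \<bar>w x\<bar> \<partial>lborel) = (\<integral>\<^sup>+x. ennreal \<bar>w x\<bar> \<partial>lebesgue)"
        using wm by (intro nn_integral_completion[symmetric]) measurable
      also have "\<dots> = (\<integral>\<^sup>+x. ennreal \<bar>w0 x\<bar> \<partial>lebesgue)"
        using weq by (intro nn_integral_cong_AE) (auto elim: eventually_mono)
      finally show ?thesis .
    qed
    have wi: "integrable lborel w"
      using w(1) w0i wnorm by (intro integrableI_bounded) auto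
    have BVn: "BV_norm UNIV w0 \<le> ennreal (max C' 0) * BV_norm \<Omega> u"
    proof -
      have "BV_norm UNIV w0 \<le> ennreal C' * BV_norm \<Omega> u"
        using C'[OF pu] by (simp add: prod_norm_def w0_def)
      also have "\<dots> \<le> ennreal (max C' 0) * BV_norm \<Omega> u" by (intro mult_right_mono ennreal_leI) auto
      finally show ?thesis .
    qed
    have Bw: "BV_norm UNIV w0 = (\<integral>\<^sup>+x. ennreal \<bar>w x\<bar> \<partial>lborel) + TV UNIV w"
      by (simp add: BV_norm_def Lp_norm_1 lebesgue_on_UNIV_eq wnorm TVeq)
    have ae: "AE x in lebesgue_on \<Omega>. w x = u x"
    proof -
      have "AE x in lebesgue. x \<in> \<Omega> \<longrightarrow> w0 x = u x" using T(2)[OF pu, of 0] by (simp add: w0_def)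
      then have "AE x in lebesgue. x \<in> \<Omega> \<longrightarrow> w x = u x" using weq by eventually_elim auto
      then show ?thesis using op by (subst AE_restrict_space_iff) auto
    qed
    have small: "\<exists>A. open A \<and> frontier \<Omega> \<subseteq> A \<and> TV A w \<le> ennreal \<eta>" if "\<eta> > 0" for \<eta>
    proof -
      have "(INF A\<in>{A. open A \<and> frontier \<Omega> \<subseteq> A}. variation 1 A (T ?u)) < ennreal \<eta>"
        using T(3)[OF pu] that by (simp add: variation_measure_def)
      then obtain A where A: "open A" "frontier \<Omega> \<subseteq> A" "variation 1 A (T ?u) < ennreal \<eta>"
        unfolding INF_less_iff by auto
      have "TV A w \<le> ennreal \<eta>"
        using TV_le_variation_1[of A "T ?u"] A(3) by (simp add: TVeq[OF A(1)] w0_def)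
      then show ?thesis using A by blast
    qed
    show "\<exists>w. integrable lborel w \<and> (AE x in lebesgue_on \<Omega>. w x = u x) \<and>
      TV UNIV w \<le> ennreal (max C' 0) * BV_norm \<Omega> u \<and> (\<integral>\<^sup>+x. ennreal \<bar>w x\<bar> \<partial>lborel) \<le> ennreal (max C' 0) * BV_norm \<Omega> u \<and>
      (\<forall>\<eta>>0. \<exists>A. open A \<and> frontier \<Omega> \<subseteq> A \<and> TV A w \<le> ennreal \<eta>)"
    proof (intro exI[of _ w] conjI wi ae)
      show "TV UNIV w \<le> ennreal (max C' 0) * BV_norm \<Omega> u"
        using BVn unfolding Bw by (rule order_trans[rotated]) simp
      show "(\<integral>\<^sup>+x. ennreal \<bar>w x\<bar> \<partial>lborel) \<le> ennreal (max C' 0) * BV_norm \<Omega> u"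
        using BVn unfolding Bw by (rule order_trans[rotated]) simp
      show "\<forall>\<eta>>0. \<exists>A. open A \<and> frontier \<Omega> \<subseteq> A \<and> TV A w \<le> ennreal \<eta>" using small by blast
    qed
  qed
qed

text \<open>Cauchy-Schwarz against the constant function 1.\<close>

lemma nn_integral_abs_le_L2:
  fixes h :: "'a \<Rightarrow> real"
  assumes [measurable]: "h \<in> borel_measurable M" and m: "emeasure M (space M) = ennreal m" "m \<ge> 0"
  shows "(\<integral>\<^sup>+x. ennreal \<bar>h x\<bar> \<partial>M) \<le> Lp_norm 2 M h * ennreal (sqrt m)"
proof -
  have "(\<integral>\<^sup>+x. ennreal \<bar>h x\<bar> * 1 \<partial>M)\<^sup>2 \<le> (\<integral>\<^sup>+x. (ennreal \<bar>h x\<bar>)\<^sup>2 \<partial>M) * (\<integral>\<^sup>+x. 1\<^sup>2 \<partial>M)"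
    by (rule Cauchy_Schwarz_nn_integral) measurable
  also have "\<dots> = (Lp_norm 2 M h)\<^sup>2 * (ennreal (sqrt m))\<^sup>2"
    using m by (simp add: Lp_norm_2_power2 sq_integral_def ennreal_power)
  finally have "(\<integral>\<^sup>+x. ennreal \<bar>h x\<bar> \<partial>M)\<^sup>2 \<le> (Lp_norm 2 M h * ennreal (sqrt m))\<^sup>2"
    by (simp add: power_mult_distrib)
  then show ?thesis by (simp only: ennreal_power2_le_iff)
qed

lemma emeasure_lebesgue_on_eq_ennreal:
  fixes U :: "(real^'n) set"
  assumes "open U" "bounded U"
  shows "emeasure (lebesgue_on U) (space (lebesgue_on U)) = ennreal (measure (lebesgue_on U) U)"
  using emeasure_lebesgue_on_bounded(1)[OF assms] by (simp add: emeasure_eq_ennreal_measure)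

lemma L2_imp_L1:
  fixes \<Omega> :: "(real^'n) set"
  assumes "open \<Omega>" "bounded \<Omega>" "u \<in> L2 \<Omega>"
  shows "u \<in> Lp 1 (lebesgue_on \<Omega>)" "integrable (lebesgue_on \<Omega>) u"
proof -
  have m: "u \<in> borel_measurable (lebesgue_on \<Omega>)" using assms(3) by (simp add: Lp_def)
  have "(\<integral>\<^sup>+x. ennreal \<bar>u x\<bar> \<partial>lebesgue_on \<Omega>) \<le> Lp_norm 2 (lebesgue_on \<Omega>) u * ennreal (sqrt (measure (lebesgue_on \<Omega>) \<Omega>))"
    by (rule nn_integral_abs_le_L2[OF m emeasure_lebesgue_on_eq_ennreal[OF assms(1,2)]]) simp
  also have "\<dots> < \<infinity>" using assms(3) by (simp add: Lp_def ennreal_mult_less_top)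
  finally have fin: "(\<integral>\<^sup>+x. ennreal \<bar>u x\<bar> \<partial>lebesgue_on \<Omega>) < \<infinity>" .
  then show "u \<in> Lp 1 (lebesgue_on \<Omega>)" using m by (simp add: Lp_def Lp_norm_1)
  show "integrable (lebesgue_on \<Omega>) u" using m fin by (intro integrableI_bounded) auto
qed

section \<open>The \<open>\<Gamma>\<close>-limit\<close>

text \<open>\<open>u\<close> is extended to \<open>w\<close>, \<open>w\<close> is approximated by a
  C1 function \<open>f\<close>, and \<open>f\<close> by a staircase \<open>v\<close>. As
  \<open>u\<close> and \<open>w\<close> agree almost everywhere on the domain, only the last two
  passages cost anything.\<close>

lemma approximate_recovery:
  fixes \<Omega> :: "(real^'n) set"
  assumes bd: "bounded \<Omega>" and ext: "extension_domain \<Omega>" and u: "u \<in> L2 \<Omega>" and TV: "TV \<Omega> u < \<infinity>" and \<eta>: "\<eta> > 0"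
  shows "eventually (\<lambda>\<epsilon>. \<exists>v. v \<in> L2 \<Omega> \<and> Lp_norm 2 (lebesgue_on \<Omega>) (\<lambda>x. v x - u x) < ennreal \<eta> \<and>
    energy \<Omega> (phi \<epsilon>) v \<le> TV \<Omega> u + ennreal \<eta>) (at_right 0)"
proof -
  let ?M = "lebesgue_on \<Omega>"
  have op: "open \<Omega>" using ext by (simp add: extension_domain_def)
  have um: "u \<in> borel_measurable ?M" using u by (simp add: Lp_def)
  have uBV: "u \<in> BV \<Omega>" using L2_imp_L1[OF op bd u] TV by (simp add: BV_def)
  obtain C where C: "C \<ge> 0" "\<forall>u\<in>BV \<Omega>. \<exists>w. integrable lborel w \<and> (AE x in lebesgue_on \<Omega>. w x = u x) \<and>
      TV UNIV w \<le> ennreal C * BV_norm \<Omega> u \<and> (\<integral>\<^sup>+x. ennreal \<bar>w x\<bar> \<partial>lborel) \<le> ennreal C * BV_norm \<Omega> u \<and>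
      (\<forall>\<eta>>0. \<exists>A. open A \<and> frontier \<Omega> \<subseteq> A \<and> TV A w \<le> ennreal \<eta>)"
    by (rule extension_BV[OF ext])
  obtain w where w: "integrable lborel w" "AE x in ?M. w x = u x" "TV UNIV w \<le> ennreal C * BV_norm \<Omega> u"
      "\<And>\<eta>. \<eta> > 0 \<Longrightarrow> \<exists>A. open A \<and> frontier \<Omega> \<subseteq> A \<and> TV A w \<le> ennreal \<eta>"
    using bspec[OF C(2) uBV] by blast
  have wm: "w \<in> borel_measurable ?M"
    using w(1) by (intro measurable_restrict_space1 measurable_completion) auto
  have TVw: "TV UNIV w < \<infinity>"
  proof -
    have "BV_norm \<Omega> u < \<infinity>" using uBV by (simp add: BV_norm_def BV_def Lp_def)
    then have "ennreal C * BV_norm \<Omega> u < \<infinity>" by (simp add: ennreal_mult_less_top)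
    then show ?thesis using w(3) by (rule order_le_less_trans[rotated])
  qed
  have TVeq: "TV \<Omega> w = TV \<Omega> u" by (rule TV_cong_AE[OF op wm um w(2)])
  have w2: "(\<integral>\<^sup>+x. ennreal ((w x)\<^sup>2) \<partial>?M) < \<infinity>"
  proof -
    have "(\<integral>\<^sup>+x. ennreal ((w x)\<^sup>2) \<partial>?M) = sq_integral ?M u"
      unfolding sq_integral_def using w(2) by (intro nn_integral_cong_AE) (auto elim: eventually_mono)
    then show ?thesis using u by (simp add: Lp_2_iff)
  qed
  define m where "m = measure ?M \<Omega>"
  have m0: "m \<ge> 0" by (simp add: m_def)
  have m: "emeasure ?M (space ?M) = ennreal m" unfolding m_def by (rule emeasure_lebesgue_on_eq_ennreal[OF op bd])
  \<comment> \<open>Each of the two approximations spends \<theta> of the energy margin \<eta>. In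
    the squared distance \<eta>^2 the passage to \<open>f\<close> takes 2 \<theta>, less than one
    half, and the staircase the other half.\<close>
  define \<theta> where "\<theta> = min (\<eta> / 2) (\<eta>\<^sup>2 / 8)"
  have \<theta>: "\<theta> > 0" "2 * \<theta> \<le> \<eta>" "2 * \<theta> < \<eta>\<^sup>2 / 2"
    using \<eta> by (auto simp: \<theta>_def min_def field_simps)
  obtain f where f: "C1_fun f" "(\<integral>\<^sup>+x. ennreal ((f x - w x)\<^sup>2) \<partial>?M) \<le> ennreal \<theta>"
      "(\<integral>\<^sup>+x. ennreal (norm (grad f x)) \<partial>?M) \<le> TV \<Omega> w + ennreal \<theta>"
    by (rule C1_approximation_L2_TV[OF op bd w(1) TVw w2 w(4) \<theta>(1)])
  have fm: "f \<in> borel_measurable ?M"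
    using borel_measurable_continuous_onI[OF C1_fun_continuous[OF f(1)]]
    by (intro measurable_restrict_space1 measurable_completion) simp
  have "((\<lambda>\<epsilon>::real. 2 * (2 * \<epsilon>)\<^sup>2 * m) \<longlongrightarrow> 2 * (2 * 0)\<^sup>2 * m) (at_right 0)"
    by (intro tendsto_intros)
  then have "eventually (\<lambda>\<epsilon>::real. 2 * (2 * \<epsilon>)\<^sup>2 * m < \<eta>\<^sup>2 / 2) (at_right 0)"
    by (rule order_tendstoD(2)) (use \<eta> in simp)
  moreover have "eventually (\<lambda>\<epsilon>::real. \<epsilon> > 0) (at_right 0)" by (rule eventually_at_right_less)
  ultimately show ?thesis using recovery_C1_fun[OF op bd f(1) \<theta>(1)]
  proof eventually_elim
    case (elim \<epsilon>)
    then obtain v where v: "C1_fun v" "\<And>x. x \<in> \<Omega> \<Longrightarrow> \<bar>v x - f x\<bar> \<le> 2 * \<epsilon>"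
        "(\<integral>\<^sup>+x. ennreal (phi \<epsilon> (norm (grad v x))) \<partial>?M) \<le> (\<integral>\<^sup>+x. ennreal (norm (grad f x)) \<partial>?M) + ennreal \<theta>"
      by blast
    have vL: "v \<in> L2 \<Omega>" by (rule continuous_in_Lp_2[OF op bd C1_fun_continuous[OF v(1)]])
    have "energy \<Omega> (phi \<epsilon>) v \<le> (TV \<Omega> u + ennreal \<theta>) + ennreal \<theta>"
      unfolding energy_C1_fun[OF op bd v(1)] using v(3) f(3) unfolding TVeq
      by (meson add_right_mono order_trans)
    also have "\<dots> = TV \<Omega> u + ennreal (2 * \<theta>)" using \<theta>(1) by (simp add: add.assoc ennreal_plus[symmetric] del: ennreal_plus)
    also have "\<dots> \<le> TV \<Omega> u + ennreal \<eta>" using \<theta>(2) by (intro add_left_mono ennreal_leI)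
    finally have E: "energy \<Omega> (phi \<epsilon>) v \<le> TV \<Omega> u + ennreal \<eta>" .
    have "sq_integral ?M (\<lambda>x. v x - u x) = (\<integral>\<^sup>+x. ennreal ((v x - w x)\<^sup>2) \<partial>?M)"
      unfolding sq_integral_def using w(2) by (intro nn_integral_cong_AE) (auto elim: eventually_mono)
    also have "\<dots> \<le> (\<integral>\<^sup>+x. ennreal (2 * (2 * \<epsilon>)\<^sup>2) + 2 * ennreal ((f x - w x)\<^sup>2) \<partial>?M)"
    proof (rule nn_integral_mono)
      fix x assume "x \<in> space ?M"
      then have x: "x \<in> \<Omega>" by simp
      have "(v x - w x)\<^sup>2 = ((v x - f x) + (f x - w x))\<^sup>2" by simp
      also have "\<dots> \<le> 2 * (v x - f x)\<^sup>2 + 2 * (f x - w x)\<^sup>2" by (rule square_sum_le)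
      also have "(v x - f x)\<^sup>2 \<le> (2 * \<epsilon>)\<^sup>2"
        using v(2)[OF x] by (intro power2_le_iff_abs_le[THEN iffD2]) (use elim(2) in auto)
      finally have "(v x - w x)\<^sup>2 \<le> 2 * (2 * \<epsilon>)\<^sup>2 + 2 * (f x - w x)\<^sup>2" by simp
      then have "ennreal ((v x - w x)\<^sup>2) \<le> ennreal (2 * (2 * \<epsilon>)\<^sup>2 + 2 * (f x - w x)\<^sup>2)" by (rule ennreal_leI)
      also have "\<dots> = ennreal (2 * (2 * \<epsilon>)\<^sup>2) + ennreal (2 * (f x - w x)\<^sup>2)" by (rule ennreal_plus) auto
      also have "ennreal (2 * (f x - w x)\<^sup>2) = 2 * ennreal ((f x - w x)\<^sup>2)" by (simp add: ennreal_mult)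
      finally show "ennreal ((v x - w x)\<^sup>2) \<le> ennreal (2 * (2 * \<epsilon>)\<^sup>2) + 2 * ennreal ((f x - w x)\<^sup>2)" .
    qed
    also have "\<dots> = ennreal (2 * (2 * \<epsilon>)\<^sup>2) * ennreal m + 2 * (\<integral>\<^sup>+x. ennreal ((f x - w x)\<^sup>2) \<partial>?M)"
    proof -
      have "(\<lambda>x. ennreal ((f x - w x)\<^sup>2)) \<in> borel_measurable ?M" using fm wm by measurable
      then show ?thesis by (subst nn_integral_add) (auto simp: nn_integral_cmult m[simplified])
    qed
    also have "\<dots> \<le> ennreal (2 * (2 * \<epsilon>)\<^sup>2) * ennreal m + 2 * ennreal \<theta>"
      by (intro add_left_mono mult_left_mono f(2)) simp
    also have "\<dots> = ennreal (2 * (2 * \<epsilon>)\<^sup>2 * m + 2 * \<theta>)"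
    proof -
      have "ennreal (2 * (2 * \<epsilon>)\<^sup>2 * m + 2 * \<theta>) = ennreal (2 * (2 * \<epsilon>)\<^sup>2 * m) + ennreal (2 * \<theta>)"
        using m0 \<theta>(1) by (intro ennreal_plus) auto
      also have "ennreal (2 * (2 * \<epsilon>)\<^sup>2 * m) = ennreal (2 * (2 * \<epsilon>)\<^sup>2) * ennreal m" using m0 by (intro ennreal_mult) auto
      also have "ennreal (2 * \<theta>) = 2 * ennreal \<theta>" using \<theta>(1) by (simp add: ennreal_mult)
      finally show ?thesis ..
    qed
    also have "\<dots> < ennreal (\<eta>\<^sup>2)" using elim(1) \<theta>(3) \<eta> by (intro ennreal_lessI) auto
    finally have "Lp_norm 2 ?M (\<lambda>x. v x - u x) < ennreal \<eta>"
      using \<eta> by (simp add: Lp_norm_2_less_iff)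
    then show ?case using vL E by blast
  qed
qed

text \<open>\<open>N \<epsilon>\<close> is the largest n <= 1 / \<epsilon> for which
  \<open>P n \<epsilon>\<close> holds; the cap keeps the maximum finite and recedes to infinity as
  \<epsilon> tends to 0.\<close>

lemma diagonal_at_right:
  fixes P :: "nat \<Rightarrow> real \<Rightarrow> bool"
  assumes "\<And>n. eventually (P n) (at_right 0)"
  obtains N where "\<And>n. eventually (\<lambda>\<epsilon>. n \<le> N \<epsilon> \<and> P (N \<epsilon>) \<epsilon>) (at_right 0)"
proof
  define N where "N \<epsilon> = Max {n. n \<le> nat \<lfloor>1 / \<epsilon>\<rfloor> \<and> P n \<epsilon>}" for \<epsilon>
  fix n
  have "eventually (\<lambda>\<epsilon>::real. \<epsilon> \<in> {0<..<1 / (real n + 1)}) (at_right 0)"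
    by (rule eventually_at_right_real) simp
  with assms[of n] show "eventually (\<lambda>\<epsilon>. n \<le> N \<epsilon> \<and> P (N \<epsilon>) \<epsilon>) (at_right 0)"
  proof eventually_elim
    case (elim \<epsilon>)
    let ?S = "{n. n \<le> nat \<lfloor>1 / \<epsilon>\<rfloor> \<and> P n \<epsilon>}"
    have "real n \<le> 1 / \<epsilon>" using elim(2) by (auto simp: field_simps)
    then have "n \<le> nat \<lfloor>1 / \<epsilon>\<rfloor>" by (rule le_nat_floor)
    then have "n \<in> ?S" using elim(1) by simp
    moreover have "finite ?S" by simp
    ultimately have "n \<le> Max ?S" "Max ?S \<in> ?S" using Max_ge Max_in by blast+
    then show ?case unfolding N_def by blast
  qed
qed

lemma recovery_sequence:
  fixes \<Omega> :: "(real^'n) set"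
  assumes bd: "bounded \<Omega>" and ext: "extension_domain \<Omega>" and u: "u \<in> L2 \<Omega>"
  obtains v where "\<And>\<epsilon>. v \<epsilon> \<in> L2 \<Omega>" "limitin (L2_topology \<Omega>) v u (at_right 0)"
    "Limsup (at_right 0) (\<lambda>\<epsilon>. energy \<Omega> (phi \<epsilon>) (v \<epsilon>)) \<le> TV \<Omega> u"
proof (cases "TV \<Omega> u = \<infinity>")
  case True
  show ?thesis
  \<comment> \<open>Any family converging to \<open>u\<close> serves here, as the right-hand side is
    infinite.\<close>
  proof (rule that[of "\<lambda>_. u"])
    show "limitin (L2_topology \<Omega>) (\<lambda>_. u) u (at_right 0)" using u by (auto simp: limitin_def)
  qed (use u True in auto)
next
  case False
  then have TV: "TV \<Omega> u < \<infinity>" by (simp add: top.not_eq_extremum)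
  let ?N = "\<lambda>v. Lp_norm 2 (lebesgue_on \<Omega>) (\<lambda>x. v x - u x)"
  define Q where "Q n \<epsilon> v \<longleftrightarrow> v \<in> L2 \<Omega> \<and> ?N v < ennreal (1 / real (Suc n)) \<and> energy \<Omega> (phi \<epsilon>) v \<le> TV \<Omega> u + ennreal (1 / real (Suc n))" for n \<epsilon> v
  have "eventually (\<lambda>\<epsilon>. \<exists>v. Q n \<epsilon> v) (at_right 0)" for n
    unfolding Q_def by (rule approximate_recovery[OF bd ext u TV]) simp
  then obtain N where N: "\<And>n. eventually (\<lambda>\<epsilon>. n \<le> N \<epsilon> \<and> (\<exists>v. Q (N \<epsilon>) \<epsilon> v)) (at_right 0)"
    using diagonal_at_right[of "\<lambda>n \<epsilon>. \<exists>v. Q n \<epsilon> v"] by metis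
  \<comment> \<open>The default \<open>u\<close> applies where no approximant exists. It keeps the
    whole family in \<open>L2\<close>, and for all sufficiently small \<epsilon> it does not
    occur.\<close>
  define v where "v \<epsilon> = (if \<exists>v. Q (N \<epsilon>) \<epsilon> v then SOME v. Q (N \<epsilon>) \<epsilon> v else u)" for \<epsilon>
  have vL: "v \<epsilon> \<in> L2 \<Omega>" for \<epsilon>
  proof (cases "\<exists>v. Q (N \<epsilon>) \<epsilon> v")
    case True
    then have "Q (N \<epsilon>) \<epsilon> (v \<epsilon>)" unfolding v_def by (simp add: someI_ex)
    then show ?thesis by (simp add: Q_def)
  qed (simp add: v_def u)
  have ev: "eventually (\<lambda>\<epsilon>. ?N (v \<epsilon>) < ennreal (1 / real (Suc n)) \<and> energy \<Omega> (phi \<epsilon>) (v \<epsilon>) \<le> TV \<Omega> u + ennreal (1 / real (Suc n))) (at_right 0)" for n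
    using N[of n]
  proof eventually_elim
    case (elim \<epsilon>)
    then have Q: "Q (N \<epsilon>) \<epsilon> (v \<epsilon>)" unfolding v_def by (simp add: someI_ex)
    have "1 / real (Suc (N \<epsilon>)) \<le> 1 / real (Suc n)" using elim by (simp add: field_simps)
    then have le: "ennreal (1 / real (Suc (N \<epsilon>))) \<le> ennreal (1 / real (Suc n))" by (rule ennreal_leI)
    show ?case
      using Q le unfolding Q_def by (auto intro: order_less_le_trans order_trans add_left_mono)
  qed
  have arch: "\<exists>n. 1 / real (Suc n) < e" if "e > 0" for e :: real
    using reals_Archimedean[OF that] by (simp add: inverse_eq_divide)
  show ?thesis
  proof (rule that[OF vL])
    show "limitin (L2_topology \<Omega>) v u (at_right 0)"
      unfolding limitin_L2_topology[OF u]
    proof (intro allI impI)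
      fix r :: real assume "r > 0"
      then obtain n where "1 / real (Suc n) < r" using arch by blast
      then have "ennreal (1 / real (Suc n)) \<le> ennreal r" by (intro ennreal_leI) simp
      then show "eventually (\<lambda>\<epsilon>. v \<epsilon> \<in> L2 \<Omega> \<and> ?N (v \<epsilon>) < ennreal r) (at_right 0)"
        using ev[of n] vL by (auto elim!: eventually_mono intro: order_less_le_trans)
    qed
    show "Limsup (at_right 0) (\<lambda>\<epsilon>. energy \<Omega> (phi \<epsilon>) (v \<epsilon>)) \<le> TV \<Omega> u"
    proof (rule ennreal_le_epsilon)
      fix e :: real assume "e > 0"
      then obtain n where "1 / real (Suc n) < e" using arch by blast
      then have "TV \<Omega> u + ennreal (1 / real (Suc n)) \<le> TV \<Omega> u + ennreal e" by (intro add_left_mono ennreal_leI) simp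
      moreover have "Limsup (at_right 0) (\<lambda>\<epsilon>. energy \<Omega> (phi \<epsilon>) (v \<epsilon>)) \<le> TV \<Omega> u + ennreal (1 / real (Suc n))"
        using ev[of n] by (intro Limsup_bounded) (auto elim: eventually_mono)
      ultimately show "Limsup (at_right 0) (\<lambda>\<epsilon>. energy \<Omega> (phi \<epsilon>) (v \<epsilon>)) \<le> TV \<Omega> u + ennreal e" by (rule order_trans[rotated])
    qed
  qed
qed

text \<open>\<open>TV_le_weak_gradient\<close> meets the linear minorant of the convexification. The
  error is added on the side of the energy, since subtraction in \<open>ennreal\<close> is
  truncated; outside \<open>H1\<close> the energy is infinite.\<close>

lemma TV_le_energy_convexification:
  fixes \<Omega> :: "(real^'n) set"
  assumes op: "open \<Omega>" and bd: "bounded \<Omega>" and e: "0 < \<epsilon>" and c: "0 \<le> c" and d: "0 \<le> d"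
    and lower: "\<And>\<sigma>. c * \<bar>\<sigma>\<bar> - d \<le> phi \<epsilon> \<sigma>"
  shows "ennreal c * TV \<Omega> v \<le> energy \<Omega> (convexification (phi \<epsilon>)) v + ennreal (d * measure (lebesgue_on \<Omega>) \<Omega>)"
proof (cases "v \<in> H1 \<Omega>")
  case True
  let ?M = "lebesgue_on \<Omega>" and ?g = "weak_grad \<Omega> v"
  have wg: "has_weak_gradient \<Omega> v ?g" by (rule weak_grad_H1[OF True])
  have gm: "?g \<in> borel_measurable ?M"
    using wg by (intro locally_integrable_measurable op) (simp add: has_weak_gradient_def)
  have "ennreal c * TV \<Omega> v \<le> ennreal c * (\<integral>\<^sup>+x. ennreal (norm (?g x)) \<partial>?M)"
    by (intro mult_left_mono TV_le_weak_gradient[OF op wg]) simp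
  also have "\<dots> = (\<integral>\<^sup>+x. ennreal (c * norm (?g x)) \<partial>?M)"
    using gm c by (simp add: nn_integral_cmult[symmetric] ennreal_mult)
  also have "\<dots> \<le> (\<integral>\<^sup>+x. ennreal (c * norm (?g x) - d) + ennreal d \<partial>?M)"
  proof (rule nn_integral_mono)
    fix x
    have "ennreal (c * norm (?g x)) = ennreal ((c * norm (?g x) - d) + d)" by simp
    also have "\<dots> \<le> ennreal (c * norm (?g x) - d) + ennreal d" by (rule ennreal_plus_le)
    finally show "ennreal (c * norm (?g x)) \<le> ennreal (c * norm (?g x) - d) + ennreal d" .
  qed
  also have "\<dots> = (\<integral>\<^sup>+x. ennreal (c * norm (?g x) - d) \<partial>?M) + ennreal d * ennreal (measure ?M \<Omega>)"
    using gm emeasure_lebesgue_on_eq_ennreal[OF op bd] by (subst nn_integral_add) auto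
  also have "(\<integral>\<^sup>+x. ennreal (c * norm (?g x) - d) \<partial>?M) \<le> energy \<Omega> (convexification (phi \<epsilon>)) v"
    unfolding energy_def using True convexification_lower_bound[OF e c lower, of "norm (?g x)" for x]
    by (auto intro!: nn_integral_mono ennreal_leI)
  finally show ?thesis using d by (simp add: ennreal_mult)
qed (simp add: energy_def)

lemma energy_convexification_le:
  assumes "0 < \<epsilon>"
  shows "energy \<Omega> (convexification (phi \<epsilon>)) v \<le> energy \<Omega> (phi \<epsilon>) v"
  unfolding energy_def by (auto intro!: nn_integral_mono ennreal_leI convexification_phi_le assms)

text \<open>For a fixed test field the functional is continuous in L2, because the divergence is
  bounded and the domain has finite measure.\<close>

lemma tendsto_integral_divergence:
  fixes \<Omega> :: "(real^'n) set"
  assumes op: "open \<Omega>" and bd: "bounded \<Omega>" and u: "u \<in> L2 \<Omega>" and lim: "limitin (L2_topology \<Omega>) v u F" and \<phi>: "\<phi> \<in> C1c \<Omega>"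
  shows "((\<lambda>\<epsilon>. \<integral>x. v \<epsilon> x * divergence \<phi> x \<partial>lebesgue_on \<Omega>) \<longlongrightarrow> (\<integral>x. u x * divergence \<phi> x \<partial>lebesgue_on \<Omega>)) F"
proof (rule tendstoI)
  let ?M = "lebesgue_on \<Omega>" and ?m = "measure (lebesgue_on \<Omega>) \<Omega>"
  fix e :: real assume e: "e > 0"
  obtain B where B: "B > 0" "\<And>x. \<bar>divergence \<phi> x\<bar> \<le> B" using divergence_bounded[OF \<phi>] by metis
  have dm: "divergence \<phi> \<in> borel_measurable ?M"
    using borel_measurable_continuous_onI[OF continuous_on_divergence[OF C1cD[OF \<phi>]]]
    by (intro measurable_restrict_space1 measurable_completion) simp
  have int: "integrable ?M (\<lambda>x. h x * divergence \<phi> x)" if h: "h \<in> L2 \<Omega>" for h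
  proof (rule Bochner_Integration.integrable_bound[OF integrable_mult_right[OF L2_imp_L1(2)[OF op bd h], of B]])
    show "(\<lambda>x. h x * divergence \<phi> x) \<in> borel_measurable ?M"
      using h dm by (auto simp: Lp_def intro: borel_measurable_times)
    show "AE x in ?M. norm (h x * divergence \<phi> x) \<le> norm (B * h x)"
    proof (intro always_eventually allI)
      fix x
      have "\<bar>h x\<bar> * \<bar>divergence \<phi> x\<bar> \<le> \<bar>h x\<bar> * B" using B(2)[of x] by (intro mult_left_mono) auto
      then show "norm (h x * divergence \<phi> x) \<le> norm (B * h x)" using B(1) by (simp add: abs_mult mult.commute)
    qed
  qed
  \<comment> \<open>The summand 1 keeps \<open>D\<close> positive and makes the estimate
    \<open>Br\<close> strict even for measure 0.\<close>
  define D where "D = B * (sqrt ?m + 1)"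
  define r where "r = e / D"
  have D: "D > 0" unfolding D_def using B(1) by (intro mult_pos_pos) (auto simp: add_nonneg_pos)
  have r: "r > 0" using e D by (simp add: r_def)
  have Br: "B * (r * sqrt ?m) < e"
  proof -
    have "B * (r * sqrt ?m) < B * (r * (sqrt ?m + 1))" using B(1) r by (intro mult_strict_left_mono) auto
    also have "\<dots> = r * D" by (simp only: mult_ac D_def)
    also have "\<dots> = e" using D by (simp add: r_def)
    finally show ?thesis .
  qed
  have "eventually (\<lambda>\<epsilon>. v \<epsilon> \<in> L2 \<Omega> \<and> Lp_norm 2 ?M (\<lambda>x. v \<epsilon> x - u x) < ennreal r) F"
    using lim r unfolding limitin_L2_topology[OF u] by blast
  then show "eventually (\<lambda>\<epsilon>. dist (\<integral>x. v \<epsilon> x * divergence \<phi> x \<partial>?M) (\<integral>x. u x * divergence \<phi> x \<partial>?M) < e) F"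
  proof eventually_elim
    case (elim \<epsilon>)
    let ?h = "\<lambda>x. v \<epsilon> x - u x"
    have h: "?h \<in> L2 \<Omega>" using elim u by (intro Lp_2_diff) auto
    have hm: "?h \<in> borel_measurable ?M" using h by (simp add: Lp_def)
    have eq: "(\<integral>x. v \<epsilon> x * divergence \<phi> x \<partial>?M) - (\<integral>x. u x * divergence \<phi> x \<partial>?M) = (\<integral>x. ?h x * divergence \<phi> x \<partial>?M)"
      using int[of "v \<epsilon>"] int[OF u] elim by (simp add: left_diff_distrib)
    have "ennreal (norm (\<integral>x. ?h x * divergence \<phi> x \<partial>?M)) \<le> (\<integral>\<^sup>+x. norm (?h x * divergence \<phi> x) \<partial>?M)"
      by (rule integral_norm_bound_ennreal[OF int[OF h]])
    also have "\<dots> \<le> (\<integral>\<^sup>+x. ennreal B * ennreal \<bar>?h x\<bar> \<partial>?M)"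
    proof (rule nn_integral_mono)
      fix x
      have "norm (?h x * divergence \<phi> x) \<le> B * \<bar>?h x\<bar>"
        using mult_right_mono[OF B(2)[of x], of "\<bar>?h x\<bar>"] by (simp add: abs_mult mult.commute)
      then have "ennreal (norm (?h x * divergence \<phi> x)) \<le> ennreal (B * \<bar>?h x\<bar>)" by (rule ennreal_leI)
      also have "\<dots> = ennreal B * ennreal \<bar>?h x\<bar>" using B(1) by (intro ennreal_mult) auto
      finally show "ennreal (norm (?h x * divergence \<phi> x)) \<le> ennreal B * ennreal \<bar>?h x\<bar>" .
    qed
    also have "\<dots> = ennreal B * (\<integral>\<^sup>+x. ennreal \<bar>?h x\<bar> \<partial>?M)" 
      by (rule nn_integral_cmult, rule measurable_compose[OF hm]) measurable
    also have "\<dots> \<le> ennreal B * (Lp_norm 2 ?M ?h * ennreal (sqrt ?m))"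
      by (intro mult_left_mono nn_integral_abs_le_L2[OF hm emeasure_lebesgue_on_eq_ennreal[OF op bd]]) auto
    also have "\<dots> \<le> ennreal B * (ennreal r * ennreal (sqrt ?m))"
      using elim by (intro mult_left_mono mult_right_mono) auto
    also have "\<dots> = ennreal (B * (r * sqrt ?m))" using B(1) r by (simp add: ennreal_mult[symmetric])
    finally have "norm (\<integral>x. ?h x * divergence \<phi> x \<partial>?M) \<le> B * (r * sqrt ?m)"
      by (rule ennreal_le_iff[THEN iffD1, rotated]) (use B(1) r in simp)
    then show ?case using Br unfolding dist_norm eq by simp
  qed
qed

text \<open>\<open>TV\<close> is a supremum of L2-continuous functionals, so it is enough to treat
  one test field at a time and to stay above any number z below its integral; the slope loss in the
  bound for \<open>phi\<close> then fits into this gap.\<close>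

lemma liminf_inequality:
  fixes \<Omega> :: "(real^'n) set"
  assumes op: "open \<Omega>" and bd: "bounded \<Omega>" and u: "u \<in> L2 \<Omega>" and lim: "limitin (L2_topology \<Omega>) v u (at_right 0)"
  shows "TV \<Omega> u \<le> Liminf (at_right 0) (\<lambda>\<epsilon>. energy \<Omega> (convexification (phi \<epsilon>)) (v \<epsilon>))"
proof (rule TV_least)
  fix \<phi> :: "real^'n \<Rightarrow> real^'n" assume \<phi>: "\<phi> \<in> C1c \<Omega>" and 1: "\<And>x. norm (\<phi> x) \<le> 1"
  let ?M = "lebesgue_on \<Omega>" and ?m = "measure (lebesgue_on \<Omega>) \<Omega>"
  let ?I = "\<integral>x. u x * divergence \<phi> x \<partial>?M" and ?J = "\<lambda>\<epsilon>. \<integral>x. v \<epsilon> x * divergence \<phi> x \<partial>?M"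
  show "ennreal ?I \<le> Liminf (at_right 0) (\<lambda>\<epsilon>. energy \<Omega> (convexification (phi \<epsilon>)) (v \<epsilon>))"
    unfolding le_Liminf_iff
  proof (intro allI impI)
    fix y assume y: "y < ennreal ?I"
    then obtain z where z: "y = ennreal z" "0 \<le> z" "z < ?I"
      by (cases y) (auto simp: ennreal_less_iff)
    \<comment> \<open>Halfway between z / I and 1, where I is the integral \<open>?I\<close>: then q
      < 1 is an admissible slope while q I still exceeds z. The bound for \<open>phi\<close> is used
      with s = q^2, so that its slope \<open>sqrt s\<close> is q.\<close>
    define q where "q = (1 + z / ?I) / 2"
    have I: "?I > 0" using z by simp
    have q: "0 < q" "q < 1" using z I by (auto simp: q_def divide_simps add_pos_nonneg)
    have qI: "q * ?I > z" using z I by (simp add: q_def field_simps)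
    have sq: "sqrt (q\<^sup>2) = q" "0 < q\<^sup>2" "q\<^sup>2 < 1" using q by (auto simp: power_less_one_iff abs_square_less_1)
    have "((\<lambda>\<epsilon>::real. \<epsilon> * \<bar>ln \<epsilon>\<bar>) \<longlongrightarrow> 0) (at_right 0)" by real_asymp
    then have "((\<lambda>\<epsilon>. q * ?J \<epsilon> - \<epsilon> * \<bar>ln \<epsilon>\<bar> * ?m) \<longlongrightarrow> q * ?I - 0 * ?m) (at_right 0)"
      by (intro tendsto_intros tendsto_integral_divergence[OF op bd u lim \<phi>])
    then have "eventually (\<lambda>\<epsilon>. z < q * ?J \<epsilon> - \<epsilon> * \<bar>ln \<epsilon>\<bar> * ?m) (at_right 0)"
      by (rule order_tendstoD(1)) (use qI in simp)
    moreover have "eventually (\<lambda>\<epsilon>::real. \<epsilon> > 0) (at_right 0)" by (rule eventually_at_right_less)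
    ultimately show "eventually (\<lambda>\<epsilon>. y < energy \<Omega> (convexification (phi \<epsilon>)) (v \<epsilon>)) (at_right 0)"
      using phi_lower_bound_eventually[OF sq(2,3)]
    proof eventually_elim
      case (elim \<epsilon>)
      let ?E = "energy \<Omega> (convexification (phi \<epsilon>)) (v \<epsilon>)"
      let ?d = "\<epsilon> * \<bar>ln \<epsilon>\<bar>"
      have d: "0 \<le> ?d" using elim(2) by (intro mult_nonneg_nonneg) auto
      have lower: "q * \<bar>\<sigma>\<bar> - ?d \<le> phi \<epsilon> \<sigma>" for \<sigma> using elim(3)[unfolded sq(1)] by blast
      have "ennreal (z + ?d * ?m) < ennreal (q * ?J \<epsilon>)"
        using elim(1) z(2) d by (intro ennreal_lessI) (auto intro: add_nonneg_pos order_le_less_trans[of 0 "z + ?d * ?m"])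
      also have "\<dots> = ennreal q * ennreal (?J \<epsilon>)"
        using q by (intro ennreal_mult') auto
      also have "\<dots> \<le> ennreal q * TV \<Omega> (v \<epsilon>)"
        by (intro mult_left_mono TV_upper[OF \<phi> 1]) simp
      also have "\<dots> \<le> ?E + ennreal (?d * ?m)"
        by (rule TV_le_energy_convexification[OF op bd elim(2) less_imp_le[OF q(1)] d lower])
      finally have lt: "ennreal (z + ?d * ?m) < ?E + ennreal (?d * ?m)" .
      show "y < ?E"
      proof (rule ccontr)
        assume "\<not> y < ?E"
        then have "?E + ennreal (?d * ?m) \<le> ennreal z + ennreal (?d * ?m)" using z(1) by (simp add: add_right_mono)
        also have "\<dots> = ennreal (z + ?d * ?m)" using z(2) d by (intro ennreal_plus[symmetric]) auto
        finally show False using lt by simp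
      qed
    qed
  qed
qed

section \<open>Compactness\<close>

text \<open>Both constants depend on \<open>w\<close> only through the bound \<open>V\<close> for
  its L1 norm, so mollifying a bounded family gives uniformly bounded and equi-Lipschitz
  functions.\<close>

lemma mollify_bounds:
  fixes w :: "real^'n \<Rightarrow> real"
  assumes w: "integrable lborel w" and V: "(\<integral>\<^sup>+x. ennreal \<bar>w x\<bar> \<partial>lborel) \<le> ennreal V" "V \<ge> 0" and \<rho>: "mollifier \<delta> \<rho>"
    and B: "B \<ge> 0" "\<And>x. \<bar>\<rho> x\<bar> \<le> B" "\<And>x y. \<bar>\<rho> x - \<rho> y\<bar> \<le> B * norm (x - y)"
  shows "\<bar>mollify \<rho> w x\<bar> \<le> B * V" "\<bar>mollify \<rho> w x - mollify \<rho> w y\<bar> \<le> B * V * norm (x - y)"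
proof -
  have wV: "(\<integral>x. \<bar>w x\<bar> \<partial>lborel) \<le> V"
  proof -
    have "(\<integral>\<^sup>+x. ennreal \<bar>w x\<bar> \<partial>lborel) = ennreal (\<integral>x. \<bar>w x\<bar> \<partial>lborel)"
      using w by (intro nn_integral_eq_integral integrable_abs) auto
    then show ?thesis using V by simp
  qed
  have gen: "\<bar>\<integral>t. w t * g t \<partial>lborel\<bar> \<le> c * V" if i: "integrable lborel (\<lambda>t. w t * g t)" and g: "\<And>t. \<bar>g t\<bar> \<le> c" "c \<ge> 0" for g c
  proof -
    have "norm (\<integral>t. w t * g t \<partial>lborel) \<le> (\<integral>t. norm (w t * g t) \<partial>lborel)" by (rule integral_norm_bound)
    also have "\<dots> \<le> (\<integral>t. \<bar>w t\<bar> * c \<partial>lborel)"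
    proof (rule integral_mono)
      show "norm (w t * g t) \<le> \<bar>w t\<bar> * c" for t
        using mult_left_mono[OF g(1)[of t], of "\<bar>w t\<bar>"] by (simp add: abs_mult)
    qed (use i w in auto)
    also have "\<dots> = (\<integral>t. \<bar>w t\<bar> \<partial>lborel) * c" by simp
    also have "\<dots> \<le> V * c" using wV g(2) by (rule mult_right_mono)
    finally show ?thesis by (simp add: mult.commute)
  qed
  note i = integrable_mollify[OF w \<rho>, unfolded real_scaleR_def]
  show "\<bar>mollify \<rho> w x\<bar> \<le> B * V"
    unfolding mollify_def real_scaleR_def by (rule gen[OF i B(2,1)])
  have "mollify \<rho> w x - mollify \<rho> w y = (\<integral>t. w t * (\<rho> (x - t) - \<rho> (y - t)) \<partial>lborel)"
    unfolding mollify_def real_scaleR_def using i[of x] i[of y] by (simp add: right_diff_distrib)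
  moreover have "integrable lborel (\<lambda>t. w t * (\<rho> (x - t) - \<rho> (y - t)))"
    using i[of x] i[of y] by (simp add: right_diff_distrib)
  then have "\<bar>\<integral>t. w t * (\<rho> (x - t) - \<rho> (y - t)) \<partial>lborel\<bar> \<le> (B * norm (x - y)) * V"
  proof (rule gen)
    show "\<bar>\<rho> (x - t) - \<rho> (y - t)\<bar> \<le> B * norm (x - y)" for t using B(3)[of "x - t" "y - t"] by simp
    show "0 \<le> B * norm (x - y)" using B(1) by simp
  qed
  ultimately show "\<bar>mollify \<rho> w x - mollify \<rho> w y\<bar> \<le> B * V * norm (x - y)" by (simp add: mult_ac)
qed

text \<open>Arzela-Ascoli on the compact closure of the domain. Only a fixed accuracy
  \<open>e\<close> is recorded, because the mollifier itself will change with the accuracy and a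
  diagonal sequence is formed afterwards.\<close>

lemma mollified_subsequence:
  fixes w :: "nat \<Rightarrow> real^'n \<Rightarrow> real"
  assumes bd: "bounded \<Omega>" and w: "\<And>n. integrable lborel (w n)" and V: "\<And>n. (\<integral>\<^sup>+x. ennreal \<bar>w n x\<bar> \<partial>lborel) \<le> ennreal V" "V \<ge> 0"
    and \<rho>: "mollifier \<delta> \<rho>" and e: "e > 0"
  obtains r N where "strict_mono (r :: nat \<Rightarrow> nat)"
    "\<And>m n x. m \<ge> N \<Longrightarrow> n \<ge> N \<Longrightarrow> x \<in> \<Omega> \<Longrightarrow> \<bar>mollify \<rho> (w (r m)) x - mollify \<rho> (w (r n)) x\<bar> \<le> e"
proof -
  note C = mollifierD(1)[OF \<rho>]
  obtain B1 where B1: "B1 > 0" "\<And>x. norm (\<rho> x) \<le> B1" using C1c_bounded[OF C] by metis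
  obtain B2 where B2: "B2 > 0" "\<And>x y. norm (\<rho> x - \<rho> y) \<le> B2 * norm (x - y)" using C1c_lipschitz[OF C] by metis
  define B where "B = B1 + B2"
  have B: "B > 0" "B \<ge> 0" using B1 B2(1) by (auto simp: B_def)
  have Bb: "\<bar>\<rho> x\<bar> \<le> B" for x using B1(2)[of x] B2(1) by (simp add: B_def)
  have Blip: "\<bar>\<rho> x - \<rho> y\<bar> \<le> B * norm (x - y)" for x y
  proof -
    have "\<bar>\<rho> x - \<rho> y\<bar> \<le> B2 * norm (x - y)" using B2(2)[of x y] by simp
    also have "\<dots> \<le> B * norm (x - y)" using B1(1) by (intro mult_right_mono) (auto simp: B_def)
    finally show ?thesis .
  qed
  note bounds = mollify_bounds[OF w V \<rho> B(2) Bb Blip]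
  have BV: "B * V + 1 > 0" using B(1) V(2) by (simp add: add_nonneg_pos)
  have cpt: "compact (closure \<Omega>)" using bd by simp
  obtain g r where gr: "strict_mono (r :: nat \<Rightarrow> nat)"
    "\<And>e. 0 < e \<Longrightarrow> \<exists>N. \<forall>n x. n \<ge> N \<and> x \<in> closure \<Omega> \<longrightarrow> norm (mollify \<rho> (w (r n)) x - g x) < e"
  proof (rule Arzela_Ascoli[OF cpt, of "\<lambda>n. mollify \<rho> (w n)" "B * V"])
    show "norm (mollify \<rho> (w n) x) \<le> B * V" for n x using bounds(1) by simp
    show "\<exists>d>0. \<forall>n y. y \<in> closure \<Omega> \<and> norm (x - y) < d \<longrightarrow> norm (mollify \<rho> (w n) x - mollify \<rho> (w n) y) < e"
      if "0 < e" for x e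
    \<comment> \<open>The summand 1 avoids division by 0 when the Lipschitz constant
      vanishes.\<close>
    proof (intro exI[of _ "e / (B * V + 1)"] conjI allI impI)
      show "0 < e / (B * V + 1)" using that BV by simp
      fix n y assume "y \<in> closure \<Omega> \<and> norm (x - y) < e / (B * V + 1)"
      then have lt: "(B * V + 1) * norm (x - y) < e" using BV by (simp add: field_simps)
      have "norm (mollify \<rho> (w n) x - mollify \<rho> (w n) y) \<le> B * V * norm (x - y)" using bounds(2) by simp
      also have "\<dots> \<le> (B * V + 1) * norm (x - y)" by (intro mult_right_mono) auto
      finally show "norm (mollify \<rho> (w n) x - mollify \<rho> (w n) y) < e" using lt by simp
    qed
  qed (use that in blast)
  obtain N where N: "\<And>n x. n \<ge> N \<Longrightarrow> x \<in> closure \<Omega> \<Longrightarrow> norm (mollify \<rho> (w (r n)) x - g x) < e / 2"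
    using gr(2)[of "e / 2"] e by auto
  show ?thesis
  proof (rule that[OF gr(1)])
    fix m n x assume "m \<ge> N" "n \<ge> N" "x \<in> \<Omega>"
    moreover have "x \<in> closure \<Omega>" using \<open>x \<in> \<Omega>\<close> closure_subset[of \<Omega>] by (rule subsetD[rotated])
    ultimately show "\<bar>mollify \<rho> (w (r m)) x - mollify \<rho> (w (r n)) x\<bar> \<le> e"
      using N[of m x] N[of n x] by (simp add: abs_if split: if_splits)
  qed
qed

text \<open>A diagonal argument over the mollification scale 1 / (k + 1). At stage k the mollified
  functions are uniformly close along a subsequence, and by the translation estimate the functions
  themselves are L1 close to their mollifications.\<close>

lemma BV_Cauchy_subsequence:
  fixes w :: "nat \<Rightarrow> real^'n \<Rightarrow> real"
  assumes op: "open \<Omega>" and bd: "bounded \<Omega>" and w: "\<And>n. integrable lborel (w n)"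
    and V: "\<And>n. (\<integral>\<^sup>+x. ennreal \<bar>w n x\<bar> \<partial>lborel) \<le> ennreal V" "\<And>n. TV UNIV (w n) \<le> ennreal V" "V \<ge> 0"
  obtains d where "strict_mono (d :: nat \<Rightarrow> nat)"
    "\<forall>e>0. \<exists>N. \<forall>m\<ge>N. \<forall>n\<ge>N. (\<integral>\<^sup>+x. ennreal \<bar>w (d m) x - w (d n) x\<bar> \<partial>lebesgue_on \<Omega>) \<le> ennreal e"
proof -
  let ?M = "lebesgue_on \<Omega>"
  define \<mu> where "\<mu> = measure ?M \<Omega>"
  have \<mu>: "emeasure ?M (space ?M) = ennreal \<mu>" "\<mu> \<ge> 0"
    unfolding \<mu>_def by (rule emeasure_lebesgue_on_eq_ennreal[OF op bd]) simp
  \<comment> \<open>Two mollification errors V / (k + 1), and 1 / (k + 1) for the integral of the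
    uniform distance between the mollified functions.\<close>
  let ?c = "\<lambda>k. (2 * V + 1) / real (Suc k)"
  define P where "P k s \<longleftrightarrow> (\<exists>N. \<forall>m\<ge>N. \<forall>n\<ge>N. (\<integral>\<^sup>+x. ennreal \<bar>w (s m) x - w (s n) x\<bar> \<partial>?M) \<le> ennreal (?c k))" for k and s :: "nat \<Rightarrow> nat"
  have wm [measurable]: "w n \<in> borel_measurable borel" for n using w[of n] by auto
  have sum3: "ennreal a + ennreal a + ennreal b = ennreal (a + a + b)" if "0 \<le> a" "0 \<le> b" for a b
    by (simp only: ennreal_plus[OF that(1) that(1)] ennreal_plus[OF add_nonneg_nonneg[OF that(1) that(1)] that(2)])
  have step: "\<exists>r'. strict_mono r' \<and> P k (s \<circ> r')" if s: "strict_mono s" for k and s :: "nat \<Rightarrow> nat"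
  proof -
    have k: "1 / real (Suc k) > 0" by simp
    obtain \<rho> :: "real^'n \<Rightarrow> real" where \<rho>: "mollifier (1 / real (Suc k)) \<rho>" using mollifier_exists[OF k] by metis
    \<comment> \<open>The accuracy is divided by the measure \<mu> of the domain, over which it is
      integrated; \<mu> + 1 allows for \<mu> = 0.\<close>
    define e where "e = 1 / (real (Suc k) * (\<mu> + 1))"
    have e: "e > 0" using \<mu>(2) by (simp add: e_def add_nonneg_pos)
    have e\<mu>: "e * \<mu> \<le> 1 / real (Suc k)"
    proof -
      have "e * \<mu> = (1 / real (Suc k)) * (\<mu> / (\<mu> + 1))" by (simp add: e_def)
      also have "\<dots> \<le> (1 / real (Suc k)) * 1" using \<mu>(2) by (intro mult_left_mono) auto
      finally show ?thesis by simp
    qed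
    obtain r N where r: "strict_mono (r :: nat \<Rightarrow> nat)"
      "\<And>m n x. m \<ge> N \<Longrightarrow> n \<ge> N \<Longrightarrow> x \<in> \<Omega> \<Longrightarrow> \<bar>mollify \<rho> (w (s (r m))) x - mollify \<rho> (w (s (r n))) x\<bar> \<le> e"
      using mollified_subsequence[OF bd, of "\<lambda>n. w (s n)" V, OF w V(1,3) \<rho> e] by metis
    have "(\<integral>\<^sup>+x. ennreal \<bar>w (s (r m)) x - w (s (r n)) x\<bar> \<partial>?M) \<le> ennreal (?c k)" if mn: "m \<ge> N" "n \<ge> N" for m n
    proof -
      let ?a = "w (s (r m))" and ?b = "w (s (r n))"
      let ?A = "mollify \<rho> ?a" and ?B = "mollify \<rho> ?b"
      have mm: "?A \<in> borel_measurable borel" "?B \<in> borel_measurable borel"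
        by (rule borel_measurable_continuous_onI[OF C1_fun_continuous[OF C1_fun_mollify[OF w \<rho>]]])+
      have near: "(\<integral>\<^sup>+x. ennreal \<bar>mollify \<rho> (w j) x - w j x\<bar> \<partial>?M) \<le> ennreal (1 / real (Suc k) * V)" for j
      proof -
        have [measurable]: "mollify \<rho> (w j) \<in> borel_measurable borel"
          by (rule borel_measurable_continuous_onI[OF C1_fun_continuous[OF C1_fun_mollify[OF w \<rho>]]])
        have "(\<integral>\<^sup>+x. ennreal \<bar>mollify \<rho> (w j) x - w j x\<bar> \<partial>?M) \<le> (\<integral>\<^sup>+x. ennreal \<bar>mollify \<rho> (w j) x - w j x\<bar> \<partial>lborel)"
          using op by (intro nn_integral_lebesgue_on_le_lborel) auto
        also have "\<dots> \<le> ennreal (1 / real (Suc k) * V)" by (rule nn_integral_mollify_diff[OF w V(2,3) \<rho>])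
        finally show ?thesis .
      qed
      have ms: "h \<in> borel_measurable borel \<Longrightarrow> h \<in> borel_measurable ?M" for h :: "real^'n \<Rightarrow> ennreal"
        by (intro measurable_restrict_space1 measurable_completion) simp
      have "(\<integral>\<^sup>+x. ennreal \<bar>?a x - ?b x\<bar> \<partial>?M) \<le> (\<integral>\<^sup>+x. (ennreal \<bar>?A x - ?a x\<bar> + ennreal \<bar>?B x - ?b x\<bar>) + ennreal e \<partial>?M)"
      proof (rule nn_integral_mono)
        fix x assume "x \<in> space ?M"
        then have "\<bar>?A x - ?B x\<bar> \<le> e" using r(2)[OF mn] by simp
        then have "\<bar>?a x - ?b x\<bar> \<le> (\<bar>?A x - ?a x\<bar> + \<bar>?B x - ?b x\<bar>) + e" by linarith
        then have "ennreal \<bar>?a x - ?b x\<bar> \<le> ennreal ((\<bar>?A x - ?a x\<bar> + \<bar>?B x - ?b x\<bar>) + e)" by (rule ennreal_leI)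
        also have "\<dots> = (ennreal \<bar>?A x - ?a x\<bar> + ennreal \<bar>?B x - ?b x\<bar>) + ennreal e" using e by (simp add: ennreal_plus)
        finally show "ennreal \<bar>?a x - ?b x\<bar> \<le> (ennreal \<bar>?A x - ?a x\<bar> + ennreal \<bar>?B x - ?b x\<bar>) + ennreal e" .
      qed
      also have "\<dots> = ((\<integral>\<^sup>+x. ennreal \<bar>?A x - ?a x\<bar> \<partial>?M) + (\<integral>\<^sup>+x. ennreal \<bar>?B x - ?b x\<bar> \<partial>?M)) + ennreal e * ennreal \<mu>"
      proof -
        have m1: "(\<lambda>x. ennreal \<bar>?A x - ?a x\<bar>) \<in> borel_measurable ?M" "(\<lambda>x. ennreal \<bar>?B x - ?b x\<bar>) \<in> borel_measurable ?M"
          using mm by (intro ms; measurable)+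
        then show ?thesis using \<mu>(1) by (simp add: nn_integral_add)
      qed
      also have "\<dots> \<le> (ennreal (1 / real (Suc k) * V) + ennreal (1 / real (Suc k) * V)) + ennreal (1 / real (Suc k))"
        using e \<mu>(2) e\<mu> by (intro add_mono near) (simp add: ennreal_mult[symmetric] ennreal_leI)
      also have "\<dots> = ennreal ((1 / real (Suc k) * V + 1 / real (Suc k) * V) + 1 / real (Suc k))"
        by (rule sum3) (use V(3) in auto)
      also have "(1 / real (Suc k) * V + 1 / real (Suc k) * V) + 1 / real (Suc k) = ?c k" by (simp add: add_divide_distrib)
      finally show ?thesis .
    qed
    then show ?thesis using r(1) unfolding P_def by (intro exI[of _ r]) auto
  qed
  interpret subseqs P by unfold_locales (rule step)
  \<comment> \<open>\<open>P k\<close> passes to further subsequences, so the diagonal sequence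
    inherits it from index k + 1 on.\<close>
  have Pmono: "P k (s \<circ> r)" if r: "strict_mono r" and s: "P k s" for r s k
  proof -
    obtain N where N: "\<forall>m\<ge>N. \<forall>n\<ge>N. (\<integral>\<^sup>+x. ennreal \<bar>w (s m) x - w (s n) x\<bar> \<partial>?M) \<le> ennreal (?c k)"
      using s unfolding P_def by blast
    have "m \<ge> N \<Longrightarrow> r m \<ge> N" for m using seq_suble[OF r, of m] by linarith
    then show ?thesis using N unfolding P_def by (intro exI[of _ N]) simp
  qed
  show ?thesis
  proof (rule that[OF subseq_diagseq], intro allI impI)
    fix e :: real assume e: "e > 0"
    obtain k where k: "inverse (real (Suc k)) < e / (2 * V + 1)"
      using reals_Archimedean[of "e / (2 * V + 1)"] e V(3) by auto
    have ck: "?c k \<le> e" using k V(3) by (simp add: field_simps)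
    have "P k (diagseq \<circ> (+) (Suc k))" by (rule diagseq_holds) (rule Pmono)
    then obtain N where N: "\<And>m n. m \<ge> N \<Longrightarrow> n \<ge> N \<Longrightarrow> (\<integral>\<^sup>+x. ennreal \<bar>w (diagseq (Suc k + m)) x - w (diagseq (Suc k + n)) x\<bar> \<partial>?M) \<le> ennreal (?c k)"
      unfolding P_def by auto
    show "\<exists>N. \<forall>m\<ge>N. \<forall>n\<ge>N. (\<integral>\<^sup>+x. ennreal \<bar>w (diagseq m) x - w (diagseq n) x\<bar> \<partial>?M) \<le> ennreal e"
    proof (intro exI[of _ "Suc k + N"] allI impI)
      fix m n assume mn: "Suc k + N \<le> m" "Suc k + N \<le> n"
      then have "(\<integral>\<^sup>+x. ennreal \<bar>w (diagseq m) x - w (diagseq n) x\<bar> \<partial>?M) \<le> ennreal (?c k)"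
        using N[of "m - Suc k" "n - Suc k"] by simp
      also have "\<dots> \<le> ennreal e" using ck by (rule ennreal_leI)
      finally show "(\<integral>\<^sup>+x. ennreal \<bar>w (diagseq m) x - w (diagseq n) x\<bar> \<partial>?M) \<le> ennreal e" .
    qed
  qed
qed

text \<open>The Riesz-Fischer argument: consecutive L1 distances at most 2^(-j) are summable, so the
  telescoping series converges absolutely almost everywhere. Defining the limit by
  \<open>lim\<close> keeps it measurable on the whole space.\<close>

lemma L1_Cauchy_AE_subsequence:
  fixes f :: "nat \<Rightarrow> 'a \<Rightarrow> real"
  assumes fm [measurable]: "\<And>n. f n \<in> borel_measurable M"
    and C: "\<And>e. e > 0 \<Longrightarrow> \<exists>N. \<forall>m\<ge>N. \<forall>n\<ge>N. (\<integral>\<^sup>+x. ennreal \<bar>f m x - f n x\<bar> \<partial>M) \<le> ennreal e"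
  obtains r l where "strict_mono (r :: nat \<Rightarrow> nat)" "l \<in> borel_measurable M" "AE x in M. (\<lambda>n. f (r n) x) \<longlonglongrightarrow> l x"
proof -
  have "\<exists>N. \<forall>m\<ge>N. \<forall>n\<ge>N. (\<integral>\<^sup>+x. ennreal \<bar>f m x - f n x\<bar> \<partial>M) \<le> ennreal ((1/2)^j)" for j
    by (rule C) simp
  then obtain N where N: "\<And>j m n. m \<ge> N j \<Longrightarrow> n \<ge> N j \<Longrightarrow> (\<integral>\<^sup>+x. ennreal \<bar>f m x - f n x\<bar> \<partial>M) \<le> ennreal ((1/2)^j)"
    by metis
  \<comment> \<open>The thresholds \<open>N j\<close> need not be monotone; their partial sums with
    \<open>Suc\<close> are strictly increasing and still dominate them.\<close>
  define r where "r j = (\<Sum>i\<le>j. Suc (N i))" for j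
  have r: "strict_mono r" by (rule strict_monoI_Suc) (simp add: r_def)
  have rN: "N j \<le> r j" "N j \<le> r (Suc j)" for j
  proof -
    have "Suc (N j) \<le> r j" unfolding r_def by (rule member_le_sum) auto
    moreover have "r j \<le> r (Suc j)" by (simp add: r_def)
    ultimately show "N j \<le> r j" "N j \<le> r (Suc j)" by linarith+
  qed
  have "(\<integral>\<^sup>+x. (\<Sum>j. ennreal \<bar>f (r (Suc j)) x - f (r j) x\<bar>) \<partial>M) = (\<Sum>j. \<integral>\<^sup>+x. ennreal \<bar>f (r (Suc j)) x - f (r j) x\<bar> \<partial>M)"
    by (rule nn_integral_suminf) measurable
  also have "\<dots> \<le> (\<Sum>j. ennreal ((1/2)^j))"
    using N rN by (intro suminf_le) auto
  also have "\<dots> < \<infinity>"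
    by (simp add: suminf_ennreal2 summable_geometric)
  finally have "AE x in M. (\<Sum>j. ennreal \<bar>f (r (Suc j)) x - f (r j) x\<bar>) \<noteq> \<infinity>"
    by (intro nn_integral_PInf_AE) (auto simp: top.not_eq_extremum)
  then have conv: "AE x in M. convergent (\<lambda>n. f (r n) x)"
  proof eventually_elim
    case (elim x)
    then have "summable (\<lambda>j. \<bar>f (r (Suc j)) x - f (r j) x\<bar>)"
      by (intro summable_suminf_not_top) (auto simp: infinity_ennreal_def)
    then have "summable (\<lambda>j. f (r (Suc j)) x - f (r j) x)" by (rule summable_rabs_cancel)
    then have "(\<lambda>n. \<Sum>j<n. f (r (Suc j)) x - f (r j) x) \<longlonglongrightarrow> (\<Sum>j. f (r (Suc j)) x - f (r j) x)"
      by (rule summable_LIMSEQ)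
    then have "(\<lambda>n. f (r n) x - f (r 0) x) \<longlonglongrightarrow> (\<Sum>j. f (r (Suc j)) x - f (r j) x)"
      by (simp only: sum_lessThan_telescope[of "\<lambda>j. f (r j) x"])
    from tendsto_add[OF this tendsto_const[of "f (r 0) x"]] show ?case
      by (auto simp: convergent_def)
  qed
  show ?thesis
  proof (rule that[OF r])
    show "(\<lambda>x. lim (\<lambda>n. f (r n) x)) \<in> borel_measurable M" by measurable
    show "AE x in M. (\<lambda>n. f (r n) x) \<longlonglongrightarrow> lim (\<lambda>n. f (r n) x)"
      using conv by eventually_elim (simp add: convergent_LIMSEQ_iff)
  qed
qed

text \<open>The extensions are bounded in BV on the whole space, hence L1 Cauchy along a
  subsequence. On the domain they agree with \<open>u n\<close>, so a further subsequence of
  \<open>u n\<close> converges almost everywhere, and the common bound \<open>K\<close> gives L2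
  convergence by domination.\<close>

lemma L2_convergent_subsequence:
  fixes \<Omega> :: "(real^'n) set" and u :: "nat \<Rightarrow> real^'n \<Rightarrow> real"
  assumes bd: "bounded \<Omega>" and ext: "extension_domain \<Omega>" and u: "\<And>n. u n \<in> L2 \<Omega>"
    and K: "\<And>n. AE x in lebesgue_on \<Omega>. \<bar>u n x\<bar> \<le> K" and TV: "\<And>n. TV \<Omega> (u n) \<le> ennreal V" and V: "V \<ge> 0" "K \<ge> 0"
  obtains r l where "strict_mono (r :: nat \<Rightarrow> nat)" "l \<in> L2 \<Omega>"
    "(\<lambda>n. sq_integral (lebesgue_on \<Omega>) (\<lambda>x. u (r n) x - l x)) \<longlonglongrightarrow> 0"
proof -
  let ?M = "lebesgue_on \<Omega>"
  have op: "open \<Omega>" using ext by (simp add: extension_domain_def)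
  define \<mu> where "\<mu> = measure ?M \<Omega>"
  have \<mu>: "emeasure ?M (space ?M) = ennreal \<mu>" "\<mu> \<ge> 0"
    unfolding \<mu>_def by (rule emeasure_lebesgue_on_eq_ennreal[OF op bd]) simp
  have um: "u n \<in> borel_measurable ?M" for n using u[of n] by (simp add: Lp_def)
  obtain C where C: "C \<ge> 0" "\<forall>u\<in>BV \<Omega>. \<exists>w. integrable lborel w \<and> (AE x in lebesgue_on \<Omega>. w x = u x) \<and>
      TV UNIV w \<le> ennreal C * BV_norm \<Omega> u \<and> (\<integral>\<^sup>+x. ennreal \<bar>w x\<bar> \<partial>lborel) \<le> ennreal C * BV_norm \<Omega> u \<and>
      (\<forall>\<eta>>0. \<exists>A. open A \<and> frontier \<Omega> \<subseteq> A \<and> TV A w \<le> ennreal \<eta>)"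
    by (rule extension_BV[OF ext])
  have uBV: "u n \<in> BV \<Omega>" for n
  proof -
    have "TV \<Omega> (u n) < \<infinity>" using TV[of n] by (rule order_le_less_trans) simp
    then show ?thesis using L2_imp_L1(1)[OF op bd u] by (simp add: BV_def)
  qed
  \<comment> \<open>K times the measure bounds the L1 norm on the domain and \<open>V\<close> the
    variation; \<open>C\<close> is the norm of the extension.\<close>
  define W where "W = C * (K * \<mu> + V)"
  have W: "W \<ge> 0" using C(1) V \<mu>(2) by (simp add: W_def)
  have norm: "ennreal C * BV_norm \<Omega> (u n) \<le> ennreal W" for n
  proof -
    have "(\<integral>\<^sup>+x. ennreal (norm (u n x)) \<partial>?M) \<le> (\<integral>\<^sup>+x. ennreal K \<partial>?M)"
      using K[of n] by (intro nn_integral_mono_AE) (auto elim!: eventually_mono intro: ennreal_leI)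
    also have "\<dots> = ennreal (K * \<mu>)" using V \<mu> by (simp add: ennreal_mult)
    finally have "BV_norm \<Omega> (u n) \<le> ennreal (K * \<mu>) + ennreal V"
      unfolding BV_norm_def Lp_norm_1 by (intro add_mono TV)
    also have "\<dots> = ennreal (K * \<mu> + V)" using V \<mu>(2) by (intro ennreal_plus[symmetric]) auto
    finally have "ennreal C * BV_norm \<Omega> (u n) \<le> ennreal C * ennreal (K * \<mu> + V)" by (rule mult_left_mono) simp
    also have "\<dots> = ennreal W" unfolding W_def using C(1) V \<mu>(2) by (intro ennreal_mult[symmetric]) auto
    finally show ?thesis .
  qed
  define Q where "Q n w \<longleftrightarrow> integrable lborel w \<and> (AE x in ?M. w x = u n x) \<and> TV UNIV w \<le> ennreal W \<and>
      (\<integral>\<^sup>+x. ennreal \<bar>w x\<bar> \<partial>lborel) \<le> ennreal W" for n w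
  have "\<exists>w. Q n w" for n
    using bspec[OF C(2) uBV[of n]] norm[of n] unfolding Q_def by (blast intro: order_trans)
  then obtain w where "\<And>n. Q n (w n)" using choice[of Q] by auto
  then have w: "integrable lborel (w n)" "AE x in ?M. w n x = u n x" "TV UNIV (w n) \<le> ennreal W"
      "(\<integral>\<^sup>+x. ennreal \<bar>w n x\<bar> \<partial>lborel) \<le> ennreal W" for n
    unfolding Q_def by auto
  obtain d where d: "strict_mono (d :: nat \<Rightarrow> nat)"
    "\<forall>e>0. \<exists>N. \<forall>m\<ge>N. \<forall>n\<ge>N. (\<integral>\<^sup>+x. ennreal \<bar>w (d m) x - w (d n) x\<bar> \<partial>?M) \<le> ennreal e"
    by (rule BV_Cauchy_subsequence[OF op bd w(1,4,3) W])
  have eq: "(\<integral>\<^sup>+x. ennreal \<bar>w m x - w n x\<bar> \<partial>?M) = (\<integral>\<^sup>+x. ennreal \<bar>u m x - u n x\<bar> \<partial>?M)" for m n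
  proof (rule nn_integral_cong_AE)
    show "AE x in ?M. ennreal \<bar>w m x - w n x\<bar> = ennreal \<bar>u m x - u n x\<bar>"
      using w(2)[of m] w(2)[of n] by eventually_elim simp
  qed
  obtain r l where rl: "strict_mono (r :: nat \<Rightarrow> nat)" "l \<in> borel_measurable ?M" "AE x in ?M. (\<lambda>n. u (d (r n)) x) \<longlonglongrightarrow> l x"
    by (rule L1_Cauchy_AE_subsequence[where f="\<lambda>n. u (d n)" and M="?M", OF um d(2)[unfolded eq, rule_format]])
  have Kall: "AE x in ?M. \<forall>n. \<bar>u n x\<bar> \<le> K" using K by (simp add: AE_all_countable)
  have lK: "AE x in ?M. \<bar>l x\<bar> \<le> K"
    using rl(3) Kall
  proof eventually_elim
    case (elim x)
    then have "(\<lambda>n. \<bar>u (d (r n)) x\<bar>) \<longlonglongrightarrow> \<bar>l x\<bar>" by (intro tendsto_rabs)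
    then show ?case by (rule LIMSEQ_le_const2) (use elim(2) in auto)
  qed
  have lL: "l \<in> L2 \<Omega>"
  proof -
    have "sq_integral ?M l \<le> (\<integral>\<^sup>+x. ennreal (K\<^sup>2) \<partial>?M)"
      unfolding sq_integral_def
    proof (rule nn_integral_mono_AE)
      show "AE x in ?M. ennreal ((norm (l x))\<^sup>2) \<le> ennreal (K\<^sup>2)"
        using lK by eventually_elim (intro ennreal_leI power_mono, simp_all)
    qed
    also have "\<dots> < \<infinity>" using \<mu> by (simp add: ennreal_mult_less_top)
    finally show ?thesis using rl(2) by (simp add: Lp_2_iff)
  qed
  have "(\<lambda>n. \<integral>\<^sup>+x. ennreal ((norm (u (d (r n)) x - l x))\<^sup>2) \<partial>?M) \<longlonglongrightarrow> (\<integral>\<^sup>+x. 0 \<partial>?M)"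
  proof (rule nn_integral_dominated_convergence[where w="\<lambda>x. ennreal ((2 * K)\<^sup>2)"])
    show "(\<lambda>x. ennreal ((norm (u (d (r n)) x - l x))\<^sup>2)) \<in> borel_measurable ?M" for n
      using um rl(2) by measurable
    show "AE x in ?M. ennreal ((norm (u (d (r n)) x - l x))\<^sup>2) \<le> ennreal ((2 * K)\<^sup>2)" for n
      using Kall lK
    proof eventually_elim
      case (elim x)
      then have "\<bar>u (d (r n)) x\<bar> \<le> K" "\<bar>l x\<bar> \<le> K" by blast+
      then have "norm (u (d (r n)) x - l x) \<le> 2 * K"
        unfolding real_norm_def using abs_triangle_ineq4[of "u (d (r n)) x" "l x"] by linarith
      then show ?case by (intro ennreal_leI power_mono) auto
    qed
    show "(\<integral>\<^sup>+x. ennreal ((2 * K)\<^sup>2) \<partial>?M) < \<infinity>" using \<mu> by (simp add: ennreal_mult_less_top)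
    show "AE x in ?M. (\<lambda>n. ennreal ((norm (u (d (r n)) x - l x))\<^sup>2)) \<longlonglongrightarrow> 0"
      using rl(3)
    proof eventually_elim
      case (elim x)
      then have "(\<lambda>n. (norm (u (d (r n)) x - l x))\<^sup>2) \<longlonglongrightarrow> (norm (l x - l x))\<^sup>2" by (intro tendsto_intros)
      then show ?case using tendsto_ennrealI by fastforce
    qed
  qed auto
  then have "(\<lambda>n. sq_integral ?M (\<lambda>x. u ((d \<circ> r) n) x - l x)) \<longlonglongrightarrow> 0" by (simp add: sq_integral_def)
  then show ?thesis by (rule that[OF strict_mono_o[OF d(1) rl(1)] lL])
qed

text \<open>The library criterion for compactness is stated for metric spaces, so it is applied to a system
  of representatives of the classes of almost everywhere equal functions.\<close>

lemma compactin_L2_topology: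
  fixes \<Omega> :: "(real^'n) set" and K :: "(real^'n \<Rightarrow> real) set"
  defines "N \<equiv> \<lambda>u v. Lp_norm 2 (lebesgue_on \<Omega>) (\<lambda>x. u x - v x)"
  assumes K: "K \<subseteq> L2 \<Omega>"
    and seq: "\<And>\<sigma>::nat \<Rightarrow> real^'n \<Rightarrow> real. range \<sigma> \<subseteq> K \<Longrightarrow>
      \<exists>l r. l \<in> K \<and> strict_mono r \<and> (\<forall>e>0. eventually (\<lambda>n. N (\<sigma> (r n)) l < ennreal e) sequentially)"
  shows "compactin (L2_topology \<Omega>) K"
proof -
  have tri: "N a c \<le> N a b + N b c" if "a \<in> L2 \<Omega>" "b \<in> L2 \<Omega>" "c \<in> L2 \<Omega>" for a b c
    unfolding N_def using that by (intro Lp_norm_2_triangle_diff) (auto simp: Lp_def)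
  have comm: "N a b = N b a" for a b unfolding N_def by (rule Lp_norm_2_minus_commute)
  have fin: "N a b < \<infinity>" if "a \<in> L2 \<Omega>" "b \<in> L2 \<Omega>" for a b
    using Lp_2_diff[OF that] by (simp add: N_def Lp_def)
  have refl: "N a a = 0" for a by (simp add: N_def Lp_norm_2 sq_integral_def)
  \<comment> \<open>The choice depends on the class of \<open>u\<close> alone: functions at distance
    0 satisfy the same predicate, so \<open>SOME\<close> returns the same representative. On these
    representatives the seminorm distance is a metric.\<close>
  define rep where "rep u = (SOME v. v \<in> L2 \<Omega> \<and> N v u = 0)" for u
  have rep: "rep u \<in> L2 \<Omega>" "N (rep u) u = 0" if "u \<in> L2 \<Omega>" for u
  proof -
    have "\<exists>v. v \<in> L2 \<Omega> \<and> N v u = 0" using that refl by blast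
    from someI_ex[OF this] show "rep u \<in> L2 \<Omega>" "N (rep u) u = 0" unfolding rep_def by auto
  qed
  have N0: "N a c = 0" if "N a b = 0" "N b c = 0" "a \<in> L2 \<Omega>" "b \<in> L2 \<Omega>" "c \<in> L2 \<Omega>" for a b c
    using tri[OF that(3,4,5)] that(1,2) by simp
  have rep_eq: "rep u = rep v" if "N u v = 0" "u \<in> L2 \<Omega>" "v \<in> L2 \<Omega>" for u v
  proof -
    have "(w \<in> L2 \<Omega> \<and> N w u = 0) = (w \<in> L2 \<Omega> \<and> N w v = 0)" for w
      using N0[of w u v] N0[of w v u] that comm[of v u] by auto
    then show ?thesis unfolding rep_def by simp
  qed
  define X where "X = rep ` L2 \<Omega>"
  define d where "d a b = enn2real (N a b)" for a b
  have XL: "X \<subseteq> L2 \<Omega>" using rep(1) by (auto simp: X_def)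
  have Nd: "N a b = ennreal (d a b)" if "a \<in> L2 \<Omega>" "b \<in> L2 \<Omega>" for a b
    using fin[OF that] by (simp add: d_def)
  interpret Metric_space X d
  proof
    show "0 \<le> d x y" for x y by (simp add: d_def)
    show "d x y = d y x" for x y by (simp add: d_def comm[of x y])
    show "(d x y = 0) = (x = y)" if xy: "x \<in> X" "y \<in> X" for x y
    proof
      assume "d x y = 0"
      then have xy0: "N x y = 0" using Nd[of x y] XL xy by auto
      obtain a b where ab: "a \<in> L2 \<Omega>" "x = rep a" "b \<in> L2 \<Omega>" "y = rep b" using xy by (auto simp: X_def)
      have "N a x = 0" using rep(2)[OF ab(1)] comm[of a x] ab(2) by simp
      then have "N a y = 0" using N0[of a x y] xy0 ab XL xy by auto
      then have "N a b = 0" using N0[of a y b] rep(2)[OF ab(3)] ab XL xy by auto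
      then show "x = y" using rep_eq[of a b] ab by simp
    qed (simp add: d_def refl)
    show "d x z \<le> d x y + d y z" if "x \<in> X" "y \<in> X" "z \<in> X" for x y z
    proof -
      have "x \<in> L2 \<Omega>" "y \<in> L2 \<Omega>" "z \<in> L2 \<Omega>" using that XL by auto
      from tri[OF this] Nd[OF this(1,3)] Nd[OF this(1,2)] Nd[OF this(2,3)]
      have "ennreal (d x z) \<le> ennreal (d x y) + ennreal (d y z)" by simp
      also have "\<dots> = ennreal (d x y + d y z)" by (intro ennreal_plus[symmetric]) (auto simp: d_def)
      finally show ?thesis by (subst (asm) ennreal_le_iff) (auto simp: d_def)
    qed
  qed
  \<comment> \<open>Open sets are unions of classes. This lets covers be carried from
    \<open>K\<close> to the representatives and back.\<close>
  have ball: "y \<in> U" if U: "openin (L2_topology \<Omega>) U" "x \<in> U" and y: "y \<in> L2 \<Omega>" "N y x = 0" for U x y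
  proof -
    obtain r where "r > (0::real)" "\<And>v. v \<in> L2 \<Omega> \<Longrightarrow> N v x < ennreal r \<Longrightarrow> v \<in> U"
      using U unfolding openin_L2_topology N_def by blast
    then show ?thesis using y by simp
  qed
  have opm: "openin mtopology (U \<inter> X)" if U: "openin (L2_topology \<Omega>) U" for U
    unfolding openin_mtopology
  proof (intro conjI allI impI)
    fix x assume x: "x \<in> U \<inter> X"
    then obtain r where r: "r > (0::real)" "\<And>v. v \<in> L2 \<Omega> \<Longrightarrow> N v x < ennreal r \<Longrightarrow> v \<in> U"
      using U unfolding openin_L2_topology N_def by blast
    have "mball x r \<subseteq> U \<inter> X"
    proof
      fix y assume "y \<in> mball x r"
      then have y: "y \<in> X" "d x y < r" by (auto simp: in_mball)
      have "x \<in> L2 \<Omega>" "y \<in> L2 \<Omega>" using x y(1) XL by auto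
      from Nd[OF this] have "N x y < ennreal r" using y(2) r(1) by (simp add: ennreal_lessI)
      then have "N y x < ennreal r" by (simp only: comm[of y x])
      then show "y \<in> U \<inter> X" using r(2)[of y] y(1) XL by auto
    qed
    then show "\<exists>r>0. mball x r \<subseteq> U \<inter> X" using r(1) by blast
  qed simp
  have comp: "compactin mtopology (rep ` K)"
    unfolding compactin_sequentially
  proof (intro conjI allI impI)
    show "rep ` K \<subseteq> X" using K by (auto simp: X_def)
    fix \<sigma> :: "nat \<Rightarrow> real^'n \<Rightarrow> real" assume "range \<sigma> \<subseteq> rep ` K"
    then have "\<forall>n. \<exists>t. t \<in> K \<and> \<sigma> n = rep t" by blast
    from choice[OF this] obtain \<tau> where \<tau>: "\<And>n. \<tau> n \<in> K" "\<And>n. \<sigma> n = rep (\<tau> n)" by auto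
    then have "range \<tau> \<subseteq> K" by auto
    from seq[OF this] obtain l r where lr: "l \<in> K" "strict_mono r" "\<And>e. e > 0 \<Longrightarrow> eventually (\<lambda>n. N (\<tau> (r n)) l < ennreal e) sequentially"
      by blast
    have lL: "l \<in> L2 \<Omega>" and tL: "\<tau> n \<in> L2 \<Omega>" for n using lr(1) \<tau>(1) K by auto
    show "\<exists>l r. l \<in> rep ` K \<and> strict_mono r \<and> limitin mtopology (\<sigma> \<circ> r) l sequentially"
    proof (intro exI[of _ "rep l"] exI[of _ r] conjI)
      show "limitin mtopology (\<sigma> \<circ> r) (rep l) sequentially"
        unfolding limitin_metric
      proof (intro conjI allI impI)
        show "rep l \<in> X" using lL by (simp add: X_def)
        fix e :: real assume e: "e > 0"
        from lr(3)[OF e] show "eventually (\<lambda>n. (\<sigma> \<circ> r) n \<in> X \<and> d ((\<sigma> \<circ> r) n) (rep l) < e) sequentially"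
        proof eventually_elim
          case (elim n)
          let ?t = "\<tau> (r n)"
          have "N (rep ?t) (rep l) \<le> N (rep ?t) ?t + N ?t (rep l)" by (rule tri[OF rep(1)[OF tL] tL rep(1)[OF lL]])
          also have "\<dots> \<le> N (rep ?t) ?t + (N ?t l + N l (rep l))" by (intro add_left_mono tri[OF tL lL rep(1)[OF lL]])
          also have "\<dots> = N ?t l" using rep(2)[OF tL] rep(2)[OF lL] comm[of l "rep l"] by simp
          also have "\<dots> < ennreal e" by (rule elim)
          finally have "ennreal (d (rep ?t) (rep l)) < ennreal e" using Nd[OF rep(1)[OF tL] rep(1)[OF lL]] by simp
          then have "d (rep ?t) (rep l) < e" by (subst (asm) ennreal_less_iff) (auto simp: d_def)
          then show ?case using tL by (auto simp: \<tau>(2) X_def)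
        qed
      qed
    qed (use lr in auto)
  qed
  show ?thesis
    unfolding compactin_def
  proof (intro conjI allI impI)
    show "K \<subseteq> topspace (L2_topology \<Omega>)" using K by simp
    fix \<U> assume "(\<forall>U\<in>\<U>. openin (L2_topology \<Omega>) U) \<and> K \<subseteq> \<Union>\<U>"
    then have U: "\<And>U. U \<in> \<U> \<Longrightarrow> openin (L2_topology \<Omega>) U" "K \<subseteq> \<Union>\<U>" by auto
    have cov: "rep ` K \<subseteq> \<Union>((\<lambda>U. U \<inter> X) ` \<U>)"
    proof
      fix y assume "y \<in> rep ` K"
      then obtain x where x: "x \<in> K" "y = rep x" by auto
      then obtain V where V: "V \<in> \<U>" "x \<in> V" using U(2) by auto
      have "x \<in> L2 \<Omega>" using x K by auto
      then have "y \<in> V \<inter> X" using ball[OF U(1)[OF V(1)] V(2) rep(1) rep(2)] x by (auto simp: X_def)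
      then show "y \<in> \<Union>((\<lambda>U. U \<inter> X) ` \<U>)" using V(1) by auto
    qed
    have opV: "\<forall>V\<in>(\<lambda>U. U \<inter> X) ` \<U>. openin mtopology V" using opm U(1) by auto
    have "\<exists>\<F>. finite \<F> \<and> \<F> \<subseteq> (\<lambda>U. U \<inter> X) ` \<U> \<and> rep ` K \<subseteq> \<Union>\<F>"
      by (rule comp[unfolded compactin_def, THEN conjunct2, THEN spec, THEN mp, OF conjI[OF opV cov]])
    then obtain \<F> where F: "finite \<F>" "\<F> \<subseteq> (\<lambda>U. U \<inter> X) ` \<U>" "rep ` K \<subseteq> \<Union>\<F>"
      by blast
    from finite_subset_image[OF F(1,2)] obtain \<G> where G: "\<G> \<subseteq> \<U>" "finite \<G>" "\<F> = (\<lambda>U. U \<inter> X) ` \<G>" by auto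
    have "K \<subseteq> \<Union>\<G>"
    proof
      fix x assume x: "x \<in> K"
      then have xL: "x \<in> L2 \<Omega>" using K by auto
      have "rep x \<in> \<Union>\<F>" using x F(3) by auto
      then obtain V where V: "V \<in> \<G>" "rep x \<in> V" using G(3) by auto
      have "N x (rep x) = 0" using rep(2)[OF xL] comm[of x "rep x"] by simp
      then have "x \<in> V" using ball[OF U(1) V(2) xL] V(1) G(1) by auto
      then show "x \<in> \<Union>\<G>" using V(1) by auto
    qed
    then show "\<exists>\<F>. finite \<F> \<and> \<F> \<subseteq> \<U> \<and> K \<subseteq> \<Union>\<F>" using G(1,2) by blast
  qed
qed

text \<open>The terms of a sequence in the closure are not known to satisfy the bounds, so the n-th
  term is replaced by an element of \<open>S\<close> within 1 / (n + 1). A limit of the replacements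
  along a subsequence is also a limit of the original terms, and it lies in the closure.\<close>

lemma relatively_compact_L2:
  fixes \<Omega> :: "(real^'n) set" and S :: "(real^'n \<Rightarrow> real) set"
  assumes bd: "bounded \<Omega>" and ext: "extension_domain \<Omega>" and S: "S \<subseteq> L2 \<Omega>"
    and K: "\<And>u. u \<in> S \<Longrightarrow> AE x in lebesgue_on \<Omega>. \<bar>u x\<bar> \<le> K" and TV: "\<And>u. u \<in> S \<Longrightarrow> TV \<Omega> u \<le> ennreal V" and V: "V \<ge> 0" "K \<ge> 0"
  shows "relatively_compact_in (L2_topology \<Omega>) S"
  unfolding relatively_compact_in_def
proof
  let ?N = "\<lambda>u v. Lp_norm 2 (lebesgue_on \<Omega>) (\<lambda>x. u x - v x)" and ?X = "L2_topology \<Omega>"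
  show "S \<subseteq> topspace ?X" using S by simp
  have clL: "?X closure_of S \<subseteq> L2 \<Omega>" using closure_of_subset_topspace[of ?X S] by simp
  show "compactin ?X (?X closure_of S)"
  proof (rule compactin_L2_topology[OF clL])
    fix \<sigma> :: "nat \<Rightarrow> real^'n \<Rightarrow> real" assume \<sigma>: "range \<sigma> \<subseteq> ?X closure_of S"
    then have \<sigma>L: "\<sigma> n \<in> L2 \<Omega>" for n using clL by auto
    have "\<exists>s. s \<in> S \<and> ?N s (\<sigma> n) < ennreal (1 / real (Suc n))" for n
    proof -
      let ?B = "{v\<in>L2 \<Omega>. ?N v (\<sigma> n) < ennreal (1 / real (Suc n))}"
      have "\<sigma> n \<in> ?B" using \<sigma>L[of n] by (simp add: Lp_norm_2 sq_integral_def)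
      moreover have "openin ?X ?B" by (rule openin_L2_ball[OF \<sigma>L])
      moreover have "\<sigma> n \<in> ?X closure_of S" using \<sigma> by auto
      ultimately have "\<exists>y. y \<in> S \<and> y \<in> ?B" by (simp only: in_closure_of)
      then show ?thesis by blast
    qed
    then have "\<forall>n. \<exists>s. s \<in> S \<and> ?N s (\<sigma> n) < ennreal (1 / real (Suc n))" by blast
    from choice[OF this] obtain s where s: "\<And>n. s n \<in> S" "\<And>n. ?N (s n) (\<sigma> n) < ennreal (1 / real (Suc n))" by auto
    have sL: "s n \<in> L2 \<Omega>" for n using s(1) S by auto
    obtain r l where rl: "strict_mono (r :: nat \<Rightarrow> nat)" "l \<in> L2 \<Omega>"
      "(\<lambda>n. sq_integral (lebesgue_on \<Omega>) (\<lambda>x. s (r n) x - l x)) \<longlonglongrightarrow> 0"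
      by (rule L2_convergent_subsequence[OF bd ext sL K[OF s(1)] TV[OF s(1)] V])
    have conv: "eventually (\<lambda>n. ?N (s (r n)) l < ennreal e) sequentially" if "e > 0" for e
      using order_tendstoD(2)[OF rl(3), of "ennreal (e\<^sup>2)"] that by (simp add: Lp_norm_2_less_iff)
    have lcl: "l \<in> ?X closure_of S"
      unfolding in_closure_of
    proof (intro conjI allI impI)
      show "l \<in> topspace ?X" using rl(2) by simp
      fix T assume "l \<in> T \<and> openin ?X T"
      then obtain e where e: "e > (0::real)" "\<And>v. v \<in> L2 \<Omega> \<Longrightarrow> ?N v l < ennreal e \<Longrightarrow> v \<in> T"
        unfolding openin_L2_topology by blast
      from conv[OF e(1)] obtain n where "?N (s (r n)) l < ennreal e" by (auto simp: eventually_sequentially)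
      then show "\<exists>y. y \<in> S \<and> y \<in> T" using e(2)[OF sL] s(1) by blast
    qed
    have "eventually (\<lambda>n. ?N (\<sigma> (r n)) l < ennreal e) sequentially" if e: "e > 0" for e
    proof -
      have small: "eventually (\<lambda>n. inverse (real (Suc n)) < e / 2) sequentially"
        using LIMSEQ_inverse_real_of_nat e by (intro order_tendstoD(2)) auto
      have "e / 2 > 0" using e by simp
      from small conv[OF this] show ?thesis
      proof eventually_elim
        case n: (elim n)
        have "n \<le> r n" using rl(1) by (rule seq_suble)
        then have "1 / real (Suc (r n)) \<le> 1 / real (Suc n)" by (simp add: field_simps)
        also have "\<dots> < e / 2" using n(1) by (simp add: inverse_eq_divide)
        finally have "ennreal (1 / real (Suc (r n))) \<le> ennreal (e / 2)" by (intro ennreal_leI) simp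
        then have 1: "?N (\<sigma> (r n)) (s (r n)) < ennreal (e / 2)"
          using s(2)[of "r n"] by (subst Lp_norm_2_minus_commute) (rule order_less_le_trans)
        have "?N (\<sigma> (r n)) l \<le> ?N (\<sigma> (r n)) (s (r n)) + ?N (s (r n)) l"
          using \<sigma>L sL rl(2) by (intro Lp_norm_2_triangle_diff) (auto simp: Lp_def)
        also have "\<dots> < ennreal (e / 2) + ennreal (e / 2)" using 1 n(2) by (rule add_strict_mono)
        also have "\<dots> = ennreal e" using e by (simp add: ennreal_plus[symmetric] del: ennreal_plus)
        finally show "?N (\<sigma> (r n)) l < ennreal e" .
      qed
    qed
    then show "\<exists>l r. l \<in> ?X closure_of S \<and> strict_mono r \<and> (\<forall>e>0. eventually (\<lambda>n. ?N (\<sigma> (r n)) l < ennreal e) sequentially)"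
      using lcl rl(1) by blast
  qed
qed

theorem theorem2p1:
  fixes \<Omega> :: "(real^'n) set"
  assumes "bounded \<Omega>" and "extension_domain \<Omega>"
  shows "Gamma_converges (L2_topology \<Omega>) (\<lambda>\<epsilon>. energy \<Omega> (phi \<epsilon>)) (TV \<Omega>) \<and>
    Gamma_converges (L2_topology \<Omega>) (\<lambda>\<epsilon>. energy \<Omega> (convexification (phi \<epsilon>))) (TV \<Omega>) \<and>
    (\<forall>u :: real \<Rightarrow> real^'n \<Rightarrow> real.
       (\<forall>\<epsilon>\<in>{0<..<1}. u \<epsilon> \<in> L2 \<Omega>) \<and>
       (SUP \<epsilon>\<in>{0<..<1}. Lp_norm \<infinity> (lebesgue_on \<Omega>) (u \<epsilon>)
          + energy \<Omega> (convexification (phi \<epsilon>)) (u \<epsilon>)) < \<infinity> \<longrightarrow>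
       relatively_compact_in (L2_topology \<Omega>) (u ` {0<..<1}))"
proof -
  have op: "open \<Omega>" using assms(2) by (simp add: extension_domain_def)
  \<comment> \<open>The convexified energy is the smaller one, so its liminf inequality implies that
    of the original energy, and a recovery family for the original energy serves the convexified
    one.\<close>
  have le: "eventually (\<lambda>\<epsilon>. energy \<Omega> (convexification (phi \<epsilon>)) (v \<epsilon>) \<le> energy \<Omega> (phi \<epsilon>) (v \<epsilon>)) (at_right 0)" for v
    using eventually_at_right_less[of "0::real"] by eventually_elim (rule energy_convexification_le)
  have liminf: "TV \<Omega> u \<le> Liminf (at_right 0) (\<lambda>\<epsilon>. energy \<Omega> (convexification (phi \<epsilon>)) (v \<epsilon>))"
      "TV \<Omega> u \<le> Liminf (at_right 0) (\<lambda>\<epsilon>. energy \<Omega> (phi \<epsilon>) (v \<epsilon>))"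
    if "u \<in> L2 \<Omega>" "limitin (L2_topology \<Omega>) v u (at_right 0)" for u v
  proof -
    show 1: "TV \<Omega> u \<le> Liminf (at_right 0) (\<lambda>\<epsilon>. energy \<Omega> (convexification (phi \<epsilon>)) (v \<epsilon>))"
      by (rule liminf_inequality[OF op assms(1) that])
    show "TV \<Omega> u \<le> Liminf (at_right 0) (\<lambda>\<epsilon>. energy \<Omega> (phi \<epsilon>) (v \<epsilon>))"
      by (rule order_trans[OF 1 Liminf_mono[OF le]])
  qed
  have limsup: "\<exists>v. (\<forall>\<epsilon>. v \<epsilon> \<in> L2 \<Omega>) \<and> limitin (L2_topology \<Omega>) v u (at_right 0) \<and>
      Limsup (at_right 0) (\<lambda>\<epsilon>. energy \<Omega> (phi \<epsilon>) (v \<epsilon>)) \<le> TV \<Omega> u \<and>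
      Limsup (at_right 0) (\<lambda>\<epsilon>. energy \<Omega> (convexification (phi \<epsilon>)) (v \<epsilon>)) \<le> TV \<Omega> u" if u: "u \<in> L2 \<Omega>" for u
  proof -
    obtain v where v: "\<And>\<epsilon>. v \<epsilon> \<in> L2 \<Omega>" "limitin (L2_topology \<Omega>) v u (at_right 0)"
      "Limsup (at_right 0) (\<lambda>\<epsilon>. energy \<Omega> (phi \<epsilon>) (v \<epsilon>)) \<le> TV \<Omega> u"
      by (rule recovery_sequence[OF assms u], rule that; assumption)
    then show ?thesis using order_trans[OF Limsup_mono[OF le] v(3)] by blast
  qed
  have "Gamma_converges (L2_topology \<Omega>) (\<lambda>\<epsilon>. energy \<Omega> (phi \<epsilon>)) (TV \<Omega>)"
    unfolding Gamma_converges_def topspace_L2_topology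
  proof (intro ballI conjI allI impI)
    show "TV \<Omega> u \<le> Liminf (at_right 0) (\<lambda>\<epsilon>. energy \<Omega> (phi \<epsilon>) (v \<epsilon>))"
      if "u \<in> L2 \<Omega>" "(\<forall>\<epsilon>\<in>{0<..<1}. v \<epsilon> \<in> L2 \<Omega>) \<and> limitin (L2_topology \<Omega>) v u (at_right 0)" for u v
      using liminf(2)[OF that(1), of v] that(2) by blast
  qed (use limsup in blast)
  moreover have "Gamma_converges (L2_topology \<Omega>) (\<lambda>\<epsilon>. energy \<Omega> (convexification (phi \<epsilon>))) (TV \<Omega>)"
    unfolding Gamma_converges_def topspace_L2_topology
  proof (intro ballI conjI allI impI)
    show "TV \<Omega> u \<le> Liminf (at_right 0) (\<lambda>\<epsilon>. energy \<Omega> (convexification (phi \<epsilon>)) (v \<epsilon>))"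
      if "u \<in> L2 \<Omega>" "(\<forall>\<epsilon>\<in>{0<..<1}. v \<epsilon> \<in> L2 \<Omega>) \<and> limitin (L2_topology \<Omega>) v u (at_right 0)" for u v
      using liminf(1)[OF that(1), of v] that(2) by blast
  qed (use limsup in blast)
  moreover have "relatively_compact_in (L2_topology \<Omega>) (u ` {0<..<1})"
    if uL: "\<forall>\<epsilon>\<in>{0<..<1}. u \<epsilon> \<in> L2 \<Omega>" and sup: "(SUP \<epsilon>\<in>{0<..<1}. Lp_norm \<infinity> (lebesgue_on \<Omega>) (u \<epsilon>)
          + energy \<Omega> (convexification (phi \<epsilon>)) (u \<epsilon>)) < \<infinity>" for u :: "real \<Rightarrow> real^'n \<Rightarrow> real"
  proof -
    let ?\<mu> = "measure (lebesgue_on \<Omega>) \<Omega>"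
    define E where "E = (SUP \<epsilon>\<in>{0<..<1}. Lp_norm \<infinity> (lebesgue_on \<Omega>) (u \<epsilon>)
          + energy \<Omega> (convexification (phi \<epsilon>)) (u \<epsilon>))"
    have "E < \<infinity>" using sup by (simp only: E_def)
    then obtain K where K: "K \<ge> 0" "E = ennreal K" by (cases E) auto
    have Ke: "Lp_norm \<infinity> (lebesgue_on \<Omega>) (u \<epsilon>) + energy \<Omega> (convexification (phi \<epsilon>)) (u \<epsilon>) \<le> ennreal K" if "\<epsilon> \<in> {0<..<1}" for \<epsilon>
      unfolding K(2)[symmetric] E_def using that by (rule SUP_upper)
    \<comment> \<open>The bound holds for every \<epsilon> in (0, 1), because the whole family and
      not only its tail is to be compact.\<close>
    obtain C where C: "C \<ge> 0" "\<And>\<epsilon> \<sigma>. 0 < \<epsilon> \<Longrightarrow> \<epsilon> < 1 \<Longrightarrow> 1 / 2 * \<bar>\<sigma>\<bar> - C \<le> phi \<epsilon> \<sigma>"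
      using phi_lower_bound_uniform by metis
    show ?thesis
    proof (rule relatively_compact_L2[OF assms])
      show "u ` {0<..<1} \<subseteq> L2 \<Omega>" using uL by auto
      show "AE x in lebesgue_on \<Omega>. \<bar>w x\<bar> \<le> K" if w: "w \<in> u ` {0<..<1}" for w
      proof -
        obtain \<epsilon> where e: "\<epsilon> \<in> {0<..<1}" "w = u \<epsilon>" using w by auto
        have "Lp_norm \<infinity> (lebesgue_on \<Omega>) w \<le> ennreal K"
          unfolding e(2) using Ke[OF e(1)] by (rule order_trans[rotated]) simp
        then have "esssup (lebesgue_on \<Omega>) (\<lambda>x. ennreal (norm (w x))) \<le> ennreal K" by (simp add: Lp_norm_def)
        moreover have "AE x in lebesgue_on \<Omega>. ennreal (norm (w x)) \<le> esssup (lebesgue_on \<Omega>) (\<lambda>x. ennreal (norm (w x)))"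
          by (rule esssup_AE)
        ultimately have "AE x in lebesgue_on \<Omega>. ennreal (norm (w x)) \<le> ennreal K"
          by (auto elim!: eventually_mono intro: order_trans)
        then show ?thesis using K(1) by simp
      qed
      \<comment> \<open>The slope 1/2 of the minorant gives the factor 2, and the offset
        \<open>C\<close> integrates to \<open>C\<close> times the measure of the domain.\<close>
      show "TV \<Omega> w \<le> ennreal (2 * (K + C * ?\<mu>))" if w: "w \<in> u ` {0<..<1}" for w
      proof -
        obtain \<epsilon> where e: "\<epsilon> \<in> {0<..<1}" "w = u \<epsilon>" using w by auto
        have E: "energy \<Omega> (convexification (phi \<epsilon>)) w \<le> ennreal K"
          unfolding e(2) using Ke[OF e(1)] by (rule order_trans[rotated]) simp
        have "ennreal (1 / 2) * TV \<Omega> w \<le> energy \<Omega> (convexification (phi \<epsilon>)) w + ennreal (C * ?\<mu>)"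
          using e(1) C by (intro TV_le_energy_convexification[OF op assms(1)]) auto
        also have "\<dots> \<le> ennreal K + ennreal (C * ?\<mu>)" by (intro add_right_mono E)
        also have "\<dots> = ennreal (K + C * ?\<mu>)" using K(1) C(1) by (intro ennreal_plus[symmetric]) auto
        finally have "ennreal 2 * (ennreal (1 / 2) * TV \<Omega> w) \<le> ennreal 2 * ennreal (K + C * ?\<mu>)" by (rule mult_left_mono) simp
        moreover have "ennreal 2 * (ennreal (1 / 2) * TV \<Omega> w) = TV \<Omega> w"
        proof -
          have "ennreal 2 * ennreal (1 / 2) = ennreal (2 * (1 / 2))" by (rule ennreal_mult[symmetric]) auto
          then show ?thesis by (simp only: mult.assoc[symmetric]) simp
        qed
        moreover have "ennreal 2 * ennreal (K + C * ?\<mu>) = ennreal (2 * (K + C * ?\<mu>))"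
          using K(1) C(1) by (intro ennreal_mult[symmetric]) auto
        ultimately show ?thesis by (simp only:)
      qed
      show "0 \<le> 2 * (K + C * ?\<mu>)" using K(1) C(1) by simp
      show "0 \<le> K" by (rule K(1))
    qed
  qed
  ultimately show ?thesis by blast
qed

end
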